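(* Let $n\ge1$ and $0\le r\le n$ be integers and let $\Lambda\in M_n(k^* )$ be multiplicatively antisymmetric. Then the quantum torus $\mathcal O_\Lambda({k^*}^n)$ is a maximal quantum sub-torus of $\operatorname{Frac}(S_{n,r}^{\Lambda}(k))$.
   Context: $k$ is a field of characteristic $0$; all morphisms are morphisms of $k$-algebras. A matrix $\Lambda=(\lambda_{i,j})\in M_n(k^* )$ is multiplicatively antisymmetric if $\lambda_{i,j}\lambda_{j,i}=\lambda_{i,i}=1$ for all $i,j$. The quantum torus $\mathcal O_\Lambda({k^*}^n)=k_\Lambda[y_1^{\pm1},\dots,y_n^{\pm1}]$ is the $k$-algebra generated by $y_1^{\pm1},\dots,y_n^{\pm1}$ with relations $y_iy_j=\lambda_{i,j}y_jy_i$. $\mathcal O_\Lambda({k^*}^n)$ is called a maximal quantum sub-torus of a $k$-algebra $A$ if (1) $A$ has a subalgebra $k$-isomorphic to $\mathcal O_\Lambda({k^*}^n)$; and (2) for every quantum torus $\mathcal O_M({k^*}^m)$, with $m\ge1$ and $M\in M_m(k^* )$ multiplicatively antisymmetric, if there exists an algebra morphism $\mathcal O_M({k^*}^m)\to A$, then there exists an algebra morphism $\mathcal O_M({k^*}^m)\to\mathcal O_\Lambda({k^*}^n)$. For integers $n\ge1$, $0\le r\le n$ and multiplicatively antisymmetric $\Lambda$, $S_{n,r}^{\Lambda}(k)$ is the $k$-algebra generated by $y_1,\dots,y_n,x_1,\dots,x_r$ with relations: $y_iy_j=\lambda_{i,j}y_jy_i$ ($1\le i,j\le n$); $x_iy_i=y_ix_i+1$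 ($1\le i\le r$); $x_iy_j=\lambda_{i,j}^{-1}y_jx_i$ ($1\le i\le r$, $1\le j\le n$, $i\ne j$); $x_ix_j=\lambda_{i,j}x_jx_i$ ($1\le i,j\le r$). It is a noetherian domain and $\operatorname{Frac}$ denotes its skew field of fractions. *)

theory Defs
  imports
    "HOL-Algebra.QuotRing"
    "HOL-Algebra.Module"
    "HOL-Algebra.Subrings"
begin

text \<open>
  An algebra over \<^term>\<open>K\<close> is a record of type \<^typ>\<open>('k, 'a, 'm) module_scheme\<close>, as in
  \<^theory>\<open>HOL-Algebra.Module\<close>. The library locale \<^locale>\<open>algebra\<close> is restricted to commutative
  algebras and therefore cannot be used here.
\<close>

definition assoc_algebra :: "('k, 'e) ring_scheme \<Rightarrow> ('k, 'a, 'm) module_scheme \<Rightarrow> bool" where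
  "assoc_algebra K A \<longleftrightarrow>
     module K A \<and> ring A \<and>
     (\<forall>c\<in>carrier K. \<forall>x\<in>carrier A. \<forall>y\<in>carrier A.
        (c \<odot>\<^bsub>A\<^esub> x) \<otimes>\<^bsub>A\<^esub> y = c \<odot>\<^bsub>A\<^esub> (x \<otimes>\<^bsub>A\<^esub> y) \<and>
        x \<otimes>\<^bsub>A\<^esub> (c \<odot>\<^bsub>A\<^esub> y) = c \<odot>\<^bsub>A\<^esub> (x \<otimes>\<^bsub>A\<^esub> y))"

definition assoc_algebra_hom ::
    "('k, 'e) ring_scheme \<Rightarrow> ('k, 'a, 'm) module_scheme \<Rightarrow> ('k, 'b, 'n) module_scheme \<Rightarrow> ('a \<Rightarrow> 'b) set"
  where
  "assoc_algebra_hom K A B =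
     {h \<in> ring_hom A B. \<forall>c\<in>carrier K. \<forall>x\<in>carrier A. h (c \<odot>\<^bsub>A\<^esub> x) = c \<odot>\<^bsub>B\<^esub> h x}"

definition assoc_algebra_iso ::
    "('k, 'e) ring_scheme \<Rightarrow> ('k, 'a, 'm) module_scheme \<Rightarrow> ('k, 'b, 'n) module_scheme \<Rightarrow> ('a \<Rightarrow> 'b) set"
  where
  "assoc_algebra_iso K A B =
     {h \<in> assoc_algebra_hom K A B. bij_betw h (carrier A) (carrier B)}"

definition assoc_subalgebra ::
    "('k, 'e) ring_scheme \<Rightarrow> 'a set \<Rightarrow> ('k, 'a, 'm) module_scheme \<Rightarrow> bool" where
  "assoc_subalgebra K B A \<longleftrightarrow>
     subring B A \<and> (\<forall>c\<in>carrier K. \<forall>x\<in>B. c \<odot>\<^bsub>A\<^esub> x \<in> B)"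

text \<open>
  The free algebra on a set \<^term>\<open>X\<close>: elements are the finitely supported coefficient functions on
  words over \<^term>\<open>X\<close>, and the product is convolution, where a word \<^term>\<open>w\<close> is split in all
  \<^term>\<open>length w + 1\<close> possible ways into a prefix and a suffix.
\<close>

definition free_algebra ::
    "('k, 'e) ring_scheme \<Rightarrow> 'x set \<Rightarrow> ('k, 'x list \<Rightarrow> 'k) module" where
  "free_algebra K X =
     \<lparr>carrier = {f. (\<forall>w. f w \<in> carrier K) \<and> finite {w. f w \<noteq> \<zero>\<^bsub>K\<^esub>} \<and>
                    (\<forall>w. f w \<noteq> \<zero>\<^bsub>K\<^esub> \<longrightarrow> w \<in> lists X)},
      mult = (\<lambda>f g w. \<Oplus>\<^bsub>K\<^esub>i\<in>{..length w}. f (take i w) \<otimes>\<^bsub>K\<^esub> g (drop i w)),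
      one = (\<lambda>w. if w = [] then \<one>\<^bsub>K\<^esub> else \<zero>\<^bsub>K\<^esub>),
      zero = (\<lambda>w. \<zero>\<^bsub>K\<^esub>),
      add = (\<lambda>f g w. f w \<oplus>\<^bsub>K\<^esub> g w),
      smult = (\<lambda>c f w. c \<otimes>\<^bsub>K\<^esub> f w)\<rparr>"

definition free_gen :: "('k, 'e) ring_scheme \<Rightarrow> 'x \<Rightarrow> 'x list \<Rightarrow> 'k" where
  "free_gen K x = (\<lambda>w. if w = [x] then \<one>\<^bsub>K\<^esub> else \<zero>\<^bsub>K\<^esub>)"

text \<open>
  The ring \<^term>\<open>FactRing A I\<close> with its induced scalar multiplication, written on cosets in the same
  style as \<^const>\<open>rcoset_mult\<close>. Ideals in HOL-Algebra are two-sided.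
\<close>

definition quotient_algebra ::
    "('k, 'a, 'm) module_scheme \<Rightarrow> 'a set \<Rightarrow> ('k, 'a set) module" where
  "quotient_algebra A I =
     \<lparr>carrier = carrier (FactRing A I),
      mult = mult (FactRing A I),
      one = one (FactRing A I),
      zero = zero (FactRing A I),
      add = add (FactRing A I),
      smult = (\<lambda>c C. \<Union>x\<in>C. I +>\<^bsub>A\<^esub> (c \<odot>\<^bsub>A\<^esub> x))\<rparr>"

text \<open>
  A relation \<open>u = v\<close> is represented by the pair \<^term>\<open>(u, v)\<close> of elements of the free algebra.
\<close>

definition presented_algebra ::
    "('k, 'e) ring_scheme \<Rightarrow> 'x set \<Rightarrow> (('x list \<Rightarrow> 'k) \<times> ('x list \<Rightarrow> 'k)) set \<Rightarrow>
     ('k, ('x list \<Rightarrow> 'k) set) module" where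
  "presented_algebra K X E =
     (let A = free_algebra K X
      in quotient_algebra A (Idl\<^bsub>A\<^esub> {u \<ominus>\<^bsub>A\<^esub> v |u v. (u, v) \<in> E}))"

text \<open>
  An \<open>n \<times> n\<close> matrix is a function on pairs of indices of which only the values at indices in
  \<^term>\<open>{1..n}\<close> are relevant.
\<close>

definition mult_antisymmetric :: "('k, 'e) ring_scheme \<Rightarrow> nat \<Rightarrow> (nat \<Rightarrow> nat \<Rightarrow> 'k) \<Rightarrow> bool" where
  "mult_antisymmetric K n \<Lambda> \<longleftrightarrow>
     (\<forall>i\<in>{1..n}. \<forall>j\<in>{1..n}.
        \<Lambda> i j \<in> carrier K - {\<zero>\<^bsub>K\<^esub>} \<and> \<Lambda> i j \<otimes>\<^bsub>K\<^esub> \<Lambda> j i = \<one>\<^bsub>K\<^esub> \<and> \<Lambda> i i = \<one>\<^bsub>K\<^esub>)"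

datatype torus_gen = TY nat | TYinv nat

definition quantum_torus ::
    "('k, 'e) ring_scheme \<Rightarrow> nat \<Rightarrow> (nat \<Rightarrow> nat \<Rightarrow> 'k) \<Rightarrow> ('k, (torus_gen list \<Rightarrow> 'k) set) module"
  where
  "quantum_torus K n \<Lambda> =
     (let X = TY ` {1..n} \<union> TYinv ` {1..n};
          A = free_algebra K X;
          y = (\<lambda>i. free_gen K (TY i));
          y' = (\<lambda>i. free_gen K (TYinv i))
      in presented_algebra K X
           ({(y i \<otimes>\<^bsub>A\<^esub> y' i, \<one>\<^bsub>A\<^esub>) |i. i \<in> {1..n}} \<union>
            {(y' i \<otimes>\<^bsub>A\<^esub> y i, \<one>\<^bsub>A\<^esub>) |i. i \<in> {1..n}} \<union>
            {(y i \<otimes>\<^bsub>A\<^esub> y j, \<Lambda> i j \<odot>\<^bsub>A\<^esub> (y j \<otimes>\<^bsub>A\<^esub> y i)) |i j. i \<in> {1..n} \<and> j \<in> {1..n}}))"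

definition maximal_quantum_subtorus ::
    "('k, 'e) ring_scheme \<Rightarrow> nat \<Rightarrow> (nat \<Rightarrow> nat \<Rightarrow> 'k) \<Rightarrow> ('k, 'a, 'm) module_scheme \<Rightarrow> bool" where
  "maximal_quantum_subtorus K n \<Lambda> A \<longleftrightarrow>
     (\<exists>B. assoc_subalgebra K B A \<and>
          assoc_algebra_iso K (quantum_torus K n \<Lambda>) (A\<lparr>carrier := B\<rparr>) \<noteq> {}) \<and>
     (\<forall>m M. m \<ge> 1 \<longrightarrow> mult_antisymmetric K m M \<longrightarrow>
          assoc_algebra_hom K (quantum_torus K m M) A \<noteq> {} \<longrightarrow>
          assoc_algebra_hom K (quantum_torus K m M) (quantum_torus K n \<Lambda>) \<noteq> {})"

datatype S_gen = SY nat | SX nat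

definition S_algebra ::
    "('k, 'e) ring_scheme \<Rightarrow> nat \<Rightarrow> nat \<Rightarrow> (nat \<Rightarrow> nat \<Rightarrow> 'k) \<Rightarrow> ('k, (S_gen list \<Rightarrow> 'k) set) module"
  where
  "S_algebra K n r \<Lambda> =
     (let X = SY ` {1..n} \<union> SX ` {1..r};
          A = free_algebra K X;
          y = (\<lambda>i. free_gen K (SY i));
          x = (\<lambda>i. free_gen K (SX i))
      in presented_algebra K X
           ({(y i \<otimes>\<^bsub>A\<^esub> y j, \<Lambda> i j \<odot>\<^bsub>A\<^esub> (y j \<otimes>\<^bsub>A\<^esub> y i)) |i j. i \<in> {1..n} \<and> j \<in> {1..n}} \<union>
            {(x i \<otimes>\<^bsub>A\<^esub> y i, (y i \<otimes>\<^bsub>A\<^esub> x i) \<oplus>\<^bsub>A\<^esub> \<one>\<^bsub>A\<^esub>) |i. i \<in> {1..r}} \<union>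
            {(x i \<otimes>\<^bsub>A\<^esub> y j, (inv\<^bsub>K\<^esub> (\<Lambda> i j)) \<odot>\<^bsub>A\<^esub> (y j \<otimes>\<^bsub>A\<^esub> x i)) |i j.
                i \<in> {1..r} \<and> j \<in> {1..n} \<and> i \<noteq> j} \<union>
            {(x i \<otimes>\<^bsub>A\<^esub> x j, \<Lambda> i j \<odot>\<^bsub>A\<^esub> (x j \<otimes>\<^bsub>A\<^esub> x i)) |i j. i \<in> {1..r} \<and> j \<in> {1..r}}))"

definition skew_field :: "('a, 'm) ring_scheme \<Rightarrow> bool" where
  "skew_field F \<longleftrightarrow> ring F \<and> \<one>\<^bsub>F\<^esub> \<noteq> \<zero>\<^bsub>F\<^esub> \<and> Units F = carrier F - {\<zero>\<^bsub>F\<^esub>}"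

text \<open>
  \<^term>\<open>F\<close> is a skew field of fractions of \<^term>\<open>S\<close> via the embedding \<^term>\<open>\<iota>\<close>: every element of
  \<^term>\<open>F\<close> is a right fraction \<open>\<iota>(a) \<iota>(s)\<^sup>-\<^sup>1\<close> with \<open>s \<noteq> 0\<close>. For a noetherian domain such an
  \<^term>\<open>F\<close> exists and is unique up to isomorphism over \<^term>\<open>S\<close> (right Ore localization), and it
  consists equally of left fractions.
\<close>

definition skew_field_of_fractions ::
    "('k, 'e) ring_scheme \<Rightarrow> ('k, 's, 'm) module_scheme \<Rightarrow> ('k, 'f, 'n) module_scheme \<Rightarrow> ('s \<Rightarrow> 'f) \<Rightarrow> bool"
  where
  "skew_field_of_fractions K S F \<iota> \<longleftrightarrow>
     assoc_algebra K F \<and> skew_field F \<and>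
     \<iota> \<in> assoc_algebra_hom K S F \<and> inj_on \<iota> (carrier S) \<and>
     (\<forall>f\<in>carrier F. \<exists>a\<in>carrier S. \<exists>s\<in>carrier S - {\<zero>\<^bsub>S\<^esub>}. f = \<iota> a \<otimes>\<^bsub>F\<^esub> inv\<^bsub>F\<^esub> (\<iota> s))"

end

theory Submission
  imports Defs "HOL-Library.Multiset" "HOL-Library.Poly_Mapping"
begin

text \<open>
  The associated graded algebra of \<open>S\<close> for a monomial order is a quantum affine space in which
  \<open>x\<^sub>i\<close> commutes with everything like \<open>y\<^sub>i\<^sup>-\<^sup>1\<close>. Hence the leading terms of \<open>S\<close>, and then of
  \<open>Frac S\<close>, multiply by the bicharacter of \<open>\<Lambda>\<close> once \<open>x\<^sub>i\<close> is given the weight of \<open>y\<^sub>i\<^sup>-\<^sup>1\<close>. The Laurent monomials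
  in the \<open>y\<^sub>i\<close> have distinct leading degrees, so they are linearly independent in \<open>Frac S\<close> and span
  a copy of the torus. Conversely, the leading degrees of the images of the generators of
  a torus \<open>O\<^sub>M\<close> in \<open>Frac S\<close> yield Laurent monomials of \<open>O\<^sub>\<Lambda>\<close> with the same commutation relations.
  Leading terms are read off the left regular representation of \<open>S\<close>, written down explicitly on
  coefficient functions, so that no basis theorem for \<open>S\<close> has to be proved beforehand.
\<close>

text \<open>A presentation gives no lower bounds: before some basis is known, nothing prevents the
  relations from collapsing \<open>S\<close>. Rewriting shows only that ordered monomials span; the
  representation shows only that a leading coefficient, where there is one, is unique. Each half is
  easy, and together they give what is used later: every nonzero element of \<open>S\<close> has a
  nonzero leading term. It is this totality that passes to fractions. Exponents of x_i and y_i are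
  recorded separately. Distinct monomials then have distinct degrees, and the constant in x_i y_i =
  y_i x_i + 1 lies in a strictly smaller degree. The bicharacter sees only the difference of the two
  exponents. Hence the commutation scalars of leading terms, although degrees have n + r
  coordinates, already occur between Laurent monomials in n variables. The order on degrees is
  total, so that a leading term is a single monomial and its degree is additive on products; degrees
  form a group because fractions have negative degrees as well.\<close>

hide_const (open) Multiset.mult

declare in_listsD [rule del] in_listsI [rule del]

section \<open>Associative algebras\<close>

lemma assoc_algebraI:
  fixes K (structure) and A (structure)
  assumes "cring K" and "ring A"
    and "\<And>a x. \<lbrakk>a \<in> carrier K; x \<in> carrier A\<rbrakk> \<Longrightarrow> a \<odot>\<^bsub>A\<^esub> x \<in> carrier A"
    and "\<And>a b x. \<lbrakk>a \<in> carrier K; b \<in> carrier K; x \<in> carrier A\<rbrakk> \<Longrightarrow>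
      (a \<oplus>\<^bsub>K\<^esub> b) \<odot>\<^bsub>A\<^esub> x = a \<odot>\<^bsub>A\<^esub> x \<oplus>\<^bsub>A\<^esub> b \<odot>\<^bsub>A\<^esub> x"
    and "\<And>a x y. \<lbrakk>a \<in> carrier K; x \<in> carrier A; y \<in> carrier A\<rbrakk> \<Longrightarrow>
      a \<odot>\<^bsub>A\<^esub> (x \<oplus>\<^bsub>A\<^esub> y) = a \<odot>\<^bsub>A\<^esub> x \<oplus>\<^bsub>A\<^esub> a \<odot>\<^bsub>A\<^esub> y"
    and "\<And>a b x. \<lbrakk>a \<in> carrier K; b \<in> carrier K; x \<in> carrier A\<rbrakk> \<Longrightarrow>
      (a \<otimes>\<^bsub>K\<^esub> b) \<odot>\<^bsub>A\<^esub> x = a \<odot>\<^bsub>A\<^esub> (b \<odot>\<^bsub>A\<^esub> x)"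
    and "\<And>x. x \<in> carrier A \<Longrightarrow> \<one>\<^bsub>K\<^esub> \<odot>\<^bsub>A\<^esub> x = x"
    and "\<And>c x y. \<lbrakk>c \<in> carrier K; x \<in> carrier A; y \<in> carrier A\<rbrakk> \<Longrightarrow>
      (c \<odot>\<^bsub>A\<^esub> x) \<otimes>\<^bsub>A\<^esub> y = c \<odot>\<^bsub>A\<^esub> (x \<otimes>\<^bsub>A\<^esub> y)"
    and "\<And>c x y. \<lbrakk>c \<in> carrier K; x \<in> carrier A; y \<in> carrier A\<rbrakk> \<Longrightarrow>
      x \<otimes>\<^bsub>A\<^esub> (c \<odot>\<^bsub>A\<^esub> y) = c \<odot>\<^bsub>A\<^esub> (x \<otimes>\<^bsub>A\<^esub> y)"
  shows "assoc_algebra K A"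
  unfolding assoc_algebra_def
  using assms by (auto intro!: moduleI dest: ring.is_abelian_group)

locale assoc_alg =
  fixes K :: "('k, 'e) ring_scheme" (structure) and A :: "('k, 'a, 'm) module_scheme"
  assumes assoc_algebra: "assoc_algebra K A"

sublocale assoc_alg \<subseteq> K: cring K
  using assoc_algebra by (simp add: assoc_algebra_def module_def)

sublocale assoc_alg \<subseteq> A: ring A
  using assoc_algebra by (simp add: assoc_algebra_def)

sublocale assoc_alg \<subseteq> M: module K A
  using assoc_algebra by (simp add: assoc_algebra_def)

context assoc_alg
begin

lemma smult_mult:
  "\<lbrakk>c \<in> carrier K; x \<in> carrier A; y \<in> carrier A\<rbrakk> \<Longrightarrow>
    (c \<odot>\<^bsub>A\<^esub> x) \<otimes>\<^bsub>A\<^esub> y = c \<odot>\<^bsub>A\<^esub> (x \<otimes>\<^bsub>A\<^esub> y)"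
  using assoc_algebra by (simp add: assoc_algebra_def)

lemma mult_smult:
  "\<lbrakk>c \<in> carrier K; x \<in> carrier A; y \<in> carrier A\<rbrakk> \<Longrightarrow>
    x \<otimes>\<^bsub>A\<^esub> (c \<odot>\<^bsub>A\<^esub> y) = c \<odot>\<^bsub>A\<^esub> (x \<otimes>\<^bsub>A\<^esub> y)"
  using assoc_algebra by (simp add: assoc_algebra_def)

lemma smult_cancel:
  assumes "c \<in> Units K" "x \<in> carrier A" "y \<in> carrier A" "c \<odot>\<^bsub>A\<^esub> x = c \<odot>\<^bsub>A\<^esub> y"
  shows "x = y"
proof -
  have "inv c \<odot>\<^bsub>A\<^esub> (c \<odot>\<^bsub>A\<^esub> z) = z" if "z \<in> carrier A" for z
    using assms(1) that
    by (simp add: M.smult_assoc1[symmetric] K.Units_closed K.Units_inv_closed K.Units_l_inv)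
  then show ?thesis
    using assms by metis
qed

definition word_prod :: "('x \<Rightarrow> 'a) \<Rightarrow> 'x list \<Rightarrow> 'a" where
  "word_prod g w = foldr (\<lambda>x a. g x \<otimes>\<^bsub>A\<^esub> a) w \<one>\<^bsub>A\<^esub>"

lemma word_prod_simps [simp]:
  "word_prod g [] = \<one>\<^bsub>A\<^esub>"
  "word_prod g (x # w) = g x \<otimes>\<^bsub>A\<^esub> word_prod g w"
  by (simp_all add: word_prod_def)

lemma word_prod_closed [simp]:
  assumes "g \<in> X \<rightarrow> carrier A" "w \<in> lists X"
  shows "word_prod g w \<in> carrier A"
  using assms(2) by (induction w) (use assms(1) in auto)

lemma word_prod_append:
  assumes "g \<in> X \<rightarrow> carrier A" "u \<in> lists X" "v \<in> lists X"
  shows "word_prod g (u @ v) = word_prod g u \<otimes>\<^bsub>A\<^esub> word_prod g v"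
  using assms(2)
proof (induction u)
  case Nil
  then show ?case using word_prod_closed[OF assms(1,3)] by simp
next
  case (Cons x u)
  have "g x \<in> carrier A" using Cons assms(1) by auto
  then show ?case
    using Cons word_prod_closed[OF assms(1,3)] word_prod_closed[OF assms(1), of u]
    by (simp add: A.m_assoc)
qed

end

lemma assoc_algebra_homD:
  assumes "h \<in> assoc_algebra_hom K A B"
  shows "h \<in> ring_hom A B"
    and "\<And>c x. \<lbrakk>c \<in> carrier K; x \<in> carrier A\<rbrakk> \<Longrightarrow> h (c \<odot>\<^bsub>A\<^esub> x) = c \<odot>\<^bsub>B\<^esub> h x"
    and "\<And>x. x \<in> carrier A \<Longrightarrow> h x \<in> carrier B"
    and "\<And>x y. \<lbrakk>x \<in> carrier A; y \<in> carrier A\<rbrakk> \<Longrightarrow> h (x \<otimes>\<^bsub>A\<^esub> y) = h x \<otimes>\<^bsub>B\<^esub> h y"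
    and "\<And>x y. \<lbrakk>x \<in> carrier A; y \<in> carrier A\<rbrakk> \<Longrightarrow> h (x \<oplus>\<^bsub>A\<^esub> y) = h x \<oplus>\<^bsub>B\<^esub> h y"
    and "h \<one>\<^bsub>A\<^esub> = \<one>\<^bsub>B\<^esub>"
  using assms unfolding assoc_algebra_hom_def by (auto simp: ring_hom_def)

lemma assoc_algebra_homI:
  assumes "\<And>x. x \<in> carrier A \<Longrightarrow> h x \<in> carrier B"
    and "\<And>x y. \<lbrakk>x \<in> carrier A; y \<in> carrier A\<rbrakk> \<Longrightarrow> h (x \<otimes>\<^bsub>A\<^esub> y) = h x \<otimes>\<^bsub>B\<^esub> h y"
    and "\<And>x y. \<lbrakk>x \<in> carrier A; y \<in> carrier A\<rbrakk> \<Longrightarrow> h (x \<oplus>\<^bsub>A\<^esub> y) = h x \<oplus>\<^bsub>B\<^esub> h y"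
    and "h \<one>\<^bsub>A\<^esub> = \<one>\<^bsub>B\<^esub>"
    and "\<And>c x. \<lbrakk>c \<in> carrier K; x \<in> carrier A\<rbrakk> \<Longrightarrow> h (c \<odot>\<^bsub>A\<^esub> x) = c \<odot>\<^bsub>B\<^esub> h x"
  shows "h \<in> assoc_algebra_hom K A B"
  using assms unfolding assoc_algebra_hom_def by (auto simp: ring_hom_def)

lemma assoc_algebra_hom_zero:
  assumes "h \<in> assoc_algebra_hom K A B" "ring A" "ring B"
  shows "h \<zero>\<^bsub>A\<^esub> = \<zero>\<^bsub>B\<^esub>"
  using ring_hom_zero assoc_algebra_homD(1) assms by blast

lemma assoc_algebra_hom_word_prod:
  assumes "assoc_alg K A" "assoc_alg K B" "h \<in> assoc_algebra_hom K A B"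
    and "g \<in> X \<rightarrow> carrier A" "w \<in> lists X"
  shows "h (assoc_alg.word_prod A g w) = assoc_alg.word_prod B (h \<circ> g) w"
proof -
  interpret A: assoc_alg K A by fact
  interpret B: assoc_alg K B by fact
  show ?thesis
    using assms(5)
  proof (induction w)
    case Nil
    then show ?case using assoc_algebra_homD(6)[OF assms(3)] by simp
  next
    case (Cons x w)
    have "g x \<in> carrier A" using Cons assms(4) by auto
    then show ?case
      using Cons A.word_prod_closed[OF assms(4), of w] assoc_algebra_homD(4)[OF assms(3)] by simp
  qed
qed

section \<open>The free algebra\<close>

context cring
begin

definition conv :: "('x list \<Rightarrow> 'a) \<Rightarrow> ('x list \<Rightarrow> 'a) \<Rightarrow> 'x list \<Rightarrow> 'a" where
  "conv f g w = (\<Oplus>i\<in>{..length w}. f (take i w) \<otimes> g (drop i w))"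

lemma conv_closed [simp, intro]:
  "\<lbrakk>\<And>w. f w \<in> carrier R; \<And>w. g w \<in> carrier R\<rbrakk> \<Longrightarrow> conv f g w \<in> carrier R"
  unfolding conv_def by (rule finsum_closed) auto

lemma conv_Nil: "\<lbrakk>\<And>w. f w \<in> carrier R; \<And>w. g w \<in> carrier R\<rbrakk> \<Longrightarrow> conv f g [] = f [] \<otimes> g []"
  unfolding conv_def by simp

text \<open>Only the split with empty prefix is singled out; the rest is a convolution with the left
  derivative \<open>\<lambda>u. f (x # u)\<close>. With this recursion the laws of the algebra
  follow by induction on the word, for arbitrary \<open>f\<close>, without double sums.\<close>

lemma conv_Cons:
  assumes "\<And>w. f w \<in> carrier R" "\<And>w. g w \<in> carrier R"
  shows "conv f g (x # w) = f [] \<otimes> g (x # w) \<oplus> conv (\<lambda>u. f (x # u)) g w"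
proof -
  have "conv f g (x # w) =
      (\<Oplus>i\<in>{..length w}. f (take (Suc i) (x # w)) \<otimes> g (drop (Suc i) (x # w))) \<oplus>
      f (take 0 (x # w)) \<otimes> g (drop 0 (x # w))"
    unfolding conv_def list.size add_0_right add_Suc_right
    by (rule finsum_Suc2) (use assms in auto)
  also have "\<dots> = conv (\<lambda>u. f (x # u)) g w \<oplus> f [] \<otimes> g (x # w)"
    by (simp add: conv_def)
  finally show ?thesis
    using assms by (simp add: a_comm)
qed

lemma conv_add_left:
  assumes "\<And>w. f w \<in> carrier R" "\<And>w. f' w \<in> carrier R" "\<And>w. g w \<in> carrier R"
  shows "conv (\<lambda>w. f w \<oplus> f' w) g w = conv f g w \<oplus> conv f' g w"
  using assms
proof (induction w arbitrary: f f')
  case Nil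
  then show ?case by (simp add: conv_Nil l_distr)
next
  case (Cons x w)
  then show ?case
    by (simp add: conv_Cons l_distr a_ac)
qed

lemma conv_smult_left:
  assumes "c \<in> carrier R" "\<And>w. f w \<in> carrier R" "\<And>w. g w \<in> carrier R"
  shows "conv (\<lambda>w. c \<otimes> f w) g w = c \<otimes> conv f g w"
  using assms
proof (induction w arbitrary: f)
  case Nil
  then show ?case by (simp add: conv_Nil m_assoc)
next
  case (Cons x w)
  then show ?case
    by (simp add: conv_Cons r_distr m_assoc)
qed

lemma conv_add_right:
  assumes "\<And>w. f w \<in> carrier R" "\<And>w. g' w \<in> carrier R" "\<And>w. g w \<in> carrier R"
  shows "conv f (\<lambda>w. g w \<oplus> g' w) w = conv f g w \<oplus> conv f g' w"
  using assms
proof (induction w arbitrary: f)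
  case Nil
  then show ?case by (simp add: conv_Nil r_distr)
next
  case (Cons x w)
  then show ?case
    by (simp add: conv_Cons r_distr a_ac)
qed

lemma conv_smult_right:
  assumes "c \<in> carrier R" "\<And>w. f w \<in> carrier R" "\<And>w. g w \<in> carrier R"
  shows "conv f (\<lambda>w. c \<otimes> g w) w = c \<otimes> conv f g w"
  using assms
proof (induction w arbitrary: f)
  case Nil
  then show ?case by (simp add: conv_Nil m_lcomm)
next
  case (Cons x w)
  then show ?case
    by (simp add: conv_Cons r_distr m_lcomm)
qed

lemma conv_assoc:
  assumes "\<And>w. f w \<in> carrier R" "\<And>w. g w \<in> carrier R" "\<And>w. h w \<in> carrier R"
  shows "conv (conv f g) h w = conv f (conv g h) w"
  using assms
proof (induction w arbitrary: f g)
  case Nil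
  then show ?case by (simp add: conv_Nil m_assoc)
next
  case (Cons x w)
  let ?f = "\<lambda>u. f (x # u)" and ?g = "\<lambda>u. g (x # u)"
  \<comment> \<open>The left derivative of a product obeys a Leibniz rule: it is \<open>f []\<close>
    times the derivative of \<open>g\<close>, plus the derivative of \<open>f\<close> convolved with
    \<open>g\<close>.\<close>
  have "conv (conv f g) h (x # w) =
      f [] \<otimes> g [] \<otimes> h (x # w) \<oplus> conv (\<lambda>u. f [] \<otimes> ?g u \<oplus> conv ?f g u) h w"
    using Cons.prems by (simp add: conv_Cons conv_Nil)
  also have "\<dots> = f [] \<otimes> g [] \<otimes> h (x # w) \<oplus> (f [] \<otimes> conv ?g h w \<oplus> conv ?f (conv g h) w)"
    using Cons by (simp add: conv_add_left conv_smult_left)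
  also have "\<dots> = conv f (conv g h) (x # w)"
    using Cons.prems by (simp add: conv_Cons m_assoc r_distr a_ac)
  finally show ?case .
qed

lemma conv_one_left:
  assumes "\<And>w. f w \<in> carrier R"
  shows "conv (\<lambda>w. if w = [] then \<one> else \<zero>) f w = f w"
proof -
  have "conv (\<lambda>w. \<zero>) f w = \<zero>" for w
    using conv_smult_left[of \<zero> "\<lambda>w. \<zero>" f w] assms by simp
  then show ?thesis
    using assms by (cases w) (simp_all add: conv_Cons conv_Nil)
qed

lemma conv_one_right:
  assumes "\<And>w. f w \<in> carrier R"
  shows "conv f (\<lambda>w. if w = [] then \<one> else \<zero>) w = f w"
  using assms by (induction w arbitrary: f) (simp_all add: conv_Cons conv_Nil)

lemma conv_nonzeroD:
  assumes "\<And>w. f w \<in> carrier R" "\<And>w. g w \<in> carrier R" "conv f g w \<noteq> \<zero>"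
  shows "\<exists>u v. w = u @ v \<and> f u \<noteq> \<zero> \<and> g v \<noteq> \<zero>"
proof (rule ccontr)
  assume *: "\<not> ?thesis"
  have "f (take i w) \<otimes> g (drop i w) = \<zero>" for i
  proof -
    have "f (take i w) = \<zero> \<or> g (drop i w) = \<zero>"
      using * append_take_drop_id[of i w] by metis
    then show ?thesis using assms(1,2) by auto
  qed
  then show False using assms(3) by (simp add: conv_def)
qed

lemma free_carrier_iff:
  "f \<in> carrier (free_algebra R X) \<longleftrightarrow>
    (\<forall>w. f w \<in> carrier R) \<and> finite {w. f w \<noteq> \<zero>} \<and> (\<forall>w. f w \<noteq> \<zero> \<longrightarrow> w \<in> lists X)"
  by (simp add: free_algebra_def)

lemma free_simps:
  "f \<otimes>\<^bsub>free_algebra R X\<^esub> g = conv f g"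
  "\<one>\<^bsub>free_algebra R X\<^esub> = (\<lambda>w. if w = [] then \<one> else \<zero>)"
  "\<zero>\<^bsub>free_algebra R X\<^esub> = (\<lambda>w. \<zero>)"
  "f \<oplus>\<^bsub>free_algebra R X\<^esub> g = (\<lambda>w. f w \<oplus> g w)"
  "c \<odot>\<^bsub>free_algebra R X\<^esub> f = (\<lambda>w. c \<otimes> f w)"
  by (simp_all add: free_algebra_def conv_def fun_eq_iff)

lemma free_add_closed:
  assumes "f \<in> carrier (free_algebra R X)" "g \<in> carrier (free_algebra R X)"
  shows "(\<lambda>w. f w \<oplus> g w) \<in> carrier (free_algebra R X)"
proof -
  have "{w. f w \<oplus> g w \<noteq> \<zero>} \<subseteq> {w. f w \<noteq> \<zero>} \<union> {w. g w \<noteq> \<zero>}"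
    by auto
  then have "finite {w. f w \<oplus> g w \<noteq> \<zero>}"
    using assms finite_subset unfolding free_carrier_iff by blast
  moreover have "f w \<noteq> \<zero> \<or> g w \<noteq> \<zero>" if "f w \<oplus> g w \<noteq> \<zero>" for w
    using that by auto
  ultimately show ?thesis
    using assms unfolding free_carrier_iff by blast
qed

lemma free_smult_closed:
  assumes "f \<in> carrier (free_algebra R X)" "c \<in> carrier R"
  shows "(\<lambda>w. c \<otimes> f w) \<in> carrier (free_algebra R X)"
proof -
  have "{w. c \<otimes> f w \<noteq> \<zero>} \<subseteq> {w. f w \<noteq> \<zero>}"
    using assms by auto
  then show ?thesis
    using assms finite_subset unfolding free_carrier_iff by auto
qed

lemma free_conv_closed:
  assumes "f \<in> carrier (free_algebra R X)" "g \<in> carrier (free_algebra R X)"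
  shows "conv f g \<in> carrier (free_algebra R X)"
proof -
  have cl: "\<And>w. f w \<in> carrier R" "\<And>w. g w \<in> carrier R"
    using assms by (auto simp: free_carrier_iff)
  have "{w. conv f g w \<noteq> \<zero>} \<subseteq> (\<lambda>(u, v). u @ v) ` ({w. f w \<noteq> \<zero>} \<times> {w. g w \<noteq> \<zero>})"
    using conv_nonzeroD[OF cl] by force
  moreover have "finite ((\<lambda>(u, v). u @ v) ` ({w. f w \<noteq> \<zero>} \<times> {w. g w \<noteq> \<zero>}))"
    using assms by (simp add: free_carrier_iff)
  ultimately have "finite {w. conv f g w \<noteq> \<zero>}"
    by (rule finite_subset)
  moreover have "w \<in> lists X" if "conv f g w \<noteq> \<zero>" for w
  proof -
    obtain u v where "w = u @ v" "f u \<noteq> \<zero>" "g v \<noteq> \<zero>"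
      using conv_nonzeroD[OF cl \<open>conv f g w \<noteq> \<zero>\<close>] by blast
    then show ?thesis
      using assms unfolding free_carrier_iff by (metis append_in_lists_conv)
  qed
  ultimately show ?thesis
    using cl by (auto simp: free_carrier_iff)
qed

lemma free_algebra_ring: "ring (free_algebra R X)"
proof (rule ringI)
  show "abelian_group (free_algebra R X)"
  proof (rule abelian_groupI)
    fix f assume f: "f \<in> carrier (free_algebra R X)"
    have "(\<lambda>w. \<ominus> \<one> \<otimes> f w) \<in> carrier (free_algebra R X)"
      using f by (simp add: free_smult_closed)
    moreover have "\<ominus> \<one> \<otimes> f w \<oplus> f w = \<zero>" for w
      using f by (simp add: free_carrier_iff l_minus l_neg)
    ultimately show "\<exists>g\<in>carrier (free_algebra R X). g \<oplus>\<^bsub>free_algebra R X\<^esub> f = \<zero>\<^bsub>free_algebra R X\<^esub>"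
      by (auto simp: free_simps fun_eq_iff intro!: bexI[of _ "\<lambda>w. \<ominus> \<one> \<otimes> f w"])
    fix g assume "g \<in> carrier (free_algebra R X)"
    with f show "f \<oplus>\<^bsub>free_algebra R X\<^esub> g \<in> carrier (free_algebra R X)"
      by (simp add: free_simps free_add_closed)
  qed (auto simp: free_simps free_carrier_iff a_ac)
  show "monoid (free_algebra R X)"
  proof (rule monoidI)
    show "\<one>\<^bsub>free_algebra R X\<^esub> \<in> carrier (free_algebra R X)"
      by (auto simp: free_simps free_carrier_iff)
    fix f g :: "'c list \<Rightarrow> 'a"
    assume "f \<in> carrier (free_algebra R X)" "g \<in> carrier (free_algebra R X)"
    then show "f \<otimes>\<^bsub>free_algebra R X\<^esub> g \<in> carrier (free_algebra R X)"
      by (simp add: free_simps free_conv_closed)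
  qed (auto simp: free_simps fun_eq_iff conv_assoc conv_one_left conv_one_right
        free_carrier_iff)
qed (auto simp: free_simps fun_eq_iff conv_add_left conv_add_right free_carrier_iff)

lemma free_algebra_assoc_alg: "assoc_alg R (free_algebra R X)"
proof (rule assoc_alg.intro, rule assoc_algebraI)
  show "cring R" ..
  show "ring (free_algebra R X)" by (rule free_algebra_ring)
  show "a \<odot>\<^bsub>free_algebra R X\<^esub> f \<in> carrier (free_algebra R X)"
    if "a \<in> carrier R" "f \<in> carrier (free_algebra R X)" for a f
    using that by (simp add: free_simps free_smult_closed)
qed (auto simp: free_simps free_carrier_iff fun_eq_iff
      l_distr r_distr m_assoc conv_smult_left conv_smult_right)

definition free_word :: "'x list \<Rightarrow> 'x list \<Rightarrow> 'a" where
  "free_word u = (\<lambda>w. if w = u then \<one> else \<zero>)"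

lemma free_word_closed: "u \<in> lists X \<Longrightarrow> free_word u \<in> carrier (free_algebra R X)"
  by (auto simp: free_word_def free_carrier_iff)

lemma free_gen_eq: "free_gen R x = free_word [x]"
  by (simp add: free_gen_def free_word_def)

lemma conv_free_gen:
  assumes "\<And>w. g w \<in> carrier R"
  shows "conv (free_word [x]) g w = (case w of [] \<Rightarrow> \<zero> | y # v \<Rightarrow> if y = x then g v else \<zero>)"
proof (cases w)
  case Nil
  then show ?thesis using assms by (simp add: conv_Nil free_word_def)
next
  case (Cons y v)
  have z: "conv (\<lambda>w. \<zero>) g v = \<zero>"
    using conv_smult_left[of \<zero> "\<lambda>w. \<zero>" g v] assms by simp
  show ?thesis
  proof (cases "y = x")
    case True
    then show ?thesis using Cons assms
      by (simp add: conv_Cons free_word_def conv_one_left)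
  next
    case False
    then show ?thesis using Cons assms z
      by (simp add: conv_Cons free_word_def)
  qed
qed

lemma free_word_Cons: "free_word (x # u) = conv (free_word [x]) (free_word u)"
proof
  fix w
  have "free_word u v \<in> carrier R" for v by (simp add: free_word_def)
  from conv_free_gen[of "free_word u" x w, OF this]
  show "free_word (x # u) w = conv (free_word [x]) (free_word u) w"
    by (auto simp: free_word_def split: list.split)
qed

text \<open>The support is finite, so one word at a time can be split off. Identities that are
  linear in \<open>f\<close> are thereby reduced to words.\<close>

lemma free_algebra_induct [consumes 1, case_names zero step]:
  fixes f :: "'x list \<Rightarrow> 'a"
  assumes "f \<in> carrier (free_algebra R X)"
    and zero: "P (\<lambda>w. \<zero>)"
    and step: "\<And>f c u. \<lbrakk>f \<in> carrier (free_algebra R X); P f; c \<in> carrier R; u \<in> lists X\<rbrakk> \<Longrightarrow>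
      P (\<lambda>w. f w \<oplus> c \<otimes> free_word u w)"
  shows "P f"
proof -
  have "\<forall>f\<in>carrier (free_algebra R X). {w. f w \<noteq> \<zero>} = S \<longrightarrow> P f"
    if "finite S" for S :: "'x list set"
    using that
  proof (induction S rule: finite_induct)
    case empty
    show ?case
    proof (intro ballI impI)
      fix f :: "'x list \<Rightarrow> 'a" assume "{w. f w \<noteq> \<zero>} = {}"
      then have "f = (\<lambda>w. \<zero>)" by auto
      then show "P f" using zero by simp
    qed
  next
    case (insert u S)
    show ?case
    proof (intro ballI impI)
      fix f :: "'x list \<Rightarrow> 'a" assume f: "f \<in> carrier (free_algebra R X)" and S: "{w. f w \<noteq> \<zero>} = insert u S"
      let ?g = "\<lambda>w. if w = u then \<zero> else f w"
      have supp: "{w. ?g w \<noteq> \<zero>} = S"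
        using S insert.hyps by auto
      then have g: "?g \<in> carrier (free_algebra R X)"
        using f insert.hyps unfolding free_carrier_iff by auto
      have "u \<in> lists X" "f u \<in> carrier R"
        using f S unfolding free_carrier_iff by auto
      moreover have "P ?g" using insert.IH supp g by simp
      ultimately have "P (\<lambda>w. ?g w \<oplus> f u \<otimes> free_word u w)"
        using g by (intro step)
      moreover have "(\<lambda>w. ?g w \<oplus> f u \<otimes> free_word u w) = f"
        using f unfolding free_carrier_iff free_word_def by auto
      ultimately show "P f" by simp
    qed
  qed
  then show ?thesis
    using assms(1) by (auto simp: free_carrier_iff)
qed

end

section \<open>Evaluation of noncommutative polynomials and the universal property of the free
  algebra\<close>

context assoc_alg
begin

definition free_eval :: "('x \<Rightarrow> 'a) \<Rightarrow> ('x list \<Rightarrow> 'k) \<Rightarrow> 'a" where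
  "free_eval g f = (\<Oplus>\<^bsub>A\<^esub>w\<in>{w. f w \<noteq> \<zero>}. f w \<odot>\<^bsub>A\<^esub> word_prod g w)"

context
  fixes X :: "'x set" and g :: "'x \<Rightarrow> 'a"
  assumes g: "g \<in> X \<rightarrow> carrier A"
begin

text \<open>Supports may shrink by cancellation, so evaluations are compared over a common finite
  set of words, the extra terms being zero.\<close>

lemma free_eval_superset:
  assumes "f \<in> carrier (free_algebra K X)" "finite W" "{w. f w \<noteq> \<zero>} \<subseteq> W" "W \<subseteq> lists X"
  shows "free_eval g f = (\<Oplus>\<^bsub>A\<^esub>w\<in>W. f w \<odot>\<^bsub>A\<^esub> word_prod g w)"
  unfolding free_eval_def
  by (rule A.add.finprod_mono_neutral_cong_left)
    (use assms word_prod_closed[OF g] in \<open>auto simp: K.free_carrier_iff\<close>)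

lemma free_eval_closed:
  assumes "f \<in> carrier (free_algebra K X)"
  shows "free_eval g f \<in> carrier A"
  unfolding free_eval_def
  by (rule A.finsum_closed) (use assms word_prod_closed[OF g] in \<open>auto simp: K.free_carrier_iff\<close>)

lemma free_eval_add:
  assumes "f \<in> carrier (free_algebra K X)" "f' \<in> carrier (free_algebra K X)"
  shows "free_eval g (\<lambda>w. f w \<oplus> f' w) = free_eval g f \<oplus>\<^bsub>A\<^esub> free_eval g f'"
proof -
  let ?W = "{w. f w \<noteq> \<zero>} \<union> {w. f' w \<noteq> \<zero>}"
  have W: "finite ?W" "?W \<subseteq> lists X"
    using assms by (auto simp: K.free_carrier_iff)
  have cl: "\<And>w. f w \<in> carrier K" "\<And>w. f' w \<in> carrier K"
    using assms by (auto simp: K.free_carrier_iff)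
  have c: "word_prod g w \<in> carrier A" if "w \<in> ?W" for w
    using that W word_prod_closed[OF g] by auto
  have "free_eval g (\<lambda>w. f w \<oplus> f' w) =
      (\<Oplus>\<^bsub>A\<^esub>w\<in>?W. (f w \<oplus> f' w) \<odot>\<^bsub>A\<^esub> word_prod g w)"
    by (rule free_eval_superset) (use W assms in \<open>auto simp: K.free_add_closed\<close>)
  also have "\<dots> = (\<Oplus>\<^bsub>A\<^esub>w\<in>?W. f w \<odot>\<^bsub>A\<^esub> word_prod g w \<oplus>\<^bsub>A\<^esub> f' w \<odot>\<^bsub>A\<^esub> word_prod g w)"
    by (rule A.finsum_cong') (use cl c in \<open>auto simp: M.smult_l_distr\<close>)
  also have "\<dots> = (\<Oplus>\<^bsub>A\<^esub>w\<in>?W. f w \<odot>\<^bsub>A\<^esub> word_prod g w) \<oplus>\<^bsub>A\<^esub> (\<Oplus>\<^bsub>A\<^esub>w\<in>?W. f' w \<odot>\<^bsub>A\<^esub> word_prod g w)"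
    by (rule A.finsum_addf) (use cl c in auto)
  also have "\<dots> = free_eval g f \<oplus>\<^bsub>A\<^esub> free_eval g f'"
    using free_eval_superset[of f ?W] free_eval_superset[of f' ?W] W assms by auto
  finally show ?thesis .
qed

lemma free_eval_word: "u \<in> lists X \<Longrightarrow> free_eval g (K.free_word u) = word_prod g u"
proof -
  assume u: "u \<in> lists X"
  have "{w. K.free_word u w \<noteq> \<zero>} \<subseteq> {u}"
    by (auto simp: K.free_word_def)
  then have "free_eval g (K.free_word u) = (\<Oplus>\<^bsub>A\<^esub>w\<in>{u}. K.free_word u w \<odot>\<^bsub>A\<^esub> word_prod g w)"
    by (intro free_eval_superset) (use u in \<open>simp_all add: K.free_word_closed\<close>)
  then show ?thesis
    using word_prod_closed[OF g u] by (simp add: K.free_word_def)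
qed

lemma free_eval_zero: "free_eval g (\<lambda>w. \<zero>) = \<zero>\<^bsub>A\<^esub>"
  by (simp add: free_eval_def)

lemma free_eval_smult:
  assumes "f \<in> carrier (free_algebra K X)" "c \<in> carrier K"
  shows "free_eval g (\<lambda>w. c \<otimes> f w) = c \<odot>\<^bsub>A\<^esub> free_eval g f"
proof -
  let ?W = "{w. f w \<noteq> \<zero>}"
  have W: "finite ?W" "?W \<subseteq> lists X"
    using assms by (auto simp: K.free_carrier_iff)
  have cl: "\<And>w. f w \<in> carrier K"
    using assms by (auto simp: K.free_carrier_iff)
  have c: "word_prod g w \<in> carrier A" if "w \<in> ?W" for w
    using that W word_prod_closed[OF g] by auto
  have "free_eval g (\<lambda>w. c \<otimes> f w) = (\<Oplus>\<^bsub>A\<^esub>w\<in>?W. (c \<otimes> f w) \<odot>\<^bsub>A\<^esub> word_prod g w)"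
    by (rule free_eval_superset) (use W assms in \<open>auto simp: K.free_smult_closed\<close>)
  also have "\<dots> = (\<Oplus>\<^bsub>A\<^esub>w\<in>?W. c \<odot>\<^bsub>A\<^esub> (f w \<odot>\<^bsub>A\<^esub> word_prod g w))"
    by (rule A.finsum_cong') (use assms cl c in \<open>auto simp: M.smult_assoc1\<close>)
  also have "\<dots> = c \<odot>\<^bsub>A\<^esub> free_eval g f"
    unfolding free_eval_def
    using M.finsum_smult_ldistr[of ?W c "\<lambda>w. f w \<odot>\<^bsub>A\<^esub> word_prod g w"] assms(2) W(1) cl c by auto
  finally show ?thesis .
qed

text \<open>First of three stages of multiplicativity: a letter, then a word, then a polynomial on
  the left. A letter on the left merely lengthens every word, so no double sum arises.\<close>

lemma free_eval_gen_mult: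
  assumes "f \<in> carrier (free_algebra K X)" "x \<in> X"
  shows "free_eval g (K.conv (K.free_word [x]) f) = g x \<otimes>\<^bsub>A\<^esub> free_eval g f"
  using assms(1)
proof (induction f rule: K.free_algebra_induct)
  case zero
  have "K.conv (K.free_word [x]) (\<lambda>w. \<zero>) = (\<lambda>w. \<zero>)"
    by (auto simp: fun_eq_iff K.conv_free_gen split: list.split)
  moreover have "g x \<in> carrier A" using g assms by auto
  ultimately show ?case by (simp add: free_eval_zero)
next
  case (step f c u)
  have cl: "\<And>w. f w \<in> carrier K" "\<And>w. K.free_word u w \<in> carrier K"
      "\<And>w. K.free_word [x] w \<in> carrier K"
    using step by (auto simp: K.free_carrier_iff K.free_word_def)
  have xc: "K.free_word [x] \<in> carrier (free_algebra K X)"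
    using assms by (auto intro: K.free_word_closed)
  have xu: "K.free_word (x # u) \<in> carrier (free_algebra K X)" "K.free_word u \<in> carrier (free_algebra K X)"
    using assms step by (auto intro: K.free_word_closed)
  have gx: "g x \<in> carrier A" using g assms by auto
  have "K.conv (K.free_word [x]) (\<lambda>w. f w \<oplus> c \<otimes> K.free_word u w) =
    (\<lambda>w. K.conv (K.free_word [x]) f w \<oplus> c \<otimes> K.free_word (x # u) w)"
    using cl step by (simp add: fun_eq_iff K.conv_add_right K.conv_smult_right K.free_word_Cons[of x u])
  then have "free_eval g (K.conv (K.free_word [x]) (\<lambda>w. f w \<oplus> c \<otimes> K.free_word u w)) =
     g x \<otimes>\<^bsub>A\<^esub> free_eval g f \<oplus>\<^bsub>A\<^esub> c \<odot>\<^bsub>A\<^esub> (g x \<otimes>\<^bsub>A\<^esub> word_prod g u)"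
    using step xu xc assms(2)
    by (simp add: free_eval_add free_eval_smult K.free_smult_closed K.free_conv_closed free_eval_word)
  also have "\<dots> = g x \<otimes>\<^bsub>A\<^esub> (free_eval g f \<oplus>\<^bsub>A\<^esub> c \<odot>\<^bsub>A\<^esub> word_prod g u)"
    using gx step word_prod_closed[OF g] free_eval_closed by (simp add: A.r_distr mult_smult)
  finally show ?case
    using step xu by (simp add: free_eval_add free_eval_smult K.free_smult_closed free_eval_word)
qed

lemma free_eval_word_mult:
  assumes "f \<in> carrier (free_algebra K X)" "u \<in> lists X"
  shows "free_eval g (K.conv (K.free_word u) f) = word_prod g u \<otimes>\<^bsub>A\<^esub> free_eval g f"
  using assms(2)
proof (induction u)
  case Nil
  have "K.conv (K.free_word []) f = f"
    using assms(1) K.conv_one_left[of f] by (simp add: fun_eq_iff K.free_word_def K.free_carrier_iff)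
  then show ?case using free_eval_closed assms by simp
next
  case (Cons x u)
  have cl: "\<And>w. f w \<in> carrier K" "\<And>w. K.free_word u w \<in> carrier K"
      "\<And>w. K.free_word [x] w \<in> carrier K"
    using assms by (auto simp: K.free_carrier_iff K.free_word_def)
  have u: "u \<in> lists X" "x \<in> X" and gx: "g x \<in> carrier A" using Cons g by auto
  have "K.conv (K.free_word (x # u)) f = K.conv (K.free_word [x]) (K.conv (K.free_word u) f)"
    using cl by (simp add: K.free_word_Cons[of x u] fun_eq_iff K.conv_assoc)
  then show ?case
    using Cons u gx assms free_eval_closed word_prod_closed[OF g]
    by (simp add: free_eval_gen_mult K.free_conv_closed K.free_word_closed A.m_assoc)
qed

lemma free_eval_mult:
  assumes "f \<in> carrier (free_algebra K X)" "f' \<in> carrier (free_algebra K X)"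
  shows "free_eval g (K.conv f f') = free_eval g f \<otimes>\<^bsub>A\<^esub> free_eval g f'"
  using assms(1)
proof (induction f rule: K.free_algebra_induct)
  case zero
  have "K.conv (\<lambda>w. \<zero>) f' = (\<lambda>w. \<zero>)"
    using K.conv_smult_left[of "\<zero>" "\<lambda>w. \<zero>" f'] assms(2)
    by (simp add: fun_eq_iff K.free_carrier_iff)
  then show ?case using assms free_eval_closed by (auto simp: free_eval_zero)
next
  case (step f c u)
  have cl: "\<And>w. f w \<in> carrier K" "\<And>w. K.free_word u w \<in> carrier K" "\<And>w. f' w \<in> carrier K"
    using step assms by (auto simp: K.free_carrier_iff K.free_word_def)
  have u: "K.free_word u \<in> carrier (free_algebra K X)"
    using assms step by (auto intro: K.free_word_closed)
  have "K.conv (\<lambda>w. f w \<oplus> c \<otimes> K.free_word u w) f' =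
    (\<lambda>w. K.conv f f' w \<oplus> c \<otimes> K.conv (K.free_word u) f' w)"
    using cl step by (simp add: fun_eq_iff K.conv_add_left K.conv_smult_left)
  then show ?case
    using step u assms free_eval_closed word_prod_closed[OF g]
    by (simp add: free_eval_add free_eval_smult K.free_smult_closed K.free_conv_closed
        free_eval_word free_eval_word_mult A.l_distr smult_mult)
qed

lemma free_eval_hom: "free_eval g \<in> assoc_algebra_hom K (free_algebra K X) A"
proof (rule assoc_algebra_homI)
  show "free_eval g \<one>\<^bsub>free_algebra K X\<^esub> = \<one>\<^bsub>A\<^esub>"
    using free_eval_word[of "[]"] by (simp add: K.free_simps K.free_word_def)
qed (auto simp: K.free_simps free_eval_mult free_eval_add free_eval_smult free_eval_closed)

end

end

text \<open>Used to view an element of the torus and its image in the skew field as values of one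
  and the same polynomial.\<close>

lemma assoc_algebra_hom_free_eval:
  assumes "assoc_alg K A" "assoc_alg K B" and h: "h \<in> assoc_algebra_hom K A B"
    and g: "g \<in> X \<rightarrow> carrier A" and "f \<in> carrier (free_algebra K X)"
  shows "h (assoc_alg.free_eval K A g f) = assoc_alg.free_eval K B (h \<circ> g) f"
proof -
  interpret A: assoc_alg K A by fact
  interpret B: assoc_alg K B by fact
  note hD = assoc_algebra_homD[OF h]
  have hg: "h \<circ> g \<in> X \<rightarrow> carrier B" using g hD(3) by (simp add: Pi_iff)
  show ?thesis
    using assms(5)
  proof (induction f rule: A.K.free_algebra_induct)
    case zero
    then show ?case
      unfolding A.free_eval_zero[OF g] B.free_eval_zero[OF hg]
      by (rule assoc_algebra_hom_zero[OF h A.A.ring_axioms B.A.ring_axioms])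
  next
    case (step f c u)
    have u: "A.K.free_word u \<in> carrier (free_algebra K X)"
      by (rule A.K.free_word_closed[OF step(3)])
    note cu = A.K.free_smult_closed[OF u step(2)]
    show ?case
      unfolding A.free_eval_add[OF g step(1) cu] B.free_eval_add[OF hg step(1) cu]
        A.free_eval_smult[OF g u step(2)] B.free_eval_smult[OF hg u step(2)]
        A.free_eval_word[OF g step(3)] B.free_eval_word[OF hg step(3)]
      using A.free_eval_closed[OF g step(1)] A.word_prod_closed[OF g step(3)] step(2,4)
        assoc_algebra_hom_word_prod[OF assms(1,2) h g step(3)] hD
      by (simp add: comp_def)
  qed
qed

section \<open>Quotients and presented algebras\<close>

context assoc_alg
begin

text \<open>Scaling by \<open>c\<close> is multiplication by \<open>c \<odot> \<one>\<close>, so a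
  ring ideal is automatically a subspace. This makes the scalar multiplication on cosets well
  defined.\<close>

lemma smult_ideal:
  assumes "ideal I A" "c \<in> carrier K" "x \<in> I"
  shows "c \<odot>\<^bsub>A\<^esub> x \<in> I"
proof -
  interpret I: ideal I A by fact
  have "(c \<odot>\<^bsub>A\<^esub> \<one>\<^bsub>A\<^esub>) \<otimes>\<^bsub>A\<^esub> x = c \<odot>\<^bsub>A\<^esub> x"
    using assms I.Icarr by (simp add: smult_mult)
  then show ?thesis
    using I.I_l_closed[OF assms(3), of "c \<odot>\<^bsub>A\<^esub> \<one>\<^bsub>A\<^esub>"] assms by simp
qed

context
  fixes I
  assumes I: "ideal I A"
begin

lemma quotient_carrier: "carrier (quotient_algebra A I) = (\<lambda>x. I +>\<^bsub>A\<^esub> x) ` carrier A"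
  by (auto simp: quotient_algebra_def FactRing_def A_RCOSETS_def')

lemma quotient_mult:
  "\<lbrakk>x \<in> carrier A; y \<in> carrier A\<rbrakk> \<Longrightarrow>
    (I +>\<^bsub>A\<^esub> x) \<otimes>\<^bsub>quotient_algebra A I\<^esub> (I +>\<^bsub>A\<^esub> y) = I +>\<^bsub>A\<^esub> (x \<otimes>\<^bsub>A\<^esub> y)"
  by (simp add: quotient_algebra_def FactRing_def ideal.rcoset_mult_add[OF I])

lemma quotient_add:
  "\<lbrakk>x \<in> carrier A; y \<in> carrier A\<rbrakk> \<Longrightarrow>
    (I +>\<^bsub>A\<^esub> x) \<oplus>\<^bsub>quotient_algebra A I\<^esub> (I +>\<^bsub>A\<^esub> y) = I +>\<^bsub>A\<^esub> (x \<oplus>\<^bsub>A\<^esub> y)"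
  by (simp add: quotient_algebra_def FactRing_def ideal.a_rcos_sum[OF I])

lemma quotient_one: "\<one>\<^bsub>quotient_algebra A I\<^esub> = I +>\<^bsub>A\<^esub> \<one>\<^bsub>A\<^esub>"
  by (simp add: quotient_algebra_def FactRing_def)

lemma quotient_eq_iff:
  "\<lbrakk>x \<in> carrier A; y \<in> carrier A\<rbrakk> \<Longrightarrow> I +>\<^bsub>A\<^esub> x = I +>\<^bsub>A\<^esub> y \<longleftrightarrow> x \<ominus>\<^bsub>A\<^esub> y \<in> I"
  by (rule A.quotient_eq_iff_same_a_r_cos[OF I, symmetric])

lemma quotient_zero: "\<zero>\<^bsub>quotient_algebra A I\<^esub> = I +>\<^bsub>A\<^esub> \<zero>\<^bsub>A\<^esub>"
proof -
  interpret I: ideal I A by (rule I)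
  show ?thesis
    using A.a_rcos_zero[OF I I.zero_closed] by (simp add: quotient_algebra_def FactRing_def)
qed

lemma quotient_smult:
  assumes "c \<in> carrier K" "x \<in> carrier A"
  shows "c \<odot>\<^bsub>quotient_algebra A I\<^esub> (I +>\<^bsub>A\<^esub> x) = I +>\<^bsub>A\<^esub> (c \<odot>\<^bsub>A\<^esub> x)"
proof -
  interpret I: ideal I A by (rule I)
  have "I +>\<^bsub>A\<^esub> (c \<odot>\<^bsub>A\<^esub> x') = I +>\<^bsub>A\<^esub> (c \<odot>\<^bsub>A\<^esub> x)" if x': "x' \<in> I +>\<^bsub>A\<^esub> x" for x'
  proof -
    obtain h where h: "h \<in> I" "x' = h \<oplus>\<^bsub>A\<^esub> x"
      using x' by (auto simp: a_r_coset_def')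
    have "h \<in> carrier A" using h I.Icarr by simp
    then have "c \<odot>\<^bsub>A\<^esub> x' \<ominus>\<^bsub>A\<^esub> c \<odot>\<^bsub>A\<^esub> x = c \<odot>\<^bsub>A\<^esub> h"
      using assms h by (simp add: M.smult_r_distr a_minus_def A.a_assoc A.r_neg)
    then show ?thesis
      using smult_ideal[OF I assms(1) h(1)] assms h \<open>h \<in> carrier A\<close> by (simp add: quotient_eq_iff)
  qed
  moreover have "x \<in> I +>\<^bsub>A\<^esub> x"
    using I.a_rcos_self assms by simp
  ultimately have "(\<Union>x'\<in>I +>\<^bsub>A\<^esub> x. I +>\<^bsub>A\<^esub> (c \<odot>\<^bsub>A\<^esub> x')) = I +>\<^bsub>A\<^esub> (c \<odot>\<^bsub>A\<^esub> x)"
    by blast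
  then show ?thesis by (simp add: quotient_algebra_def)
qed

lemmas quotient_simps = quotient_mult quotient_add quotient_one quotient_zero quotient_smult

lemma quotient_assoc_alg: "assoc_alg K (quotient_algebra A I)"
proof (rule assoc_alg.intro, rule assoc_algebraI)
  show "cring K" ..
  show "ring (quotient_algebra A I)"
  proof (rule ringI)
    show "abelian_group (quotient_algebra A I)"
    proof (rule abelian_groupI)
      fix z assume "z \<in> carrier (quotient_algebra A I)"
      then obtain x where x: "x \<in> carrier A" "z = I +>\<^bsub>A\<^esub> x" by (auto simp: quotient_carrier)
      then show "\<exists>y\<in>carrier (quotient_algebra A I).
          y \<oplus>\<^bsub>quotient_algebra A I\<^esub> z = \<zero>\<^bsub>quotient_algebra A I\<^esub>"
        by (intro bexI[of _ "I +>\<^bsub>A\<^esub> (\<ominus>\<^bsub>A\<^esub> x)"]) (auto simp: quotient_simps A.l_neg quotient_carrier)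
    qed (auto simp: quotient_carrier quotient_simps A.a_ac)
    show "monoid (quotient_algebra A I)"
      by (rule monoidI) (auto simp: quotient_carrier quotient_simps A.m_assoc)
  qed (auto simp: quotient_carrier quotient_simps A.l_distr A.r_distr)
qed (auto simp: quotient_carrier quotient_simps M.smult_l_distr M.smult_r_distr M.smult_assoc1
      smult_mult mult_smult)

lemma quotient_proj_hom: "(\<lambda>x. I +>\<^bsub>A\<^esub> x) \<in> assoc_algebra_hom K A (quotient_algebra A I)"
  by (rule assoc_algebra_homI) (auto simp: quotient_simps quotient_carrier)

lemma quotient_lift:
  assumes B: "assoc_alg K B" and h: "h \<in> assoc_algebra_hom K A B"
    and ker: "\<And>x. x \<in> I \<Longrightarrow> h x = \<zero>\<^bsub>B\<^esub>"
  obtains h' where "h' \<in> assoc_algebra_hom K (quotient_algebra A I) B"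
    and "\<And>x. x \<in> carrier A \<Longrightarrow> h' (I +>\<^bsub>A\<^esub> x) = h x"
proof -
  interpret B: assoc_alg K B by (rule B)
  note hD = assoc_algebra_homD[OF h]
  interpret h: ring_hom_ring A B h
    by (rule ring_hom_ringI2[OF A.ring_axioms B.A.ring_axioms hD(1)])
  have eq: "h x = h y" if "x \<in> carrier A" "y \<in> carrier A" "I +>\<^bsub>A\<^esub> x = I +>\<^bsub>A\<^esub> y" for x y
  proof -
    have "h (x \<ominus>\<^bsub>A\<^esub> y) = \<zero>\<^bsub>B\<^esub>"
      using ker that quotient_eq_iff by blast
    then have "h x \<ominus>\<^bsub>B\<^esub> h y = \<zero>\<^bsub>B\<^esub>"
      using that by (simp add: a_minus_def)
    then show ?thesis using that by simp
  qed
  define h' where "h' C = h (SOME x. x \<in> carrier A \<and> I +>\<^bsub>A\<^esub> x = C)" for C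
  have h': "h' (I +>\<^bsub>A\<^esub> x) = h x" if "x \<in> carrier A" for x
  proof -
    have "\<exists>y. y \<in> carrier A \<and> I +>\<^bsub>A\<^esub> y = I +>\<^bsub>A\<^esub> x" using that by blast
    from someI_ex[OF this] show ?thesis
      unfolding h'_def using that eq by blast
  qed
  have "h' \<in> assoc_algebra_hom K (quotient_algebra A I) B"
    by (rule assoc_algebra_homI) (auto simp: quotient_carrier quotient_simps h' hD)
  then show ?thesis using that h' by blast
qed

end

end

section \<open>Algebras given by generators and relations\<close>

definition relation_ideal ::
    "('k, 'e) ring_scheme \<Rightarrow> 'x set \<Rightarrow> (('x list \<Rightarrow> 'k) \<times> ('x list \<Rightarrow> 'k)) set \<Rightarrow> ('x list \<Rightarrow> 'k) set"
  where
  "relation_ideal K X E =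
    Idl\<^bsub>free_algebra K X\<^esub> {u \<ominus>\<^bsub>free_algebra K X\<^esub> v |u v. (u, v) \<in> E}"

definition presented_proj ::
    "('k, 'e) ring_scheme \<Rightarrow> 'x set \<Rightarrow> (('x list \<Rightarrow> 'k) \<times> ('x list \<Rightarrow> 'k)) set \<Rightarrow>
     ('x list \<Rightarrow> 'k) \<Rightarrow> ('x list \<Rightarrow> 'k) set" where
  "presented_proj K X E f = relation_ideal K X E +>\<^bsub>free_algebra K X\<^esub> f"

definition presented_gen ::
    "('k, 'e) ring_scheme \<Rightarrow> 'x set \<Rightarrow> (('x list \<Rightarrow> 'k) \<times> ('x list \<Rightarrow> 'k)) set \<Rightarrow>
     'x \<Rightarrow> ('x list \<Rightarrow> 'k) set" where
  "presented_gen K X E x = presented_proj K X E (free_gen K x)"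

lemma presented_algebra_eq:
  "presented_algebra K X E = quotient_algebra (free_algebra K X) (relation_ideal K X E)"
  by (simp add: presented_algebra_def relation_ideal_def Let_def)

locale presentation = K: cring K for K :: "('k, 'e) ring_scheme" (structure) +
  fixes X :: "'x set" and E :: "(('x list \<Rightarrow> 'k) \<times> ('x list \<Rightarrow> 'k)) set"
  assumes E: "E \<subseteq> carrier (free_algebra K X) \<times> carrier (free_algebra K X)"
begin

abbreviation "FA \<equiv> free_algebra K X"
abbreviation "PA \<equiv> presented_algebra K X E"
abbreviation "proj \<equiv> presented_proj K X E"
abbreviation "gen \<equiv> presented_gen K X E"

sublocale FA: assoc_alg K FA
  by (rule K.free_algebra_assoc_alg)

lemma relators: "{u \<ominus>\<^bsub>FA\<^esub> v |u v. (u, v) \<in> E} \<subseteq> carrier FA"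
  using E by auto

lemma ideal_relation_ideal: "ideal (relation_ideal K X E) FA"
  unfolding relation_ideal_def by (rule FA.A.genideal_ideal[OF relators])

sublocale PA: assoc_alg K PA
  unfolding presented_algebra_eq by (rule FA.quotient_assoc_alg[OF ideal_relation_ideal])

lemma proj_hom: "proj \<in> assoc_algebra_hom K FA PA"
  unfolding presented_algebra_eq presented_proj_def
  by (rule FA.quotient_proj_hom[OF ideal_relation_ideal])

lemmas proj_homD = assoc_algebra_homD[OF proj_hom]

lemma PA_carrier: "carrier PA = proj ` carrier FA"
  unfolding presented_algebra_eq presented_proj_def
  by (rule FA.quotient_carrier[OF ideal_relation_ideal])

lemma proj_relation:
  assumes "(u, v) \<in> E"
  shows "proj u = proj v"
proof -
  have "u \<ominus>\<^bsub>FA\<^esub> v \<in> relation_ideal K X E"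
    unfolding relation_ideal_def using FA.A.genideal_self[OF relators] assms by blast
  then show ?thesis
    unfolding presented_proj_def
    using FA.quotient_eq_iff[OF ideal_relation_ideal] assms E by auto
qed

lemma free_gen_closed: "x \<in> X \<Longrightarrow> free_gen K x \<in> carrier FA"
  by (simp add: K.free_gen_eq K.free_word_closed)

lemma gen_closed: "gen \<in> X \<rightarrow> carrier PA"
  by (auto simp: presented_gen_def free_gen_closed proj_homD)

lemma proj_word: "u \<in> lists X \<Longrightarrow> proj (K.free_word u) = PA.word_prod gen u"
proof (induction u)
  case Nil
  then show ?case
    using proj_homD(6) by (simp add: K.free_simps K.free_word_def)
next
  case (Cons x u)
  then have "x \<in> X" "u \<in> lists X" by auto
  then have "proj (free_gen K x \<otimes>\<^bsub>FA\<^esub> K.free_word u) = gen x \<otimes>\<^bsub>PA\<^esub> proj (K.free_word u)"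
    by (simp add: proj_homD free_gen_closed K.free_word_closed presented_gen_def)
  then show ?case
    using Cons by (simp add: K.free_simps K.free_gen_eq K.free_word_Cons[of x u])
qed

lemma presented_induct [consumes 1, case_names zero step]:
  assumes "z \<in> carrier PA"
    and zero: "P \<zero>\<^bsub>PA\<^esub>"
    and step: "\<And>z c u. \<lbrakk>z \<in> carrier PA; P z; c \<in> carrier K; u \<in> lists X\<rbrakk> \<Longrightarrow>
      P (z \<oplus>\<^bsub>PA\<^esub> c \<odot>\<^bsub>PA\<^esub> PA.word_prod gen u)"
  shows "P z"
proof -
  obtain f where f: "f \<in> carrier FA" "z = proj f"
    using assms(1) PA_carrier by auto
  have "P (proj f)"
    using f(1)
  proof (induction f rule: K.free_algebra_induct)
    case zero
    have "proj \<zero>\<^bsub>FA\<^esub> = \<zero>\<^bsub>PA\<^esub>"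
      by (rule assoc_algebra_hom_zero[OF proj_hom FA.A.ring_axioms PA.A.ring_axioms])
    then show ?case using assms(2) by (simp add: K.free_simps)
  next
    case (step f c u)
    have "proj (f \<oplus>\<^bsub>FA\<^esub> c \<odot>\<^bsub>FA\<^esub> K.free_word u) = proj f \<oplus>\<^bsub>PA\<^esub> c \<odot>\<^bsub>PA\<^esub> PA.word_prod gen u"
      using step by (simp add: proj_homD K.free_word_closed proj_word)
    then show ?case
      using assms(3)[of "proj f" c u] step by (simp add: K.free_simps proj_homD)
  qed
  then show ?thesis using f by simp
qed

text \<open>The kernel of evaluation is an ideal containing all relators, hence it contains the
  ideal generated by them.\<close>

lemma presented_lift:
  assumes B: "assoc_alg K B" and g: "g \<in> X \<rightarrow> carrier B"
    and rel: "\<And>u v. (u, v) \<in> E \<Longrightarrow> assoc_alg.free_eval K B g u = assoc_alg.free_eval K B g v"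
  obtains h where "h \<in> assoc_algebra_hom K PA B" "\<And>x. x \<in> X \<Longrightarrow> h (gen x) = g x"
proof -
  interpret B: assoc_alg K B by (rule B)
  note hom = B.free_eval_hom[OF g]
  interpret ev: ring_hom_ring FA B "B.free_eval g"
    by (rule ring_hom_ringI2[OF FA.A.ring_axioms B.A.ring_axioms assoc_algebra_homD(1)[OF hom]])
  have "u \<ominus>\<^bsub>FA\<^esub> v \<in> a_kernel FA B (B.free_eval g)" if "(u, v) \<in> E" for u v
  proof -
    have "u \<in> carrier FA" "v \<in> carrier FA" using that E by auto
    moreover from this have "B.free_eval g (u \<ominus>\<^bsub>FA\<^esub> v) = \<zero>\<^bsub>B\<^esub>"
      unfolding a_minus_def using rel[OF that] by (simp add: B.A.r_neg)
    ultimately show ?thesis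
      unfolding a_kernel_def' by blast
  qed
  then have "relation_ideal K X E \<subseteq> a_kernel FA B (B.free_eval g)"
    unfolding relation_ideal_def
    by (intro FA.A.genideal_minimal ev.kernel_is_ideal) auto
  then have "B.free_eval g f = \<zero>\<^bsub>B\<^esub>" if "f \<in> relation_ideal K X E" for f
    using subsetD[OF \<open>relation_ideal K X E \<subseteq> _\<close> that] unfolding a_kernel_def' by blast
  from FA.quotient_lift[OF ideal_relation_ideal B hom this] obtain h where
    h: "h \<in> assoc_algebra_hom K PA B" "\<And>f. f \<in> carrier FA \<Longrightarrow> h (proj f) = B.free_eval g f"
    unfolding presented_algebra_eq presented_proj_def by blast
  have "h (gen x) = g x" if "x \<in> X" for x
  proof -
    have "g x \<in> carrier B" using g that by auto
    then show ?thesis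
      using h(2)[OF free_gen_closed[OF that]] B.free_eval_word[OF g, of "[x]"] that
      by (simp add: presented_gen_def K.free_gen_eq)
  qed
  then show ?thesis using that h(1) by blast
qed

lemma eval_gen:
  assumes "assoc_alg K B" "g \<in> X \<rightarrow> carrier B" "x \<in> X"
  shows "assoc_alg.free_eval K B g (free_gen K x) = g x"
proof -
  interpret B: assoc_alg K B by fact
  have "g x \<in> carrier B" using assms by auto
  then show ?thesis
    using B.free_eval_word[OF assms(2), of "[x]"] assms(3) by (simp add: K.free_gen_eq)
qed

end

section \<open>Endomorphism algebras\<close>

text \<open>Operators are \<open>extensional\<close>: values off the carrier are fixed, so that
  operators agreeing on the carrier are equal, as the ring axioms demand.\<close>

definition End_algebra ::
    "('k, 'e) ring_scheme \<Rightarrow> ('k, 'v, 'm) module_scheme \<Rightarrow> ('k, 'v \<Rightarrow> 'v) module" where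
  "End_algebra K V =
    \<lparr>carrier = {T \<in> extensional (carrier V). T \<in> carrier V \<rightarrow> carrier V \<and>
        (\<forall>x\<in>carrier V. \<forall>y\<in>carrier V. T (x \<oplus>\<^bsub>V\<^esub> y) = T x \<oplus>\<^bsub>V\<^esub> T y) \<and>
        (\<forall>c\<in>carrier K. \<forall>x\<in>carrier V. T (c \<odot>\<^bsub>V\<^esub> x) = c \<odot>\<^bsub>V\<^esub> T x)},
     mult = (\<lambda>S T. \<lambda>x\<in>carrier V. S (T x)),
     one = (\<lambda>x\<in>carrier V. x),
     zero = (\<lambda>x\<in>carrier V. \<zero>\<^bsub>V\<^esub>),
     add = (\<lambda>S T. \<lambda>x\<in>carrier V. S x \<oplus>\<^bsub>V\<^esub> T x),
     smult = (\<lambda>c T. \<lambda>x\<in>carrier V. c \<odot>\<^bsub>V\<^esub> T x)\<rparr>"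

lemma (in module) End_algebra_assoc_alg: "assoc_alg R (End_algebra R M)"
proof -
  have eqI: "S = T" if "S \<in> extensional (carrier M)" "T \<in> extensional (carrier M)"
      "\<And>x. x \<in> carrier M \<Longrightarrow> S x = T x" for S T :: "'c \<Rightarrow> 'c"
    using that by (rule extensionalityI)
  have smult_commute: "a \<odot>\<^bsub>M\<^esub> (c \<odot>\<^bsub>M\<^esub> x) = c \<odot>\<^bsub>M\<^esub> (a \<odot>\<^bsub>M\<^esub> x)"
    if "a \<in> carrier R" "c \<in> carrier R" "x \<in> carrier M" for a c x
    using that by (simp add: smult_assoc1[symmetric] R.m_comm)
  note simps = End_algebra_def Pi_iff smult_l_distr smult_r_distr smult_assoc1 M.a_ac
  show ?thesis
  proof (rule assoc_alg.intro, rule assoc_algebraI)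
    show "cring R" ..
    show "ring (End_algebra R M)"
    proof (rule ringI)
      show "abelian_group (End_algebra R M)"
      proof (rule abelian_groupI)
        fix T assume T: "T \<in> carrier (End_algebra R M)"
        then show "\<exists>S\<in>carrier (End_algebra R M). S \<oplus>\<^bsub>End_algebra R M\<^esub> T = \<zero>\<^bsub>End_algebra R M\<^esub>"
          by (intro bexI[of _ "\<lambda>x\<in>carrier M. \<ominus>\<^bsub>M\<^esub> T x"])
            (auto simp: simps M.l_neg M.r_neg M.minus_add smult_r_minus intro!: restrict_ext)
      qed (auto simp: simps intro!: eqI)
      show "monoid (End_algebra R M)"
        by (rule monoidI) (auto simp: simps intro!: eqI)
    qed (auto simp: simps intro!: eqI)
  qed (auto simp: simps smult_commute intro!: eqI)
qed

definition fun_module :: "('k, 'e) ring_scheme \<Rightarrow> ('k, 'g \<Rightarrow> 'k) module" where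
  "fun_module K =
    \<lparr>carrier = {f. \<forall>x. f x \<in> carrier K},
     mult = (\<lambda>f g x. f x \<otimes>\<^bsub>K\<^esub> g x),
     one = (\<lambda>x. \<one>\<^bsub>K\<^esub>),
     zero = (\<lambda>x. \<zero>\<^bsub>K\<^esub>),
     add = (\<lambda>f g x. f x \<oplus>\<^bsub>K\<^esub> g x),
     smult = (\<lambda>c f x. c \<otimes>\<^bsub>K\<^esub> f x)\<rparr>"

lemma (in cring) fun_module: "module R (fun_module R)"
proof (rule moduleI)
  show "cring R" ..
  show "abelian_group (fun_module R)"
  proof (rule abelian_groupI)
    fix f assume "f \<in> carrier (fun_module R)"
    then show "\<exists>g\<in>carrier (fun_module R). g \<oplus>\<^bsub>fun_module R\<^esub> f = \<zero>\<^bsub>fun_module R\<^esub>"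
      by (intro bexI[of _ "\<lambda>x. \<ominus> f x"]) (auto simp: fun_module_def l_neg)
  qed (auto simp: fun_module_def a_ac)
qed (auto simp: fun_module_def l_distr r_distr m_assoc)

section \<open>Linear spans of words\<close>

context assoc_alg
begin

text \<open>Elements are taken as values of polynomials supported in \<open>N\<close>, so each of
  them comes with coefficients indexed by words, from which leading terms can be computed.\<close>

definition word_span :: "('x \<Rightarrow> 'a) \<Rightarrow> 'x set \<Rightarrow> 'x list set \<Rightarrow> 'a set" where
  "word_span g X N = free_eval g ` {f \<in> carrier (free_algebra K X). \<forall>w. f w \<noteq> \<zero> \<longrightarrow> w \<in> N}"

lemma word_spanE:
  assumes "z \<in> word_span g X N"
  obtains f where "f \<in> carrier (free_algebra K X)" "\<forall>w. f w \<noteq> \<zero> \<longrightarrow> w \<in> N"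
    "z = free_eval g f"
  using assms unfolding word_span_def by blast

lemma word_span_mono: "M \<subseteq> N \<Longrightarrow> word_span g X M \<subseteq> word_span g X N"
  unfolding word_span_def by blast

context
  fixes X :: "'x set" and g :: "'x \<Rightarrow> 'a"
  assumes g: "g \<in> X \<rightarrow> carrier A"
begin

lemma word_span_carrier: "word_span g X N \<subseteq> carrier A"
  unfolding word_span_def using free_eval_closed[OF g] by auto

lemma word_span_zero: "\<zero>\<^bsub>A\<^esub> \<in> word_span g X N"
  unfolding word_span_def
  by (rule image_eqI[of _ _ "\<lambda>w. \<zero>"]) (auto simp: free_eval_zero[OF g] K.free_carrier_iff)

lemma word_span_word:
  assumes "w \<in> N" "w \<in> lists X"
  shows "word_prod g w \<in> word_span g X N"
proof -
  have "K.free_word w \<in> {f \<in> carrier (free_algebra K X). \<forall>v. f v \<noteq> \<zero> \<longrightarrow> v \<in> N}"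
    using K.free_word_closed[OF assms(2)] assms(1) by (simp add: K.free_word_def)
  then show ?thesis
    unfolding word_span_def free_eval_word[OF g assms(2), symmetric] by (rule imageI)
qed

lemma word_span_add:
  assumes "y \<in> word_span g X N" "z \<in> word_span g X N"
  shows "y \<oplus>\<^bsub>A\<^esub> z \<in> word_span g X N"
proof -
  obtain f f' where f: "f \<in> carrier (free_algebra K X)" "\<forall>w. f w \<noteq> \<zero> \<longrightarrow> w \<in> N" "y = free_eval g f"
    and f': "f' \<in> carrier (free_algebra K X)" "\<forall>w. f' w \<noteq> \<zero> \<longrightarrow> w \<in> N" "z = free_eval g f'"
    using assms unfolding word_span_def by blast
  have "f w \<noteq> \<zero> \<or> f' w \<noteq> \<zero>" if "f w \<oplus> f' w \<noteq> \<zero>" for w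
    using that by auto
  then show ?thesis
    unfolding word_span_def using f f' free_eval_add[OF g f(1) f'(1)] K.free_add_closed[OF f(1) f'(1)]
    by (intro image_eqI[of _ _ "\<lambda>w. f w \<oplus> f' w"]) auto
qed

lemma word_span_smult:
  assumes "y \<in> word_span g X N" "c \<in> carrier K"
  shows "c \<odot>\<^bsub>A\<^esub> y \<in> word_span g X N"
proof -
  obtain f where f: "f \<in> carrier (free_algebra K X)" "\<forall>w. f w \<noteq> \<zero> \<longrightarrow> w \<in> N" "y = free_eval g f"
    using assms unfolding word_span_def by blast
  have "f w \<noteq> \<zero>" if "c \<otimes> f w \<noteq> \<zero>" for w
    using that assms(2) by auto
  then show ?thesis
    unfolding word_span_def
    using f free_eval_smult[OF g f(1) assms(2)] K.free_smult_closed[OF f(1) assms(2)]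
    by (intro image_eqI[of _ _ "\<lambda>w. c \<otimes> f w"]) auto
qed

lemma word_span_mult:
  assumes "y \<in> word_span g X M" "z \<in> word_span g X N"
  shows "y \<otimes>\<^bsub>A\<^esub> z \<in> word_span g X {u @ v |u v. u \<in> M \<and> v \<in> N}"
proof -
  obtain f f' where f: "f \<in> carrier (free_algebra K X)" "\<forall>w. f w \<noteq> \<zero> \<longrightarrow> w \<in> M" "y = free_eval g f"
    and f': "f' \<in> carrier (free_algebra K X)" "\<forall>w. f' w \<noteq> \<zero> \<longrightarrow> w \<in> N" "z = free_eval g f'"
    using assms unfolding word_span_def by blast
  have "\<exists>u v. w = u @ v \<and> f u \<noteq> \<zero> \<and> f' v \<noteq> \<zero>" if "K.conv f f' w \<noteq> \<zero>" for w
    using f f' that by (intro K.conv_nonzeroD) (auto simp: K.free_carrier_iff)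
  then have "\<forall>w. K.conv f f' w \<noteq> \<zero> \<longrightarrow> w \<in> {u @ v |u v. u \<in> M \<and> v \<in> N}"
    using f(2) f'(2) by blast
  then show ?thesis
    unfolding word_span_def using f f' free_eval_mult[OF g f(1) f'(1)] K.free_conv_closed[OF f(1) f'(1)]
    by (intro image_eqI[of _ _ "K.conv f f'"]) auto
qed

lemma word_span_subset:
  assumes "\<And>w. \<lbrakk>w \<in> M; w \<in> lists X\<rbrakk> \<Longrightarrow> word_prod g w \<in> word_span g X N"
  shows "word_span g X M \<subseteq> word_span g X N"
proof
  fix z assume "z \<in> word_span g X M"
  then obtain f where f: "f \<in> carrier (free_algebra K X)" "\<forall>w. f w \<noteq> \<zero> \<longrightarrow> w \<in> M" "z = free_eval g f"
    unfolding word_span_def by blast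
  have "(\<Oplus>\<^bsub>A\<^esub>w\<in>W. f w \<odot>\<^bsub>A\<^esub> word_prod g w) \<in> word_span g X N"
    if "finite W" "W \<subseteq> {w. f w \<noteq> \<zero>}" for W
    using that
  proof (induction W rule: finite_induct)
    case empty
    then show ?case by (simp add: word_span_zero)
  next
    case (insert w W)
    have mem: "f v \<odot>\<^bsub>A\<^esub> word_prod g v \<in> word_span g X N" if "v \<in> insert w W" for v
    proof -
      have "v \<in> M" "v \<in> lists X" "f v \<in> carrier K"
        using that insert.prems f unfolding K.free_carrier_iff by blast+
      then show ?thesis using assms word_span_smult by blast
    qed
    then have "(\<lambda>v. f v \<odot>\<^bsub>A\<^esub> word_prod g v) \<in> insert w W \<rightarrow> carrier A"
      using word_span_carrier by blast
    then show ?case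
      using insert mem word_span_add by (simp add: Pi_iff)
  qed
  then show "z \<in> word_span g X N"
    using f unfolding free_eval_def K.free_carrier_iff by blast
qed

section \<open>Straightening words in generators that commute up to scalars and constants\<close>

context
  assumes commute: "\<And>x y. \<lbrakk>x \<in> X; y \<in> X\<rbrakk> \<Longrightarrow> \<exists>c\<in>carrier K. \<exists>d\<in>carrier K.
    g x \<otimes>\<^bsub>A\<^esub> g y = c \<odot>\<^bsub>A\<^esub> (g y \<otimes>\<^bsub>A\<^esub> g x) \<oplus>\<^bsub>A\<^esub> d \<odot>\<^bsub>A\<^esub> \<one>\<^bsub>A\<^esub>"
begin

text \<open>Passing a letter costs a scalar and a term in which two letters have disappeared. The
  bound \<open>length u\<close> on the remainder is crude, but it is strictly less than the length
  of \<open>x # u\<close>, which is what an induction on the length requires.\<close>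

lemma word_move_letter:
  assumes "u \<in> lists X" "x \<in> X"
  shows "\<exists>c\<in>carrier K. \<exists>z\<in>word_span g X {w. length w \<le> length u}.
    g x \<otimes>\<^bsub>A\<^esub> word_prod g u = c \<odot>\<^bsub>A\<^esub> (word_prod g u \<otimes>\<^bsub>A\<^esub> g x) \<oplus>\<^bsub>A\<^esub> z"
  using assms(1)
proof (induction u)
  case Nil
  have "g x \<in> carrier A" using g assms by auto
  then show ?case
    using word_span_zero by (intro bexI[of _ "\<one>"] bexI[of _ "\<zero>\<^bsub>A\<^esub>"]) auto
next
  case (Cons y v)
  then have y: "y \<in> X" and v: "v \<in> lists X" by auto
  have cl: "g x \<in> carrier A" "g y \<in> carrier A" "word_prod g v \<in> carrier A"
    using g assms y word_prod_closed[OF g v] by auto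
  obtain c z where c: "c \<in> carrier K" and z: "z \<in> word_span g X {w. length w \<le> length v}"
    and 1: "g x \<otimes>\<^bsub>A\<^esub> word_prod g v = c \<odot>\<^bsub>A\<^esub> (word_prod g v \<otimes>\<^bsub>A\<^esub> g x) \<oplus>\<^bsub>A\<^esub> z"
    using Cons by blast
  obtain c' d where c': "c' \<in> carrier K" and d: "d \<in> carrier K"
    and 2: "g x \<otimes>\<^bsub>A\<^esub> g y = c' \<odot>\<^bsub>A\<^esub> (g y \<otimes>\<^bsub>A\<^esub> g x) \<oplus>\<^bsub>A\<^esub> d \<odot>\<^bsub>A\<^esub> \<one>\<^bsub>A\<^esub>"
    using commute[OF assms(2) y] by blast
  have zc: "z \<in> carrier A" using z word_span_carrier by blast
  have "g x \<otimes>\<^bsub>A\<^esub> word_prod g (y # v) = (g x \<otimes>\<^bsub>A\<^esub> g y) \<otimes>\<^bsub>A\<^esub> word_prod g v"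
    using cl by (simp add: A.m_assoc)
  also have "\<dots> = c' \<odot>\<^bsub>A\<^esub> (g y \<otimes>\<^bsub>A\<^esub> (g x \<otimes>\<^bsub>A\<^esub> word_prod g v)) \<oplus>\<^bsub>A\<^esub> d \<odot>\<^bsub>A\<^esub> word_prod g v"
    unfolding 2 using cl c' d by (simp add: A.l_distr smult_mult A.m_assoc)
  also have "\<dots> = (c' \<otimes> c) \<odot>\<^bsub>A\<^esub> (word_prod g (y # v) \<otimes>\<^bsub>A\<^esub> g x) \<oplus>\<^bsub>A\<^esub>
      (c' \<odot>\<^bsub>A\<^esub> (g y \<otimes>\<^bsub>A\<^esub> z) \<oplus>\<^bsub>A\<^esub> d \<odot>\<^bsub>A\<^esub> word_prod g v)"
    unfolding 1 using cl c c' d zc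
    by (simp add: A.r_distr mult_smult M.smult_r_distr M.smult_assoc1 A.m_assoc A.a_assoc)
  finally have eq: "g x \<otimes>\<^bsub>A\<^esub> word_prod g (y # v) =
      (c' \<otimes> c) \<odot>\<^bsub>A\<^esub> (word_prod g (y # v) \<otimes>\<^bsub>A\<^esub> g x) \<oplus>\<^bsub>A\<^esub>
      (c' \<odot>\<^bsub>A\<^esub> (g y \<otimes>\<^bsub>A\<^esub> z) \<oplus>\<^bsub>A\<^esub> d \<odot>\<^bsub>A\<^esub> word_prod g v)" .
  have "word_prod g [y] \<in> word_span g X {[y]}"
    by (rule word_span_word) (use y in auto)
  from word_span_mult[OF this z]
  have "word_prod g [y] \<otimes>\<^bsub>A\<^esub> z \<in> word_span g X {w. length w \<le> length (y # v)}"
    by (rule rev_subsetD) (rule word_span_mono, auto)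
  then have "g y \<otimes>\<^bsub>A\<^esub> z \<in> word_span g X {w. length w \<le> length (y # v)}"
    using cl by simp
  moreover have "word_prod g v \<in> word_span g X {w. length w \<le> length (y # v)}"
    by (rule word_span_word) (use v in auto)
  ultimately have "c' \<odot>\<^bsub>A\<^esub> (g y \<otimes>\<^bsub>A\<^esub> z) \<oplus>\<^bsub>A\<^esub> d \<odot>\<^bsub>A\<^esub> word_prod g v \<in>
      word_span g X {w. length w \<le> length (y # v)}"
    using c' d by (intro word_span_add word_span_smult)
  then show ?case
    using eq c c' by blast
qed

lemma word_permute:
  assumes w: "w \<in> lists X" and w': "mset w = mset w'"
  shows "\<exists>c\<in>carrier K. \<exists>z\<in>word_span g X {v. length v < length w}.
    word_prod g w = c \<odot>\<^bsub>A\<^esub> word_prod g w' \<oplus>\<^bsub>A\<^esub> z"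
  using w w'
proof (induction w arbitrary: w' rule: list.induct)
  case Nil
  then show ?case
    using word_span_zero by (intro bexI[of _ "\<one>"] bexI[of _ "\<zero>\<^bsub>A\<^esub>"]) auto
next
  case (Cons x w)
  then have x: "x \<in> X" and w: "w \<in> lists X" by auto
  \<comment> \<open>The first letter of \<open>w\<close> is located in \<open>w'\<close>; the
    induction hypothesis arranges the tail as \<open>u @ v\<close>, and then \<open>x\<close> is
    moved across \<open>u\<close>.\<close>
  have "x \<in> set w'" using Cons.prems(2) by (metis list.set_intros(1) set_mset_mset)
  then obtain u v where w': "w' = u @ x # v" by (auto dest: split_list)
  have "set w' = set (x # w)" using Cons.prems(2) by (metis set_mset_mset)
  then have uv: "u \<in> lists X" "v \<in> lists X" using Cons.prems(1) w' unfolding lists_eq_set by auto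
  have ms: "mset w = mset (u @ v)" using Cons.prems(2) w' by simp
  then have len: "length w = length u + length v"
    by (metis length_append size_mset)
  obtain c z where c: "c \<in> carrier K" and z: "z \<in> word_span g X {v. length v < length w}"
    and 1: "word_prod g w = c \<odot>\<^bsub>A\<^esub> word_prod g (u @ v) \<oplus>\<^bsub>A\<^esub> z"
    using Cons.IH[OF w ms] by blast
  obtain c' z' where c': "c' \<in> carrier K" and z': "z' \<in> word_span g X {w. length w \<le> length u}"
    and 2: "g x \<otimes>\<^bsub>A\<^esub> word_prod g u = c' \<odot>\<^bsub>A\<^esub> (word_prod g u \<otimes>\<^bsub>A\<^esub> g x) \<oplus>\<^bsub>A\<^esub> z'"
    using word_move_letter[OF uv(1) x] by blast
  have cl: "g x \<in> carrier A" "word_prod g u \<in> carrier A" "word_prod g v \<in> carrier A"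
    "z \<in> carrier A" "z' \<in> carrier A"
    using g x word_prod_closed[OF g] uv z z' word_span_carrier by blast+
  have app: "word_prod g (u @ v) = word_prod g u \<otimes>\<^bsub>A\<^esub> word_prod g v"
    "word_prod g w' = word_prod g u \<otimes>\<^bsub>A\<^esub> (g x \<otimes>\<^bsub>A\<^esub> word_prod g v)"
    using word_prod_append[OF g uv(1), of v] word_prod_append[OF g uv(1), of "x # v"] uv x w' by auto
  have "word_prod g (x # w) =
      c \<odot>\<^bsub>A\<^esub> ((g x \<otimes>\<^bsub>A\<^esub> word_prod g u) \<otimes>\<^bsub>A\<^esub> word_prod g v) \<oplus>\<^bsub>A\<^esub> g x \<otimes>\<^bsub>A\<^esub> z"
    using cl c by (simp add: 1 app A.r_distr mult_smult A.m_assoc)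
  also have "\<dots> = (c \<otimes> c') \<odot>\<^bsub>A\<^esub> word_prod g w' \<oplus>\<^bsub>A\<^esub>
      (c \<odot>\<^bsub>A\<^esub> (z' \<otimes>\<^bsub>A\<^esub> word_prod g v) \<oplus>\<^bsub>A\<^esub> g x \<otimes>\<^bsub>A\<^esub> z)"
    unfolding 2 app using cl c c'
    by (simp add: A.l_distr smult_mult M.smult_r_distr M.smult_assoc1 A.m_assoc A.a_assoc)
  finally have eq: "word_prod g (x # w) = (c \<otimes> c') \<odot>\<^bsub>A\<^esub> word_prod g w' \<oplus>\<^bsub>A\<^esub>
      (c \<odot>\<^bsub>A\<^esub> (z' \<otimes>\<^bsub>A\<^esub> word_prod g v) \<oplus>\<^bsub>A\<^esub> g x \<otimes>\<^bsub>A\<^esub> z)" .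
  have "word_prod g [x] \<in> word_span g X {[x]}"
    by (rule word_span_word) (use x in auto)
  from word_span_mult[OF this z]
  have "word_prod g [x] \<otimes>\<^bsub>A\<^esub> z \<in> word_span g X {v. length v < length (x # w)}"
    by (rule rev_subsetD) (rule word_span_mono, auto)
  then have "g x \<otimes>\<^bsub>A\<^esub> z \<in> word_span g X {v. length v < length (x # w)}"
    using cl by simp
  moreover have "word_prod g v \<in> word_span g X {v}"
    by (rule word_span_word) (use uv in auto)
  from word_span_mult[OF z' this]
  have "z' \<otimes>\<^bsub>A\<^esub> word_prod g v \<in> word_span g X {v. length v < length (x # w)}"
    by (rule rev_subsetD) (rule word_span_mono, auto simp: len)
  ultimately have "c \<odot>\<^bsub>A\<^esub> (z' \<otimes>\<^bsub>A\<^esub> word_prod g v) \<oplus>\<^bsub>A\<^esub> g x \<otimes>\<^bsub>A\<^esub> z \<in>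
      word_span g X {v. length v < length (x # w)}"
    using c by (intro word_span_add word_span_smult)
  then show ?case using eq c c' by blast
qed

text \<open>Induction on the length: a word is a multiple of any rearrangement up to shorter words.
  The second alternative in the assumption is meant for the torus, where a word containing a
  generator and its inverse has no arrangement in normal form but can be arranged so that the two
  cancel.\<close>

lemma word_span_normal_forms:
  assumes N: "\<And>w. w \<in> lists X \<Longrightarrow> \<exists>w'. mset w' = mset w \<and>
      (w' \<in> N \<or> word_prod g w' \<in> word_span g X {v. length v < length w})"
    and "w \<in> lists X"
  shows "word_prod g w \<in> word_span g X N"
  using assms(2)
proof (induction "length w" arbitrary: w rule: less_induct)
  case less
  obtain w' where w': "mset w' = mset w"
    "w' \<in> N \<or> word_prod g w' \<in> word_span g X {v. length v < length w}"
    using N less.prems by blast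
  have "set w' = set w" using w'(1) by (metis set_mset_mset)
  then have wl: "w' \<in> lists X" using less.prems unfolding lists_eq_set by auto
  have sub: "word_span g X {v. length v < length w} \<subseteq> word_span g X N"
    by (rule word_span_subset) (use less.hyps in auto)
  then have "word_prod g w' \<in> word_span g X N"
    using w'(2) word_span_word wl by blast
  then show ?case
    using word_permute[OF less.prems w'(1)[symmetric]] sub word_span_add word_span_smult
    by auto
qed

end

end

end

lemma (in presentation) carrier_eq_word_span:
  assumes "\<And>w. w \<in> lists X \<Longrightarrow> PA.word_prod gen w \<in> PA.word_span gen X N"
  shows "carrier PA = PA.word_span gen X N"
proof
  show "carrier PA \<subseteq> PA.word_span gen X N"
  proof
    fix z assume "z \<in> carrier PA"
    then show "z \<in> PA.word_span gen X N"
      by (induction rule: presented_induct)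
        (simp_all add: PA.word_span_zero[OF gen_closed] PA.word_span_add[OF gen_closed]
          PA.word_span_smult[OF gen_closed] assms)
  qed
qed (rule PA.word_span_carrier[OF gen_closed])

section \<open>Leading terms\<close>

locale bicharacter = K: field K for K :: "('k, 'e) ring_scheme" (structure) +
  fixes \<beta> :: "'g::linordered_ab_group_add \<Rightarrow> 'g \<Rightarrow> 'k"
  assumes beta_Units: "\<beta> a b \<in> Units K"
    and beta_add_left: "\<beta> (a + a') b = \<beta> a b \<otimes> \<beta> a' b"
    and beta_add_right: "\<beta> a (b + b') = \<beta> a b \<otimes> \<beta> a b'"
begin

lemma beta_closed [simp]: "\<beta> a b \<in> carrier K" and beta_nonzero [simp]: "\<beta> a b \<noteq> \<zero>"
  using beta_Units[of a b] by (auto simp: K.field_Units)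

lemma beta_zero_left [simp]: "\<beta> 0 b = \<one>"
  using beta_add_left[of 0 0 b] beta_closed[of 0 b] beta_nonzero[of 0 b]
  by (metis K.m_rcancel K.one_closed K.l_one add.right_neutral)

lemma beta_zero_right [simp]: "\<beta> a 0 = \<one>"
  using beta_add_right[of a 0 0] beta_closed[of a 0] beta_nonzero[of a 0]
  by (metis K.m_rcancel K.one_closed K.l_one add.right_neutral)

end

text \<open>
  The set \<^term>\<open>P a c\<close> is meant to consist of the elements with leading term \<^term>\<open>c\<close> in degree
  \<^term>\<open>a\<close>; for \<open>c = 0\<close> these are the elements all of whose terms have degree below \<^term>\<open>a\<close>.
\<close>

locale leading = assoc_alg K A + bicharacter K \<beta>
  for K :: "('k, 'e) ring_scheme" (structure) and A :: "('k, 'a, 'm) module_scheme"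
    and \<beta> :: "'g::linordered_ab_group_add \<Rightarrow> 'g \<Rightarrow> 'k" +
  fixes P :: "'g \<Rightarrow> 'k \<Rightarrow> 'a set"
  assumes P_carrier: "z \<in> P a c \<Longrightarrow> z \<in> carrier A"
    and P_coeff: "z \<in> P a c \<Longrightarrow> c \<in> carrier K"
    and P_add: "\<lbrakk>z \<in> P a c; z' \<in> P a c'\<rbrakk> \<Longrightarrow> z \<oplus>\<^bsub>A\<^esub> z' \<in> P a (c \<oplus> c')"
    and P_smult: "\<lbrakk>z \<in> P a c; d \<in> carrier K\<rbrakk> \<Longrightarrow> d \<odot>\<^bsub>A\<^esub> z \<in> P a (d \<otimes> c)"
    and P_mult: "\<lbrakk>z \<in> P a c; z' \<in> P b d\<rbrakk> \<Longrightarrow>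
      z \<otimes>\<^bsub>A\<^esub> z' \<in> P (a + b) (c \<otimes> d \<otimes> \<beta> a b)"
    and P_lower: "\<lbrakk>z \<in> P a c; a < b\<rbrakk> \<Longrightarrow> z \<in> P b \<zero>"
    and P_one: "\<one>\<^bsub>A\<^esub> \<in> P 0 \<one>"
    and P_zero: "\<zero>\<^bsub>A\<^esub> \<in> P a \<zero>"
    and P_zeroD: "\<zero>\<^bsub>A\<^esub> \<in> P a c \<Longrightarrow> c = \<zero>"
begin

text \<open>Subtracting the element from itself puts zero into degree \<open>a\<close> with
  coefficient \<open>c \<ominus> c'\<close>. So all uniqueness rests on
  \<open>P_zeroD\<close>.\<close>

lemma P_unique_coeff:
  assumes "z \<in> P a c" "z \<in> P a c'"
  shows "c = c'"
proof -
  note cl = P_coeff[OF assms(1)] P_coeff[OF assms(2)] P_carrier[OF assms(1)]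
  have "z \<oplus>\<^bsub>A\<^esub> (\<ominus> \<one>) \<odot>\<^bsub>A\<^esub> z \<in> P a (c \<oplus> (\<ominus> \<one>) \<otimes> c')"
    using assms by (intro P_add P_smult) auto
  moreover have "z \<oplus>\<^bsub>A\<^esub> (\<ominus> \<one>) \<odot>\<^bsub>A\<^esub> z = \<zero>\<^bsub>A\<^esub>"
    using cl by (simp add: M.smult_l_minus A.r_neg)
  ultimately have "c \<ominus> c' = \<zero>"
    using P_zeroD cl by (simp add: K.l_minus a_minus_def)
  then show ?thesis using cl by simp
qed

lemma P_unique:
  assumes "z \<in> P a c" "z \<in> P a' c'" "c \<noteq> \<zero>" "c' \<noteq> \<zero>"
  shows "a = a'" "c = c'"
proof -
  \<comment> \<open>In the larger of two different degrees the element would also have leading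
    coefficient zero, by \<open>P_lower\<close>.\<close>
  show "a = a'"
    using P_lower P_unique_coeff assms by (metis linorder_less_linear)
  then show "c = c'" using assms P_unique_coeff by blast
qed

text \<open>Degrees are pairwise different, so no cancellation is possible: the summand of largest
  degree wins, and all others count as zero there.\<close>

lemma P_sum:
  assumes "finite W" "W \<noteq> {}" "inj_on a W"
    and "\<And>w. w \<in> W \<Longrightarrow> z w \<in> P (a w) (c w)" "\<And>w. w \<in> W \<Longrightarrow> c w \<noteq> \<zero>"
  shows "\<exists>w\<in>W. (\<Oplus>\<^bsub>A\<^esub>w\<in>W. z w) \<in> P (a w) (c w)"
  using assms
proof (induction W rule: finite_ne_induct)
  case (singleton w)
  then show ?case using P_carrier[of "z w"] by simp
next
  case (insert w W)
  then obtain v where v: "v \<in> W" "(\<Oplus>\<^bsub>A\<^esub>w\<in>W. z w) \<in> P (a v) (c v)"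
    by (auto simp: inj_on_def)
  have cl: "z \<in> W \<rightarrow> carrier A" "z w \<in> carrier A" "c w \<in> carrier K" "c v \<in> carrier K"
    using insert.prems(2) v(1) by (auto intro: P_carrier P_coeff)
  have eq: "(\<Oplus>\<^bsub>A\<^esub>w\<in>insert w W. z w) = z w \<oplus>\<^bsub>A\<^esub> (\<Oplus>\<^bsub>A\<^esub>w\<in>W. z w)"
    using insert cl by simp
  have "a v \<noteq> a w" using insert v(1) by (auto simp: inj_on_def)
  then consider "a v < a w" | "a w < a v" by fastforce
  then show ?case
  proof cases
    case 1
    have "z w \<oplus>\<^bsub>A\<^esub> (\<Oplus>\<^bsub>A\<^esub>w\<in>W. z w) \<in> P (a w) (c w \<oplus> \<zero>)"
      using P_lower[OF v(2) 1] insert.prems(2) by (intro P_add) auto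
    then show ?thesis using eq cl by auto
  next
    case 2
    have "z w \<oplus>\<^bsub>A\<^esub> (\<Oplus>\<^bsub>A\<^esub>w\<in>W. z w) \<in> P (a v) (\<zero> \<oplus> c v)"
      using P_lower[OF _ 2] insert.prems(2) v by (intro P_add) auto
    then show ?thesis using eq cl v by auto
  qed
qed

lemma P_mult_nonzero:
  assumes "z \<in> P a c" "z' \<in> P b d" "c \<noteq> \<zero>" "d \<noteq> \<zero>"
  shows "c \<otimes> d \<otimes> \<beta> a b \<noteq> \<zero>"
  using assms P_coeff[OF assms(1)] P_coeff[OF assms(2)] by (simp add: K.integral_iff)

lemma P_nonzero: "\<lbrakk>z \<in> P a c; c \<noteq> \<zero>\<rbrakk> \<Longrightarrow> z \<noteq> \<zero>\<^bsub>A\<^esub>"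
  using P_zeroD by blast

lemma P_word:
  assumes g: "g \<in> X \<rightarrow> carrier A"
    and a: "\<And>x. x \<in> X \<Longrightarrow> \<exists>c. c \<noteq> \<zero> \<and> g x \<in> P (a x) c" and "w \<in> lists X"
  shows "\<exists>c. c \<noteq> \<zero> \<and> word_prod g w \<in> P (sum_list (map a w)) c"
  using assms(3)
proof (induction w)
  case Nil
  then show ?case using P_one by (intro exI[of _ "\<one>"]) simp
next
  case (Cons x w)
  then obtain c where c: "c \<noteq> \<zero>" "word_prod g w \<in> P (sum_list (map a w)) c" by auto
  obtain d where d: "d \<noteq> \<zero>" "g x \<in> P (a x) d" using a Cons by auto
  show ?case
    using P_mult[OF d(2) c(2)] P_mult_nonzero[OF d(2) c(2) d(1) c(1)] by auto
qed

text \<open>Serves two purposes. For words that span, it gives every nonzero element a nonzero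
  leading term; applied to images under a homomorphism, it shows that no nontrivial combination of
  the words is mapped to zero.\<close>

lemma P_word_span:
  assumes g: "g \<in> X \<rightarrow> carrier A"
    and a: "\<And>x. x \<in> X \<Longrightarrow> \<exists>c. c \<noteq> \<zero> \<and> g x \<in> P (a x) c"
    and inj: "inj_on (\<lambda>w. sum_list (map a w)) (N \<inter> lists X)"
    and f: "f \<in> carrier (free_algebra K X)" "\<And>w. f w \<noteq> \<zero> \<Longrightarrow> w \<in> N" "f \<noteq> (\<lambda>w. \<zero>)"
  shows "\<exists>b c. c \<noteq> \<zero> \<and> free_eval g f \<in> P b c"
proof -
  let ?W = "{w. f w \<noteq> \<zero>}"
  have W: "finite ?W" "?W \<noteq> {}" "?W \<subseteq> N \<inter> lists X" and fc: "\<And>w. f w \<in> carrier K"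
    using f by (auto simp: K.free_carrier_iff)
  have "\<exists>c. c \<noteq> \<zero> \<and> f w \<odot>\<^bsub>A\<^esub> word_prod g w \<in> P (sum_list (map a w)) c" if w: "w \<in> ?W" for w
  proof -
    obtain c where c: "c \<noteq> \<zero>" "word_prod g w \<in> P (sum_list (map a w)) c"
      using P_word[OF g a, of w] W w by auto
    then have "f w \<otimes> c \<noteq> \<zero>"
      using w fc P_coeff[OF c(2)] by (simp add: K.integral_iff)
    then show ?thesis using P_smult[OF c(2) fc] by blast
  qed
  then obtain c where c: "\<And>w. w \<in> ?W \<Longrightarrow> c w \<noteq> \<zero> \<and> f w \<odot>\<^bsub>A\<^esub> word_prod g w \<in> P (sum_list (map a w)) (c w)"
    by metis
  have "inj_on (\<lambda>w. sum_list (map a w)) ?W"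
    using inj_on_subset[OF inj W(3)] .
  from P_sum[OF W(1,2) this, of "\<lambda>w. f w \<odot>\<^bsub>A\<^esub> word_prod g w" c]
  show ?thesis
    unfolding free_eval_def using c by auto
qed

end
text \<open>Kept apart from \<open>leading\<close>, since totality for \<open>S\<close> is derived
  by means of \<open>P_word_span\<close>, a consequence of the other axioms.\<close>

locale total_leading = leading K A \<beta> P
  for K :: "('k, 'e) ring_scheme" (structure) and A :: "('k, 'a, 'm) module_scheme"
    and \<beta> :: "'g::linordered_ab_group_add \<Rightarrow> 'g \<Rightarrow> 'k" and P :: "'g \<Rightarrow> 'k \<Rightarrow> 'a set" +
  assumes P_total: "\<lbrakk>z \<in> carrier A; z \<noteq> \<zero>\<^bsub>A\<^esub>\<rbrakk> \<Longrightarrow> \<exists>a c. c \<noteq> \<zero> \<and> z \<in> P a c"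

subsection \<open>Leading terms from a representation\<close>

context bicharacter
begin

text \<open>The principal symbol of an operator: on the top coefficient of a function vanishing
  above \<open>b\<close>, \<open>s\<close> acts as \<open>c\<close> times a translation by
  \<open>a\<close> twisted by \<open>\<beta>\<close>. Testing all \<open>b\<close> and all such
  functions makes the condition stable under composition.\<close>

definition rep_lead :: "('k, 'a, 'm) module_scheme \<Rightarrow> ('a \<Rightarrow> ('g \<Rightarrow> 'k) \<Rightarrow> 'g \<Rightarrow> 'k) \<Rightarrow> 'g \<Rightarrow> 'k \<Rightarrow> 'a set" where
  "rep_lead A \<rho> a c = {s \<in> carrier A. c \<in> carrier K \<and>
     (\<forall>b. \<forall>f\<in>carrier (fun_module K). (\<forall>e>b. f e = \<zero>) \<longrightarrow>
        (\<forall>e>a + b. \<rho> s f e = \<zero>) \<and> \<rho> s f (a + b) = c \<otimes> \<beta> a b \<otimes> f b)}"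

lemma rep_leadD:
  assumes "s \<in> rep_lead A \<rho> a c" "f \<in> carrier (fun_module K)" "\<forall>e>b. f e = \<zero>"
  shows "\<And>e. e > a + b \<Longrightarrow> \<rho> s f e = \<zero>" "\<rho> s f (a + b) = c \<otimes> \<beta> a b \<otimes> f b"
  using assms unfolding rep_lead_def by auto

lemma rep_leadI:
  assumes "s \<in> carrier A" "c \<in> carrier K"
    and "\<And>b f e. \<lbrakk>f \<in> carrier (fun_module K); \<forall>e>b. f e = \<zero>; e > a + b\<rbrakk> \<Longrightarrow> \<rho> s f e = \<zero>"
    and "\<And>b f. \<lbrakk>f \<in> carrier (fun_module K); \<forall>e>b. f e = \<zero>\<rbrakk> \<Longrightarrow>
      \<rho> s f (a + b) = c \<otimes> \<beta> a b \<otimes> f b"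
  shows "s \<in> rep_lead A \<rho> a c"
  using assms unfolding rep_lead_def by blast

lemma End_fun_simps:
  assumes "f \<in> carrier (fun_module K)"
  shows "(S \<otimes>\<^bsub>End_algebra K (fun_module K)\<^esub> T) f = S (T f)"
    "\<one>\<^bsub>End_algebra K (fun_module K)\<^esub> f = f"
    "\<zero>\<^bsub>End_algebra K (fun_module K)\<^esub> f = (\<lambda>x. \<zero>)"
    "(S \<oplus>\<^bsub>End_algebra K (fun_module K)\<^esub> T) f = (\<lambda>x. S f x \<oplus> T f x)"
    "(c \<odot>\<^bsub>End_algebra K (fun_module K)\<^esub> T) f = (\<lambda>x. c \<otimes> T f x)"
  using assms by (simp_all add: End_algebra_def fun_module_def)

lemma End_fun_closed:
  assumes "f \<in> carrier (fun_module K)" "T \<in> carrier (End_algebra K (fun_module K))"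
  shows "T f \<in> carrier (fun_module K)" "T f x \<in> carrier K"
  using assms by (auto simp: End_algebra_def fun_module_def Pi_iff)

text \<open>The axioms hold for operators and are pulled back along \<open>\<rho>\<close>, whether
  or not \<open>\<rho>\<close> is injective. Zero acts as zero, and this alone keeps leading
  coefficients from being ambiguous.\<close>

lemma leading_rep_lead:
  assumes A: "assoc_alg K A" and \<rho>: "\<rho> \<in> assoc_algebra_hom K A (End_algebra K (fun_module K))"
  shows "leading K A \<beta> (rep_lead A \<rho>)"
proof -
  interpret A: assoc_alg K A by (rule A)
  interpret V: module K "fun_module K :: ('k, 'g \<Rightarrow> 'k) module" by (rule K.fun_module)
  interpret E: assoc_alg K "End_algebra K (fun_module K :: ('k, 'g \<Rightarrow> 'k) module)"
    by (rule V.End_algebra_assoc_alg)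
  note hom = assoc_algebra_homD[OF \<rho>]
  note cl = End_fun_closed[OF _ hom(3)]
  have car: "s \<in> carrier A" "c \<in> carrier K" if "s \<in> rep_lead A \<rho> a c" for s a c
    using that by (auto simp: rep_lead_def)
  have fcl: "f x \<in> carrier K" if "f \<in> carrier (fun_module K)" for f and x :: 'g
    using that by (simp add: fun_module_def)
  note simps = hom End_fun_simps cl fcl
  show ?thesis
  proof (intro leading.intro leading_axioms.intro)
    show "assoc_alg K A" by (rule A)
    show "bicharacter K \<beta>" by (rule bicharacter_axioms)
  next
    fix z a c z' c'
    assume z: "z \<in> rep_lead A \<rho> a c" and z': "z' \<in> rep_lead A \<rho> a c'"
    show "z \<oplus>\<^bsub>A\<^esub> z' \<in> rep_lead A \<rho> a (c \<oplus> c')"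
    proof (rule rep_leadI)
      fix b and f :: "'g \<Rightarrow> 'k" assume f: "f \<in> carrier (fun_module K)" "\<forall>e>b. f e = \<zero>"
      note D = rep_leadD[OF z f] rep_leadD[OF z' f]
      show "\<rho> (z \<oplus>\<^bsub>A\<^esub> z') f e = \<zero>" if "e > a + b" for e
        using that D car[OF z] car[OF z'] f by (simp add: simps)
      show "\<rho> (z \<oplus>\<^bsub>A\<^esub> z') f (a + b) = (c \<oplus> c') \<otimes> \<beta> a b \<otimes> f b"
        using D car[OF z] car[OF z'] f by (simp add: simps K.l_distr)
    qed (use car z z' in auto)
  next
    fix z a c d
    assume z: "z \<in> rep_lead A \<rho> a c" and d: "d \<in> carrier K"
    show "d \<odot>\<^bsub>A\<^esub> z \<in> rep_lead A \<rho> a (d \<otimes> c)"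
    proof (rule rep_leadI)
      fix b and f :: "'g \<Rightarrow> 'k" assume f: "f \<in> carrier (fun_module K)" "\<forall>e>b. f e = \<zero>"
      note D = rep_leadD[OF z f]
      show "\<rho> (d \<odot>\<^bsub>A\<^esub> z) f e = \<zero>" if "e > a + b" for e
        using that D car[OF z] d f by (simp add: simps)
      show "\<rho> (d \<odot>\<^bsub>A\<^esub> z) f (a + b) = d \<otimes> c \<otimes> \<beta> a b \<otimes> f b"
        using D car[OF z] d f by (simp add: simps K.m_assoc)
    qed (use car z d in auto)
  next
    fix z a c z' b d
    assume z: "z \<in> rep_lead A \<rho> a c" and z': "z' \<in> rep_lead A \<rho> b d"
    show "z \<otimes>\<^bsub>A\<^esub> z' \<in> rep_lead A \<rho> (a + b) (c \<otimes> d \<otimes> \<beta> a b)"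
    proof (rule rep_leadI)
      fix k and f :: "'g \<Rightarrow> 'k" assume f: "f \<in> carrier (fun_module K)" "\<forall>e>k. f e = \<zero>"
      note D' = rep_leadD[OF z' f]
      have f': "\<rho> z' f \<in> carrier (fun_module K)" using car[OF z'] f cl by simp
      have "\<forall>e>b + k. \<rho> z' f e = \<zero>" using D'(1) by blast
      note D = rep_leadD[OF z f' this]
      show "\<rho> (z \<otimes>\<^bsub>A\<^esub> z') f e = \<zero>" if "e > a + b + k" for e
        using that D(1)[of e] car[OF z] car[OF z'] f by (simp add: simps add.assoc)
      have "\<rho> (z \<otimes>\<^bsub>A\<^esub> z') f (a + b + k) = c \<otimes> \<beta> a (b + k) \<otimes> (d \<otimes> \<beta> b k \<otimes> f k)"
        using D(2) D'(2) car[OF z] car[OF z'] f by (simp add: simps add.assoc)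
      \<comment> \<open>The 2-cocycle identity \<open>\<beta> b k \<otimes> \<beta> a (b + k) =
        \<beta> a b \<otimes> \<beta> (a + b) k\<close>, a consequence of
        bimultiplicativity.\<close>
      also have "\<dots> = c \<otimes> d \<otimes> \<beta> a b \<otimes> \<beta> (a + b) k \<otimes> f k"
        using car[OF z] car[OF z'] fcl[OF f(1)]
        by (simp add: beta_add_left beta_add_right K.m_ac)
      finally show "\<rho> (z \<otimes>\<^bsub>A\<^esub> z') f (a + b + k) =
        c \<otimes> d \<otimes> \<beta> a b \<otimes> \<beta> (a + b) k \<otimes> f k" .
    qed (use car z z' in auto)
  next
    fix z and a b :: 'g and c
    assume z: "z \<in> rep_lead A \<rho> a c" and "a < b"
    show "z \<in> rep_lead A \<rho> b \<zero>"
    proof (rule rep_leadI)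
      fix k and f :: "'g \<Rightarrow> 'k" assume f: "f \<in> carrier (fun_module K)" "\<forall>e>k. f e = \<zero>"
      have 1: "a + k < b + k" using \<open>a < b\<close> by simp
      show "\<rho> z f e = \<zero>" if "e > b + k" for e
        using rep_leadD(1)[OF z f, of e] less_trans[OF 1 that] by blast
      show "\<rho> z f (b + k) = \<zero> \<otimes> \<beta> b k \<otimes> f k"
        using rep_leadD(1)[OF z f 1] fcl[OF f(1)] by simp
    qed (use car z in auto)
  next
    show "\<one>\<^bsub>A\<^esub> \<in> rep_lead A \<rho> 0 \<one>"
      by (rule rep_leadI) (auto simp: simps)
  next
    show "\<zero>\<^bsub>A\<^esub> \<in> rep_lead A \<rho> a \<zero>" for a
      by (rule rep_leadI) (auto simp: assoc_algebra_hom_zero[OF \<rho> A.A.ring_axioms E.A.ring_axioms]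
          End_fun_simps fcl)
  next
    fix a c assume z: "\<zero>\<^bsub>A\<^esub> \<in> rep_lead A \<rho> a c"
    \<comment> \<open>The delta function at degree 0: an operator with symbol \<open>c\<close> in
      degree \<open>a\<close> sends it to a function with value \<open>c\<close> at
      \<open>a\<close>.\<close>
    define f :: "'g \<Rightarrow> 'k" where "f = (\<lambda>x. if x = 0 then \<one> else \<zero>)"
    have f: "f \<in> carrier (fun_module K)" by (simp add: f_def fun_module_def)
    have "\<rho> \<zero>\<^bsub>A\<^esub> = \<zero>\<^bsub>End_algebra K (fun_module K)\<^esub>"
      by (rule assoc_algebra_hom_zero[OF \<rho> A.A.ring_axioms E.A.ring_axioms])
    moreover have "\<rho> \<zero>\<^bsub>A\<^esub> f (a + 0) = c \<otimes> \<beta> a 0 \<otimes> f 0"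
      by (rule rep_leadD(2)[OF z f]) (simp add: f_def)
    ultimately show "c = \<zero>"
      using car[OF z] f by (simp add: End_fun_simps f_def)
  qed (use car in auto)
qed

end

section \<open>The bicharacter of a multiplicatively antisymmetric matrix\<close>

text \<open>
  Degrees are exponent vectors of the generators \<open>y\<^sub>k\<close> (at position \<open>2k\<close>) and \<open>x\<^sub>k\<close> (at position
  \<open>2k + 1\<close>), ordered lexicographically. Up to scalars \<open>x\<^sub>k\<close> commutes like \<open>y\<^sub>k\<^sup>-\<^sup>1\<close>, hence the difference.
\<close>

definition expo :: "(nat \<Rightarrow>\<^sub>0 int) \<Rightarrow> nat \<Rightarrow> int" where
  "expo a k = Poly_Mapping.lookup a (2 * k) - Poly_Mapping.lookup a (2 * k + 1)"

definition ydeg :: "nat \<Rightarrow> nat \<Rightarrow>\<^sub>0 int" where "ydeg k = Poly_Mapping.single (2 * k) 1"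
definition xdeg :: "nat \<Rightarrow> nat \<Rightarrow>\<^sub>0 int" where "xdeg k = Poly_Mapping.single (2 * k + 1) 1"

lemma expo_add: "expo (a + b) = (\<lambda>k. expo a k + expo b k)"
  by (simp add: expo_def fun_eq_iff Poly_Mapping.lookup_add)

lemma expo_minus: "expo (a - b) = (\<lambda>k. expo a k - expo b k)"
  by (simp add: expo_def fun_eq_iff Poly_Mapping.lookup_minus)

lemma expo_ydeg: "expo (ydeg i) = (\<lambda>k. if k = i then 1 else 0)"
proof
  fix k
  have "2 * i \<noteq> 2 * k + 1" by presburger
  then show "expo (ydeg i) k = (if k = i then 1 else 0)"
    by (simp add: expo_def ydeg_def Poly_Mapping.lookup_single when_def)
qed

lemma expo_xdeg: "expo (xdeg i) = (\<lambda>k. if k = i then - 1 else 0)"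
proof
  fix k
  have "2 * i + 1 \<noteq> 2 * k" by presburger
  then show "expo (xdeg i) k = (if k = i then - 1 else 0)"
    by (simp add: expo_def xdeg_def Poly_Mapping.lookup_single when_def)
qed

text \<open>For \<open>expo\<close>, dividing by y_i is the same as multiplying by x_i. Hence the
  shifted arguments in the operators below turn into factors \<open>dbeta\<close> without
  inverses.\<close>

lemma expo_minus_ydeg: "expo (a - ydeg i) = expo (a + xdeg i)"
  and expo_minus_xdeg: "expo (a - xdeg i) = expo (a + ydeg i)"
  by (auto simp: expo_minus expo_add expo_ydeg expo_xdeg)

lemma expo_cancel: "expo (xdeg i + ydeg i) = expo 0"
  by (auto simp: expo_add expo_ydeg expo_xdeg expo_def)

locale antisymmetric_matrix = K: field K for K :: "('k, 'e) ring_scheme" (structure) +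
  fixes n :: nat and \<Lambda> :: "nat \<Rightarrow> nat \<Rightarrow> 'k"
  assumes antisym: "mult_antisymmetric K n \<Lambda>"
begin

sublocale G: comm_group "units_of K"
  by (rule K.units_comm_group)

lemma Lambda_Units [simp]: "\<lbrakk>i \<in> {1..n}; j \<in> {1..n}\<rbrakk> \<Longrightarrow> \<Lambda> i j \<in> Units K"
  and Lambda_closed [simp]: "\<lbrakk>i \<in> {1..n}; j \<in> {1..n}\<rbrakk> \<Longrightarrow> \<Lambda> i j \<in> carrier K"
  and Lambda_mult: "\<lbrakk>i \<in> {1..n}; j \<in> {1..n}\<rbrakk> \<Longrightarrow> \<Lambda> i j \<otimes> \<Lambda> j i = \<one>"
  and Lambda_diag: "i \<in> {1..n} \<Longrightarrow> \<Lambda> i i = \<one>"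
  using antisym by (auto simp: mult_antisymmetric_def K.field_Units)

text \<open>
  Any \<open>b\<close> with \<open>b i j = \<Lambda> i j \<cdot> b j i\<close> and \<open>b i i = 1\<close> would do: the resulting bicharacter then
  satisfies \<open>\<beta>(a, b) / \<beta>(b, a) = \<Prod> \<Lambda> i j ^ (a i * b j)\<close>.
\<close>

definition half :: "nat \<Rightarrow> nat \<Rightarrow> 'k" where
  "half i j = (if i < j then \<Lambda> i j else \<one>)"

text \<open>Formed in the unit group, where negative integer exponents make sense.\<close>

definition qbeta :: "(nat \<Rightarrow> int) \<Rightarrow> (nat \<Rightarrow> int) \<Rightarrow> 'k" where
  "qbeta a b = (\<Otimes>\<^bsub>units_of K\<^esub>k\<in>{1..n}. \<Otimes>\<^bsub>units_of K\<^esub>l\<in>{1..n}. half k l [^]\<^bsub>units_of K\<^esub> (a k * b l))"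

lemma half_closed [simp]: "\<lbrakk>i \<in> {1..n}; j \<in> {1..n}\<rbrakk> \<Longrightarrow> half i j \<in> carrier (units_of K)"
  by (simp add: half_def units_of_def)

lemma half_swap:
  assumes "i \<in> {1..n}" "j \<in> {1..n}"
  shows "half i j = \<Lambda> i j \<otimes> half j i"
  using assms Lambda_mult[OF assms] Lambda_diag by (auto simp: half_def not_less le_less)

lemma qbeta_carrier: "qbeta a b \<in> carrier (units_of K)"
  unfolding qbeta_def by (intro G.finprod_closed funcsetI G.int_pow_closed half_closed)

lemma qbeta_add_left: "qbeta (\<lambda>k. a k + a' k) b = qbeta a b \<otimes>\<^bsub>units_of K\<^esub> qbeta a' b"
proof -
  have "qbeta (\<lambda>k. a k + a' k) b = (\<Otimes>\<^bsub>units_of K\<^esub>k\<in>{1..n}.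
      (\<Otimes>\<^bsub>units_of K\<^esub>l\<in>{1..n}. half k l [^]\<^bsub>units_of K\<^esub> (a k * b l)) \<otimes>\<^bsub>units_of K\<^esub>
      (\<Otimes>\<^bsub>units_of K\<^esub>l\<in>{1..n}. half k l [^]\<^bsub>units_of K\<^esub> (a' k * b l)))"
    unfolding qbeta_def
  proof (rule G.finprod_cong')
    fix k assume k: "k \<in> {1..n}"
    have "(\<Otimes>\<^bsub>units_of K\<^esub>l\<in>{1..n}. half k l [^]\<^bsub>units_of K\<^esub> ((a k + a' k) * b l)) =
      (\<Otimes>\<^bsub>units_of K\<^esub>l\<in>{1..n}. half k l [^]\<^bsub>units_of K\<^esub> (a k * b l) \<otimes>\<^bsub>units_of K\<^esub>
        half k l [^]\<^bsub>units_of K\<^esub> (a' k * b l))"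
      by (rule G.finprod_cong') (use k in \<open>auto simp: distrib_right G.int_pow_mult\<close>)
    then show "(\<Otimes>\<^bsub>units_of K\<^esub>l\<in>{1..n}. half k l [^]\<^bsub>units_of K\<^esub> ((a k + a' k) * b l)) =
      (\<Otimes>\<^bsub>units_of K\<^esub>l\<in>{1..n}. half k l [^]\<^bsub>units_of K\<^esub> (a k * b l)) \<otimes>\<^bsub>units_of K\<^esub>
      (\<Otimes>\<^bsub>units_of K\<^esub>l\<in>{1..n}. half k l [^]\<^bsub>units_of K\<^esub> (a' k * b l))"
      using k by (subst G.finprod_multf[symmetric]) auto
  qed (auto intro!: G.m_closed G.finprod_closed)
  also have "\<dots> = qbeta a b \<otimes>\<^bsub>units_of K\<^esub> qbeta a' b"
    unfolding qbeta_def by (rule G.finprod_multf) (auto intro!: G.finprod_closed)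
  finally show ?thesis .
qed

lemma qbeta_add_right: "qbeta a (\<lambda>k. b k + b' k) = qbeta a b \<otimes>\<^bsub>units_of K\<^esub> qbeta a b'"
proof -
  have "qbeta a (\<lambda>k. b k + b' k) = (\<Otimes>\<^bsub>units_of K\<^esub>k\<in>{1..n}.
      (\<Otimes>\<^bsub>units_of K\<^esub>l\<in>{1..n}. half k l [^]\<^bsub>units_of K\<^esub> (a k * b l)) \<otimes>\<^bsub>units_of K\<^esub>
      (\<Otimes>\<^bsub>units_of K\<^esub>l\<in>{1..n}. half k l [^]\<^bsub>units_of K\<^esub> (a k * b' l)))"
    unfolding qbeta_def
  proof (rule G.finprod_cong')
    fix k assume k: "k \<in> {1..n}"
    have "(\<Otimes>\<^bsub>units_of K\<^esub>l\<in>{1..n}. half k l [^]\<^bsub>units_of K\<^esub> (a k * (b l + b' l))) =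
      (\<Otimes>\<^bsub>units_of K\<^esub>l\<in>{1..n}. half k l [^]\<^bsub>units_of K\<^esub> (a k * b l) \<otimes>\<^bsub>units_of K\<^esub>
        half k l [^]\<^bsub>units_of K\<^esub> (a k * b' l))"
      by (rule G.finprod_cong') (use k in \<open>auto simp: distrib_left G.int_pow_mult\<close>)
    then show "(\<Otimes>\<^bsub>units_of K\<^esub>l\<in>{1..n}. half k l [^]\<^bsub>units_of K\<^esub> (a k * (b l + b' l))) =
      (\<Otimes>\<^bsub>units_of K\<^esub>l\<in>{1..n}. half k l [^]\<^bsub>units_of K\<^esub> (a k * b l)) \<otimes>\<^bsub>units_of K\<^esub>
      (\<Otimes>\<^bsub>units_of K\<^esub>l\<in>{1..n}. half k l [^]\<^bsub>units_of K\<^esub> (a k * b' l))"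
      using k by (subst G.finprod_multf[symmetric]) auto
  qed (auto intro!: G.m_closed G.finprod_closed)
  also have "\<dots> = qbeta a b \<otimes>\<^bsub>units_of K\<^esub> qbeta a b'"
    unfolding qbeta_def by (rule G.finprod_multf) (auto intro!: G.finprod_closed)
  finally show ?thesis .
qed

lemma qbeta_cong:
  assumes "\<And>k. k \<in> {1..n} \<Longrightarrow> a k = a' k" "\<And>k. k \<in> {1..n} \<Longrightarrow> b k = b' k"
  shows "qbeta a b = qbeta a' b'"
  unfolding qbeta_def using assms by (intro G.finprod_cong') (auto intro!: G.finprod_cong' G.finprod_closed)

text \<open>On unit vectors a single factor of the double product has a nonzero exponent.\<close>

lemma qbeta_unit:
  assumes "i \<in> {1..n}" "j \<in> {1..n}"
  shows "qbeta (\<lambda>k. if k = i then 1 else 0) (\<lambda>k. if k = j then 1 else 0) = half i j"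
proof -
  have inner: "(\<Otimes>\<^bsub>units_of K\<^esub>l\<in>{1..n}. half k l [^]\<^bsub>units_of K\<^esub>
      ((if k = i then 1 else 0) * (if l = j then 1 else 0) :: int)) =
      (if i = k then half k j else \<one>\<^bsub>units_of K\<^esub>)" if k: "k \<in> {1..n}" for k
  proof (cases "k = i")
    case True
    have "(\<Otimes>\<^bsub>units_of K\<^esub>l\<in>{1..n}. half k l [^]\<^bsub>units_of K\<^esub>
      ((if k = i then 1 else 0) * (if l = j then 1 else 0) :: int)) =
      (\<Otimes>\<^bsub>units_of K\<^esub>l\<in>{1..n}. if j = l then half k l else \<one>\<^bsub>units_of K\<^esub>)"
      by (rule G.finprod_cong') (use k True in auto)
    also have "\<dots> = half k j"
      by (rule G.finprod_singleton) (use k assms in auto)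
    finally show ?thesis using True by simp
  next
    case False
    then show ?thesis by simp
  qed
  have "qbeta (\<lambda>k. if k = i then 1 else 0) (\<lambda>k. if k = j then 1 else 0) =
     (\<Otimes>\<^bsub>units_of K\<^esub>k\<in>{1..n}. if i = k then half k j else \<one>\<^bsub>units_of K\<^esub>)"
    unfolding qbeta_def by (rule G.finprod_cong') (use inner assms in auto)
  also have "\<dots> = half i j"
    by (rule G.finprod_singleton) (use assms in auto)
  finally show ?thesis .
qed

definition dbeta :: "(nat \<Rightarrow>\<^sub>0 int) \<Rightarrow> (nat \<Rightarrow>\<^sub>0 int) \<Rightarrow> 'k" where
  "dbeta a b = qbeta (expo a) (expo b)"

sublocale D: bicharacter K dbeta
proof (unfold_locales)
  show "dbeta a b \<in> Units K" for a b
    using qbeta_carrier by (simp add: dbeta_def units_of_def)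
qed (simp_all add: dbeta_def expo_add qbeta_add_left qbeta_add_right, simp_all add: units_of_def)

lemma dbeta_minus_ydeg: "dbeta a (b - ydeg i) = dbeta a b \<otimes> dbeta a (xdeg i)"
  and dbeta_minus_xdeg: "dbeta a (b - xdeg i) = dbeta a b \<otimes> dbeta a (ydeg i)"
  using D.beta_add_right[of a b "xdeg i"] D.beta_add_right[of a b "ydeg i"]
  by (simp_all only: dbeta_def expo_minus_ydeg expo_minus_xdeg)

lemma dbeta_swap_yy:
  assumes "i \<in> {1..n}" "j \<in> {1..n}"
  shows "dbeta (ydeg i) (ydeg j) = \<Lambda> i j \<otimes> dbeta (ydeg j) (ydeg i)"
  using half_swap[OF assms] by (simp only: dbeta_def expo_ydeg qbeta_unit assms)

lemma dbeta_diag_yy: "i \<in> {1..n} \<Longrightarrow> dbeta (ydeg i) (ydeg i) = \<one>"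
  by (simp add: dbeta_def expo_ydeg qbeta_unit half_def)

lemma dbeta_cancel_left: "dbeta (xdeg i) a \<otimes> dbeta (ydeg i) a = \<one>"
  using D.beta_add_left[of "xdeg i" "ydeg i" a] D.beta_zero_left[of a]
  by (simp add: dbeta_def expo_cancel)

lemma dbeta_cancel_right: "dbeta a (xdeg i) \<otimes> dbeta a (ydeg i) = \<one>"
  using D.beta_add_right[of a "xdeg i" "ydeg i"] D.beta_zero_right[of a]
  by (simp add: dbeta_def expo_cancel)

lemma dbeta_xdeg_left: "dbeta (xdeg i) a = inv dbeta (ydeg i) a"
  using K.comm_inv_char[of "dbeta (ydeg i) a" "dbeta (xdeg i) a"] dbeta_cancel_left[of i a]
  by (simp add: K.m_comm)

lemma dbeta_xdeg_right: "dbeta a (xdeg i) = inv dbeta a (ydeg i)"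
  using K.comm_inv_char[of "dbeta a (ydeg i)" "dbeta a (xdeg i)"] dbeta_cancel_right[of a i]
  by (simp add: K.m_comm)

lemma dbeta_diag:
  assumes "i \<in> {1..n}"
  shows "dbeta (xdeg i) (ydeg i) = \<one>" "dbeta (ydeg i) (xdeg i) = \<one>"
    "dbeta (xdeg i) (xdeg i) = \<one>"
  using assms by (simp_all add: dbeta_xdeg_left dbeta_xdeg_right dbeta_diag_yy)

lemma dbeta_swap_xy:
  assumes "i \<in> {1..n}" "j \<in> {1..n}"
  shows "dbeta (ydeg j) (ydeg i) = inv (\<Lambda> i j) \<otimes> dbeta (ydeg i) (ydeg j)"
  unfolding dbeta_swap_yy[OF assms] using assms
  by (simp add: K.m_assoc[symmetric] K.Units_l_inv K.Units_inv_closed)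

text \<open>Since \<open>dbeta (xdeg i)\<close> is inverse to \<open>dbeta (ydeg i)\<close>, this is
  \<open>dbeta_swap_yy\<close> inverted. It is the form in which the scalar appears when two
  operators y or two operators x are exchanged.\<close>

lemma dbeta_swap_xx:
  assumes "i \<in> {1..n}" "j \<in> {1..n}"
  shows "dbeta (xdeg j) (ydeg i) = \<Lambda> i j \<otimes> dbeta (xdeg i) (ydeg j)"
proof -
  \<comment> \<open>The inserted factor is one; the swap of y-degrees is applied inside it, which
    avoids computing with inverses.\<close>
  have "dbeta (xdeg j) (ydeg i) =
      dbeta (xdeg j) (ydeg i) \<otimes> (dbeta (xdeg i) (ydeg j) \<otimes> dbeta (ydeg i) (ydeg j))"
    by (simp add: dbeta_cancel_left)
  also have "\<dots> = \<Lambda> i j \<otimes> dbeta (xdeg i) (ydeg j) \<otimes>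
      (dbeta (xdeg j) (ydeg i) \<otimes> dbeta (ydeg j) (ydeg i))"
    unfolding dbeta_swap_yy[OF assms] using assms by (simp add: K.m_ac)
  finally show ?thesis
    using assms by (simp add: dbeta_cancel_left)
qed

end

section \<open>Leading terms in the quantum Weyl-type algebra\<close>

definition S_gens :: "nat \<Rightarrow> nat \<Rightarrow> S_gen set" where
  "S_gens n r = SY ` {1..n} \<union> SX ` {1..r}"

definition S_relations ::
    "('k, 'e) ring_scheme \<Rightarrow> nat \<Rightarrow> nat \<Rightarrow> (nat \<Rightarrow> nat \<Rightarrow> 'k) \<Rightarrow>
      ((S_gen list \<Rightarrow> 'k) \<times> (S_gen list \<Rightarrow> 'k)) set" where
  "S_relations K n r \<Lambda> =
     (let A = free_algebra K (S_gens n r);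
          y = (\<lambda>i. free_gen K (SY i));
          x = (\<lambda>i. free_gen K (SX i))
      in {(y i \<otimes>\<^bsub>A\<^esub> y j, \<Lambda> i j \<odot>\<^bsub>A\<^esub> (y j \<otimes>\<^bsub>A\<^esub> y i)) |i j. i \<in> {1..n} \<and> j \<in> {1..n}} \<union>
         {(x i \<otimes>\<^bsub>A\<^esub> y i, (y i \<otimes>\<^bsub>A\<^esub> x i) \<oplus>\<^bsub>A\<^esub> \<one>\<^bsub>A\<^esub>) |i. i \<in> {1..r}} \<union>
         {(x i \<otimes>\<^bsub>A\<^esub> y j, (inv\<^bsub>K\<^esub> (\<Lambda> i j)) \<odot>\<^bsub>A\<^esub> (y j \<otimes>\<^bsub>A\<^esub> x i)) |i j.
             i \<in> {1..r} \<and> j \<in> {1..n} \<and> i \<noteq> j} \<union>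
         {(x i \<otimes>\<^bsub>A\<^esub> x j, \<Lambda> i j \<odot>\<^bsub>A\<^esub> (x j \<otimes>\<^bsub>A\<^esub> x i)) |i j. i \<in> {1..r} \<and> j \<in> {1..r}})"

lemma S_algebra_eq:
  "S_algebra K n r \<Lambda> = presented_algebra K (S_gens n r) (S_relations K n r \<Lambda>)"
  by (simp add: S_algebra_def S_gens_def S_relations_def Let_def)

fun S_deg :: "S_gen \<Rightarrow> nat \<Rightarrow>\<^sub>0 int" where
  "S_deg (SY i) = ydeg i"
| "S_deg (SX i) = xdeg i"

lemma S_deg_count:
  "Poly_Mapping.lookup (sum_list (map S_deg w)) (2 * i) = int (count (mset w) (SY i))"
  "Poly_Mapping.lookup (sum_list (map S_deg w)) (2 * i + 1) = int (count (mset w) (SX i))"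
proof (induction w)
  case (Cons x w)
  have *: "(2 * j = Suc (2 * k)) = False" "(Suc (2 * k) = 2 * j) = False" for j k :: nat
    by presburger+
  { case 1 show ?case using Cons by (cases x)
      (auto simp: Poly_Mapping.lookup_add Poly_Mapping.lookup_single when_def ydeg_def xdeg_def *) }
  { case 2 show ?case using Cons by (cases x)
      (auto simp: Poly_Mapping.lookup_add Poly_Mapping.lookup_single when_def ydeg_def xdeg_def *) }
qed simp_all

text \<open>Even and odd positions record the multiplicities of all letters y and x, so a degree
  determines its word up to order.\<close>

lemma S_deg_mset:
  assumes "sum_list (map S_deg v) = sum_list (map S_deg w)"
  shows "mset v = mset w"
proof (rule multiset_eqI)
  fix x
  show "count (mset v) x = count (mset w) x"
    using S_deg_count[of v] S_deg_count[of w] assms by (cases x) (metis of_nat_eq_iff)+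
qed

text \<open>Any fixed arrangement serves as the normal one, since rearranging a word changes it only
  by a scalar and shorter words.\<close>

definition mset_word :: "'x multiset \<Rightarrow> 'x list" where
  "mset_word m = (SOME w. mset w = m)"

lemma mset_mset_word [simp]: "mset (mset_word m) = m"
  unfolding mset_word_def by (rule someI_ex) (rule ex_mset)

section \<open>The operators of the left regular representation and their relations\<close>

context antisymmetric_matrix
begin

text \<open>The factor produced when x_i meets a power of y_i. Degrees form a group, so the exponent
  may be negative.\<close>

definition num :: "int \<Rightarrow> 'k" where "num k = [k] \<cdot> \<one>"

lemma num_closed [simp]: "num k \<in> carrier K"
  by (simp add: num_def)

lemma num_Suc: "num (k + 1) = num k \<oplus> \<one>"
  using K.add.int_pow_mult[of "\<one>" k 1] K.add.int_pow_1[of "\<one>"] by (simp add: num_def)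

abbreviation V :: "('k, (nat \<Rightarrow>\<^sub>0 int) \<Rightarrow> 'k) module" where "V \<equiv> fun_module K"

text \<open>
  The left regular representation in the basis of ordered monomials, transposed so that it acts
  on all coefficient functions and no finiteness is needed: \<open>x\<^sub>i\<close> maps the monomial of degree \<open>a\<close> to
  a multiple of \<open>x\<^sub>i\<close> times it plus \<open>a\<^sub>i\<close> times the monomial with one \<open>y\<^sub>i\<close> removed.
\<close>

definition y_op :: "nat \<Rightarrow> ((nat \<Rightarrow>\<^sub>0 int) \<Rightarrow> 'k) \<Rightarrow> (nat \<Rightarrow>\<^sub>0 int) \<Rightarrow> 'k" where
  "y_op i = (\<lambda>f\<in>carrier V. \<lambda>a. dbeta (ydeg i) a \<otimes> f (a - ydeg i))"

definition x_op :: "nat \<Rightarrow> ((nat \<Rightarrow>\<^sub>0 int) \<Rightarrow> 'k) \<Rightarrow> (nat \<Rightarrow>\<^sub>0 int) \<Rightarrow> 'k" where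
  "x_op i = (\<lambda>f\<in>carrier V. \<lambda>a. dbeta (xdeg i) a \<otimes>
     (f (a - xdeg i) \<oplus> num (Poly_Mapping.lookup a (2 * i) + 1) \<otimes> f (a + ydeg i)))"

fun S_op :: "S_gen \<Rightarrow> ((nat \<Rightarrow>\<^sub>0 int) \<Rightarrow> 'k) \<Rightarrow> (nat \<Rightarrow>\<^sub>0 int) \<Rightarrow> 'k" where
  "S_op (SY i) = y_op i"
| "S_op (SX i) = x_op i"

lemma V_closed: "f \<in> carrier V \<longleftrightarrow> (\<forall>a. f a \<in> carrier K)"
  by (simp add: fun_module_def)

lemma op_closed:
  "f \<in> carrier V \<Longrightarrow> y_op i f \<in> carrier V" "f \<in> carrier V \<Longrightarrow> x_op i f \<in> carrier V"
  by (auto simp: y_op_def x_op_def V_closed)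

lemma S_op_closed: "S_op x \<in> carrier (End_algebra K V)"
proof (cases x)
  case (SY i)
  then show ?thesis
    by (auto simp: End_algebra_def y_op_def fun_module_def fun_eq_iff K.r_distr K.m_lcomm)
next
  case (SX i)
  then show ?thesis
    by (auto simp: End_algebra_def x_op_def fun_module_def fun_eq_iff K.r_distr K.m_lcomm K.a_ac)
qed

lemma y_op_apply: "f \<in> carrier V \<Longrightarrow> y_op i f a = dbeta (ydeg i) a \<otimes> f (a - ydeg i)"
  by (simp add: y_op_def)

lemma x_op_apply: "f \<in> carrier V \<Longrightarrow> x_op i f a = dbeta (xdeg i) a \<otimes>
     (f (a - xdeg i) \<oplus> num (Poly_Mapping.lookup a (2 * i) + 1) \<otimes> f (a + ydeg i))"
  by (simp add: x_op_def)

lemma lookup_deg: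
  "Poly_Mapping.lookup (ydeg i) (2 * j) = (if i = j then 1 else 0)"
  "Poly_Mapping.lookup (xdeg i) (2 * j) = 0"
proof -
  have "2 * i + 1 \<noteq> 2 * j" by presburger
  then show "Poly_Mapping.lookup (ydeg i) (2 * j) = (if i = j then 1 else 0)"
    "Poly_Mapping.lookup (xdeg i) (2 * j) = 0"
    by (auto simp: ydeg_def xdeg_def Poly_Mapping.lookup_single when_def)
qed

lemma yy_op:
  assumes "i \<in> {1..n}" "j \<in> {1..n}" "f \<in> carrier V"
  shows "y_op i (y_op j f) a = \<Lambda> i j \<otimes> y_op j (y_op i f) a"
proof -
  have f: "f b \<in> carrier K" for b using assms by (simp add: V_closed)
  have d: "a - ydeg i - ydeg j = a - ydeg j - ydeg i" by (simp add: algebra_simps)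
  \<comment> \<open>An inverse may be moved from one argument of a bicharacter to the other, which
    reduces the claim to \<open>dbeta_swap_xx\<close>.\<close>
  have s: "dbeta (ydeg j) (xdeg i) = \<Lambda> i j \<otimes> dbeta (ydeg i) (xdeg j)"
  proof -
    have "dbeta (ydeg j) (xdeg i) = dbeta (xdeg j) (ydeg i)"
      "dbeta (ydeg i) (xdeg j) = dbeta (xdeg i) (ydeg j)"
      by (simp_all add: dbeta_xdeg_left dbeta_xdeg_right)
    then show ?thesis using dbeta_swap_xx[OF assms(1,2)] by (simp only:)
  qed
  show ?thesis
    using assms f by (simp add: y_op_apply op_closed dbeta_minus_ydeg d s K.m_ac)
qed

text \<open>In one order x_i reads the exponent of y_i at \<open>a\<close>, in the other at
  \<open>a - ydeg i\<close>; the two integer factors differ by one, which is the constant in the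
  relation. The bicharacter factors cancel because x_i has the weight of the inverse of y_i.\<close>

lemma xy_op_same:
  assumes "i \<in> {1..n}" "f \<in> carrier V"
  shows "x_op i (y_op i f) a = y_op i (x_op i f) a \<oplus> f a"
proof -
  have f: "f b \<in> carrier K" for b using assms by (simp add: V_closed)
  let ?k = "Poly_Mapping.lookup a (2 * i)"
  let ?s = "dbeta (xdeg i) a" and ?t = "dbeta (ydeg i) a"
  have d: "a - ydeg i - xdeg i = a - xdeg i - ydeg i" by (simp add: algebra_simps)
  have c: "?s \<otimes> (?t \<otimes> z) = z" if "z \<in> carrier K" for z
    using that dbeta_cancel_left[of i a] by (simp add: K.m_assoc[symmetric])
  have c': "?t \<otimes> (?s \<otimes> z) = z" if "z \<in> carrier K" for z
    using c that by (simp add: K.m_lcomm)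
  have l: "Poly_Mapping.lookup (a - ydeg i) (2 * i) + 1 = ?k"
    by (simp add: Poly_Mapping.lookup_minus lookup_deg)
  have "x_op i (y_op i f) a = ?s \<otimes> (?t \<otimes> f (a - xdeg i - ydeg i) \<oplus>
      num (?k + 1) \<otimes> (?t \<otimes> f a))"
    using assms f by (simp add: x_op_apply y_op_apply op_closed dbeta_minus_xdeg
        D.beta_add_right dbeta_diag_yy)
  also have "\<dots> = f (a - xdeg i - ydeg i) \<oplus> num (?k + 1) \<otimes> f a"
  proof -
    have "?s \<otimes> (num (?k + 1) \<otimes> (?t \<otimes> f a)) = num (?k + 1) \<otimes> f a"
      using f c[of "f a"] by (subst K.m_lcomm) auto
    then show ?thesis using f c by (simp add: K.r_distr)
  qed
  also have "\<dots> = (f (a - xdeg i - ydeg i) \<oplus> num ?k \<otimes> f a) \<oplus> f a"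
    using f by (simp add: num_Suc K.l_distr K.a_assoc)
  also have "f (a - xdeg i - ydeg i) \<oplus> num ?k \<otimes> f a = y_op i (x_op i f) a"
    using assms f c' by (simp add: x_op_apply y_op_apply op_closed dbeta_minus_ydeg
        dbeta_diag l d)
  finally show ?thesis .
qed

text \<open>The exponent read by x_i is not changed by y_j, and \<open>a - xdeg i\<close> and
  \<open>a + ydeg i\<close> have the same \<open>expo\<close>; both parts of x_i therefore pick up
  the same scalar.\<close>

lemma xy_op:
  assumes "i \<in> {1..n}" "j \<in> {1..n}" "i \<noteq> j" "f \<in> carrier V"
  shows "x_op i (y_op j f) a = inv (\<Lambda> i j) \<otimes> y_op j (x_op i f) a"
proof -
  have f: "f b \<in> carrier K" for b using assms by (simp add: V_closed)
  let ?k = "num (Poly_Mapping.lookup a (2 * i) + 1)"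
  let ?s = "dbeta (xdeg i) a" and ?t = "dbeta (ydeg j) a" and ?c = "dbeta (ydeg i) (ydeg j)"
  let ?z = "f (a - xdeg i - ydeg j) \<oplus> ?k \<otimes> f (a + ydeg i - ydeg j)"
  have d: "a - ydeg j - xdeg i = a - xdeg i - ydeg j" "a - ydeg j + ydeg i = a + ydeg i - ydeg j"
    by (simp_all add: algebra_simps)
  have z: "?z \<in> carrier K" using f by simp
  have L: "inv (\<Lambda> i j) \<in> carrier K" using assms by simp
  have s: "dbeta (xdeg i) (xdeg j) = ?c"
    using D.beta_Units by (simp add: dbeta_xdeg_left dbeta_xdeg_right K.Units_inv_inv)
  have l: "Poly_Mapping.lookup (a - ydeg j) (2 * i) = Poly_Mapping.lookup a (2 * i)"
    using assms(3) by (simp add: Poly_Mapping.lookup_minus lookup_deg)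
  have "x_op i (y_op j f) a = ?s \<otimes>
      (?t \<otimes> dbeta (ydeg j) (ydeg i) \<otimes> f (a - xdeg i - ydeg j) \<oplus>
       ?k \<otimes> (?t \<otimes> dbeta (ydeg j) (ydeg i) \<otimes> f (a + ydeg i - ydeg j)))"
    using assms f by (simp add: x_op_apply y_op_apply op_closed dbeta_minus_xdeg D.beta_add_right)
  also have "\<dots> = dbeta (ydeg j) (ydeg i) \<otimes> (?s \<otimes> ?t \<otimes> ?z)"
    using f by (simp add: K.r_distr K.m_ac)
  also have "\<dots> = inv (\<Lambda> i j) \<otimes> (?t \<otimes> (?s \<otimes> ?c \<otimes> ?z))"
    unfolding dbeta_swap_xy[OF assms(1,2)] using z L by (simp add: K.m_ac del: K.r_distr)
  also have "?t \<otimes> (?s \<otimes> ?c \<otimes> ?z) = y_op j (x_op i f) a"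
    using assms f by (simp add: x_op_apply y_op_apply op_closed dbeta_minus_ydeg s l d)
  finally show ?thesis .
qed

lemma xx_op:
  assumes "i \<in> {1..n}" "j \<in> {1..n}" "f \<in> carrier V"
  shows "x_op i (x_op j f) a = \<Lambda> i j \<otimes> x_op j (x_op i f) a"
proof (cases "i = j")
  \<comment> \<open>With equal indices each x_i changes the exponent that the other one reads, so
    the general computation does not apply; but the claim is trivial, as the diagonal of
    \<open>\<Lambda>\<close> is one.\<close>
  case True
  have "x_op i (x_op i f) \<in> carrier V" using op_closed assms by simp
  then show ?thesis using True assms Lambda_diag V_closed by simp
next
  case False
  have f: "f b \<in> carrier K" for b using assms by (simp add: V_closed)
  let ?k = "\<lambda>i. num (Poly_Mapping.lookup a (2 * i) + 1)"
  \<comment> \<open>One term for each of the four ways in which the two operators either raise x or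
    lower y. The bracket is symmetric in the indices, so only the factor
    \<open>dbeta (xdeg j) (ydeg i)\<close> in front of it records the order.\<close>
  let ?z = "\<lambda>i j. f (a - xdeg i - xdeg j) \<oplus> ?k j \<otimes> f (a - xdeg i + ydeg j) \<oplus>
      (?k i \<otimes> f (a - xdeg j + ydeg i) \<oplus> ?k i \<otimes> (?k j \<otimes> f (a + ydeg i + ydeg j)))"
  have d: "a + ydeg i - xdeg j = a - xdeg j + ydeg i" for i j
    by (simp_all add: algebra_simps)
  have d': "a - xdeg j - xdeg i = a - xdeg i - xdeg j" "a + ydeg j + ydeg i = a + ydeg i + ydeg j"
    by (simp_all add: algebra_simps)
  have z: "?z i j \<in> carrier K" for i j using f by simp
  have eq: "x_op i (x_op j f) a = dbeta (xdeg j) (ydeg i) \<otimes>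
      (dbeta (xdeg i) a \<otimes> (dbeta (xdeg j) a \<otimes> ?z i j))" if "i \<noteq> j" for i j
  proof -
    have l: "Poly_Mapping.lookup (a - xdeg i) (2 * j) = Poly_Mapping.lookup a (2 * j)"
      "Poly_Mapping.lookup (a + ydeg i) (2 * j) = Poly_Mapping.lookup a (2 * j)"
      using that by (simp_all add: Poly_Mapping.lookup_minus Poly_Mapping.lookup_add lookup_deg)
    have "x_op i (x_op j f) a = dbeta (xdeg i) a \<otimes>
      (dbeta (xdeg j) a \<otimes> dbeta (xdeg j) (ydeg i) \<otimes>
         (f (a - xdeg i - xdeg j) \<oplus> ?k j \<otimes> f (a - xdeg i + ydeg j)) \<oplus>
       ?k i \<otimes> (dbeta (xdeg j) a \<otimes> dbeta (xdeg j) (ydeg i) \<otimes>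
         (f (a - xdeg j + ydeg i) \<oplus> ?k j \<otimes> f (a + ydeg i + ydeg j))))"
      using assms(3) f
      by (simp add: x_op_apply op_closed dbeta_minus_xdeg D.beta_add_right l d)
    also have "\<dots> = dbeta (xdeg j) (ydeg i) \<otimes>
      (dbeta (xdeg i) a \<otimes> (dbeta (xdeg j) a \<otimes> ?z i j))"
      using f by (simp add: K.r_distr K.m_ac)
    finally show ?thesis .
  qed
  have zz: "?z i j = ?z j i"
    using f by (simp add: d' K.a_ac K.m_ac)
  show ?thesis
    unfolding eq[OF False] eq[OF False[symmetric]] zz dbeta_swap_xx[OF assms(1,2)]
    using z assms by (simp add: K.m_ac)
qed

lemma End_eqI:
  assumes "S \<in> carrier (End_algebra K V)" "T \<in> carrier (End_algebra K V)"
    and "\<And>f. f \<in> carrier V \<Longrightarrow> S f = T f"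
  shows "S = T"
  using assms by (auto simp: End_algebra_def intro: extensionalityI)

end

section \<open>The presented algebra \<open>S\<close>: spanning words, representation, leading
  terms\<close>

locale S_alg = antisymmetric_matrix K n \<Lambda>
  for K :: "('k, 'e) ring_scheme" (structure) and n :: nat and \<Lambda> :: "nat \<Rightarrow> nat \<Rightarrow> 'k" +
  fixes r :: nat
  assumes r_le: "r \<le> n"

sublocale S_alg \<subseteq> presentation K "S_gens n r" "S_relations K n r \<Lambda>"
proof (unfold_locales)
  interpret A: assoc_alg K "free_algebra K (S_gens n r)" by (rule K.free_algebra_assoc_alg)
  have y: "free_gen K (SY i) \<in> carrier (free_algebra K (S_gens n r))" if "i \<in> {1..n}" for i
    using that unfolding K.free_gen_eq by (intro K.free_word_closed) (auto simp: S_gens_def)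
  have x: "free_gen K (SX i) \<in> carrier (free_algebra K (S_gens n r))" if "i \<in> {1..r}" for i
    using that unfolding K.free_gen_eq by (intro K.free_word_closed) (auto simp: S_gens_def)
  have L: "i \<in> {1..r} \<Longrightarrow> i \<in> {1..n}" for i using r_le by auto
  show "S_relations K n r \<Lambda> \<subseteq>
      carrier (free_algebra K (S_gens n r)) \<times> carrier (free_algebra K (S_gens n r))"
    unfolding S_relations_def Let_def
    by (auto simp: x y L simp del: atLeastAtMost_iff One_nat_def)
qed

context S_alg
begin

lemma gens_closed:
  "i \<in> {1..n} \<Longrightarrow> gen (SY i) \<in> carrier PA" "i \<in> {1..r} \<Longrightarrow> gen (SX i) \<in> carrier PA"
  using gen_closed by (auto simp: S_gens_def)

lemma free_gens_closed:
  "i \<in> {1..n} \<Longrightarrow> free_gen K (SY i) \<in> carrier FA" "i \<in> {1..r} \<Longrightarrow> free_gen K (SX i) \<in> carrier FA"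
  using free_gen_closed by (auto simp: S_gens_def)

lemma r_n: "i \<in> {1..r} \<Longrightarrow> i \<in> {1..n}"
  using r_le by auto

lemma gen_rel_yy:
  assumes "i \<in> {1..n}" "j \<in> {1..n}"
  shows "gen (SY i) \<otimes>\<^bsub>PA\<^esub> gen (SY j) = \<Lambda> i j \<odot>\<^bsub>PA\<^esub> (gen (SY j) \<otimes>\<^bsub>PA\<^esub> gen (SY i))"
proof -
  have "proj (free_gen K (SY i) \<otimes>\<^bsub>FA\<^esub> free_gen K (SY j)) =
      proj (\<Lambda> i j \<odot>\<^bsub>FA\<^esub> (free_gen K (SY j) \<otimes>\<^bsub>FA\<^esub> free_gen K (SY i)))"
    by (rule proj_relation) (use assms in \<open>unfold S_relations_def Let_def, blast\<close>)
  then show ?thesis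
    using assms by (simp add: presented_gen_def proj_homD free_gens_closed)
qed

lemma gen_rel_xx:
  assumes "i \<in> {1..r}" "j \<in> {1..r}"
  shows "gen (SX i) \<otimes>\<^bsub>PA\<^esub> gen (SX j) = \<Lambda> i j \<odot>\<^bsub>PA\<^esub> (gen (SX j) \<otimes>\<^bsub>PA\<^esub> gen (SX i))"
proof -
  have "proj (free_gen K (SX i) \<otimes>\<^bsub>FA\<^esub> free_gen K (SX j)) =
      proj (\<Lambda> i j \<odot>\<^bsub>FA\<^esub> (free_gen K (SX j) \<otimes>\<^bsub>FA\<^esub> free_gen K (SX i)))"
    by (rule proj_relation) (use assms in \<open>unfold S_relations_def Let_def, blast\<close>)
  then show ?thesis
    using assms r_n by (simp add: presented_gen_def proj_homD free_gens_closed)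
qed

lemma gen_rel_xy_same:
  assumes "i \<in> {1..r}"
  shows "gen (SX i) \<otimes>\<^bsub>PA\<^esub> gen (SY i) = gen (SY i) \<otimes>\<^bsub>PA\<^esub> gen (SX i) \<oplus>\<^bsub>PA\<^esub> \<one>\<^bsub>PA\<^esub>"
proof -
  have "proj (free_gen K (SX i) \<otimes>\<^bsub>FA\<^esub> free_gen K (SY i)) =
      proj (free_gen K (SY i) \<otimes>\<^bsub>FA\<^esub> free_gen K (SX i) \<oplus>\<^bsub>FA\<^esub> \<one>\<^bsub>FA\<^esub>)"
    by (rule proj_relation) (use assms in \<open>unfold S_relations_def Let_def, blast\<close>)
  then show ?thesis
    using assms r_n by (simp add: presented_gen_def proj_homD free_gens_closed)
qed

lemma gen_rel_xy:
  assumes "i \<in> {1..r}" "j \<in> {1..n}" "i \<noteq> j"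
  shows "gen (SX i) \<otimes>\<^bsub>PA\<^esub> gen (SY j) = inv (\<Lambda> i j) \<odot>\<^bsub>PA\<^esub> (gen (SY j) \<otimes>\<^bsub>PA\<^esub> gen (SX i))"
proof -
  have "proj (free_gen K (SX i) \<otimes>\<^bsub>FA\<^esub> free_gen K (SY j)) =
      proj (inv (\<Lambda> i j) \<odot>\<^bsub>FA\<^esub> (free_gen K (SY j) \<otimes>\<^bsub>FA\<^esub> free_gen K (SX i)))"
    by (rule proj_relation) (use assms in \<open>unfold S_relations_def Let_def, blast\<close>)
  then show ?thesis
    using assms r_n by (simp add: presented_gen_def proj_homD free_gens_closed)
qed

text \<open>The hypothesis for straightening words. It asks for both orders of each pair, so the
  mixed relations also have to be solved for y_j x_i.\<close>

lemma gen_commute: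
  assumes "x \<in> S_gens n r" "y \<in> S_gens n r"
  shows "\<exists>c\<in>carrier K. \<exists>d\<in>carrier K.
    gen x \<otimes>\<^bsub>PA\<^esub> gen y = c \<odot>\<^bsub>PA\<^esub> (gen y \<otimes>\<^bsub>PA\<^esub> gen x) \<oplus>\<^bsub>PA\<^esub> d \<odot>\<^bsub>PA\<^esub> \<one>\<^bsub>PA\<^esub>"
proof -
  consider i j where "x = SY i" "y = SY j" "i \<in> {1..n}" "j \<in> {1..n}"
    | i j where "x = SX i" "y = SX j" "i \<in> {1..r}" "j \<in> {1..r}"
    | i where "x = SX i" "y = SY i" "i \<in> {1..r}"
    | i where "x = SY i" "y = SX i" "i \<in> {1..r}"
    | i j where "x = SX i" "y = SY j" "i \<in> {1..r}" "j \<in> {1..n}" "i \<noteq> j"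
    | i j where "x = SY j" "y = SX i" "i \<in> {1..r}" "j \<in> {1..n}" "i \<noteq> j"
    using assms unfolding S_gens_def by blast
  then show ?thesis
  proof cases
    case 1
    then show ?thesis
      using gen_rel_yy[of i j] gens_closed
      by (intro bexI[of _ "\<Lambda> i j"] bexI[of _ "\<zero>"]) auto
  next
    case 2
    then show ?thesis
      using gen_rel_xx[of i j] gens_closed r_n
      by (intro bexI[of _ "\<Lambda> i j"] bexI[of _ "\<zero>"]) auto
  next
    case 3
    then show ?thesis
      using gen_rel_xy_same[of i] gens_closed r_n[of i]
      by (intro bexI[of _ "\<one>"]) auto
  next
    case 4
    have cl: "gen (SX i) \<otimes>\<^bsub>PA\<^esub> gen (SY i) \<in> carrier PA" "gen (SY i) \<otimes>\<^bsub>PA\<^esub> gen (SX i) \<in> carrier PA"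
      using 4 gens_closed r_n[of i] by auto
    have "gen (SY i) \<otimes>\<^bsub>PA\<^esub> gen (SX i) = gen (SX i) \<otimes>\<^bsub>PA\<^esub> gen (SY i) \<oplus>\<^bsub>PA\<^esub> \<ominus>\<^bsub>PA\<^esub> \<one>\<^bsub>PA\<^esub>"
      unfolding gen_rel_xy_same[OF 4(3)] using cl by (simp add: PA.A.a_assoc PA.A.r_neg)
    then show ?thesis
      using 4 cl
      by (intro bexI[of _ "\<one>"] bexI[of _ "\<ominus> \<one>"]) (auto simp: PA.M.smult_l_minus)
  next
    case 5
    then show ?thesis
      using gen_rel_xy[of i j] gens_closed r_n[of i]
      by (intro bexI[of _ "inv (\<Lambda> i j)"] bexI[of _ "\<zero>"]) auto
  next
    case 6
    have cl: "gen (SX i) \<otimes>\<^bsub>PA\<^esub> gen (SY j) \<in> carrier PA" "gen (SY j) \<otimes>\<^bsub>PA\<^esub> gen (SX i) \<in> carrier PA"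
      using 6 gens_closed r_n[of i] by auto
    have "\<Lambda> i j \<odot>\<^bsub>PA\<^esub> (gen (SX i) \<otimes>\<^bsub>PA\<^esub> gen (SY j)) = gen (SY j) \<otimes>\<^bsub>PA\<^esub> gen (SX i)"
      unfolding gen_rel_xy[OF 6(3,4,5)] using cl 6 r_n[of i]
      by (simp add: PA.M.smult_assoc1[symmetric] K.Units_inv_closed)
    then show ?thesis
      using 6 cl r_n[of i]
      by (intro bexI[of _ "\<Lambda> i j"] bexI[of _ "\<zero>"]) auto
  qed
qed

text \<open>The spanning half of a basis theorem, by rewriting alone; nothing is claimed here about
  independence.\<close>

lemma carrier_span: "carrier PA = PA.word_span gen (S_gens n r) (range mset_word)"
proof (rule carrier_eq_word_span)
  fix w assume "w \<in> lists (S_gens n r)"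
  then show "PA.word_prod gen w \<in> PA.word_span gen (S_gens n r) (range mset_word)"
  proof (rule PA.word_span_normal_forms[OF gen_closed gen_commute, rotated 3])
    fix w :: "S_gen list"
    show "\<exists>w'. mset w' = mset w \<and> (w' \<in> range mset_word \<or>
        PA.word_prod gen w' \<in> PA.word_span gen (S_gens n r) {v. length v < length w})"
      by (intro exI[of _ "mset_word (mset w)"]) simp
  qed
qed

lemma S_representation:
  obtains \<rho> where "\<rho> \<in> assoc_algebra_hom K PA (End_algebra K V)"
    and "\<And>x. x \<in> S_gens n r \<Longrightarrow> \<rho> (gen x) = S_op x"
proof -
  interpret V: module K V by (rule K.fun_module)
  let ?B = "End_algebra K V"
  interpret B: assoc_alg K ?B by (rule V.End_algebra_assoc_alg)
  have g: "S_op \<in> S_gens n r \<rightarrow> carrier ?B" by (simp add: S_op_closed)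
  note hom = assoc_algebra_homD[OF B.free_eval_hom[OF g]]
  have ev: "B.free_eval S_op (free_gen K (SY i)) = y_op i" if "i \<in> {1..n}" for i
    using eval_gen[OF B.assoc_alg_axioms g, of "SY i"] that by (simp add: S_gens_def)
  have ev': "B.free_eval S_op (free_gen K (SX i)) = x_op i" if "i \<in> {1..r}" for i
    using eval_gen[OF B.assoc_alg_axioms g, of "SX i"] that by (simp add: S_gens_def)
  have op: "y_op i \<in> carrier ?B" "x_op i \<in> carrier ?B" for i
    using S_op_closed[of "SY i"] S_op_closed[of "SX i"] by simp_all
  note simps = hom free_gens_closed ev ev' r_n
  have yy: "y_op i \<otimes>\<^bsub>?B\<^esub> y_op j = \<Lambda> i j \<odot>\<^bsub>?B\<^esub> (y_op j \<otimes>\<^bsub>?B\<^esub> y_op i)"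
    if "i \<in> {1..n}" "j \<in> {1..n}" for i j
  proof (rule End_eqI)
    fix f assume f: "f \<in> carrier V"
    show "(y_op i \<otimes>\<^bsub>?B\<^esub> y_op j) f = (\<Lambda> i j \<odot>\<^bsub>?B\<^esub> (y_op j \<otimes>\<^bsub>?B\<^esub> y_op i)) f"
      unfolding D.End_fun_simps[OF f] by (rule ext) (rule yy_op[OF that f])
  qed (intro B.A.m_closed B.A.a_closed B.A.one_closed B.M.smult_closed op Lambda_closed Lambda_Units
      K.Units_inv_closed that)+
  \<comment> \<open>The operators satisfy the relations for all indices up to \<open>n\<close>; the
    bound \<open>r\<close> enters only through the choice of generators.\<close>
  have xx: "x_op i \<otimes>\<^bsub>?B\<^esub> x_op j = \<Lambda> i j \<odot>\<^bsub>?B\<^esub> (x_op j \<otimes>\<^bsub>?B\<^esub> x_op i)"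
    if "i \<in> {1..n}" "j \<in> {1..n}" for i j
  proof (rule End_eqI)
    fix f assume f: "f \<in> carrier V"
    show "(x_op i \<otimes>\<^bsub>?B\<^esub> x_op j) f = (\<Lambda> i j \<odot>\<^bsub>?B\<^esub> (x_op j \<otimes>\<^bsub>?B\<^esub> x_op i)) f"
      unfolding D.End_fun_simps[OF f] by (rule ext) (rule xx_op[OF that f])
  qed (intro B.A.m_closed B.A.a_closed B.A.one_closed B.M.smult_closed op Lambda_closed Lambda_Units
      K.Units_inv_closed that)+
  have xy: "x_op i \<otimes>\<^bsub>?B\<^esub> y_op i = y_op i \<otimes>\<^bsub>?B\<^esub> x_op i \<oplus>\<^bsub>?B\<^esub> \<one>\<^bsub>?B\<^esub>"
    if "i \<in> {1..n}" for i
  proof (rule End_eqI)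
    fix f assume f: "f \<in> carrier V"
    show "(x_op i \<otimes>\<^bsub>?B\<^esub> y_op i) f = (y_op i \<otimes>\<^bsub>?B\<^esub> x_op i \<oplus>\<^bsub>?B\<^esub> \<one>\<^bsub>?B\<^esub>) f"
      unfolding D.End_fun_simps[OF f] by (rule ext) (rule xy_op_same[OF that f])
  qed (intro B.A.m_closed B.A.a_closed B.A.one_closed B.M.smult_closed op Lambda_closed Lambda_Units
      K.Units_inv_closed that)+
  have xy': "x_op i \<otimes>\<^bsub>?B\<^esub> y_op j = inv (\<Lambda> i j) \<odot>\<^bsub>?B\<^esub> (y_op j \<otimes>\<^bsub>?B\<^esub> x_op i)"
    if "i \<in> {1..n}" "j \<in> {1..n}" "i \<noteq> j" for i j
  proof (rule End_eqI)
    fix f assume f: "f \<in> carrier V"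
    show "(x_op i \<otimes>\<^bsub>?B\<^esub> y_op j) f = (inv (\<Lambda> i j) \<odot>\<^bsub>?B\<^esub> (y_op j \<otimes>\<^bsub>?B\<^esub> x_op i)) f"
      unfolding D.End_fun_simps[OF f] by (rule ext) (rule xy_op[OF that f])
  qed (intro B.A.m_closed B.A.a_closed B.A.one_closed B.M.smult_closed op Lambda_closed Lambda_Units
      K.Units_inv_closed that)+
  have "B.free_eval S_op u = B.free_eval S_op v" if E: "(u, v) \<in> S_relations K n r \<Lambda>" for u v
  proof -
    let ?y = "\<lambda>i. free_gen K (SY i)" and ?x = "\<lambda>i. free_gen K (SX i)"
    from E consider
      (yy) i j where "i \<in> {1..n}" "j \<in> {1..n}"
        "u = ?y i \<otimes>\<^bsub>FA\<^esub> ?y j" "v = \<Lambda> i j \<odot>\<^bsub>FA\<^esub> (?y j \<otimes>\<^bsub>FA\<^esub> ?y i)"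
    | (xy) i where "i \<in> {1..r}"
        "u = ?x i \<otimes>\<^bsub>FA\<^esub> ?y i" "v = ?y i \<otimes>\<^bsub>FA\<^esub> ?x i \<oplus>\<^bsub>FA\<^esub> \<one>\<^bsub>FA\<^esub>"
    | (xy') i j where "i \<in> {1..r}" "j \<in> {1..n}" "i \<noteq> j"
        "u = ?x i \<otimes>\<^bsub>FA\<^esub> ?y j" "v = inv (\<Lambda> i j) \<odot>\<^bsub>FA\<^esub> (?y j \<otimes>\<^bsub>FA\<^esub> ?x i)"
    | (xx) i j where "i \<in> {1..r}" "j \<in> {1..r}"
        "u = ?x i \<otimes>\<^bsub>FA\<^esub> ?x j" "v = \<Lambda> i j \<odot>\<^bsub>FA\<^esub> (?x j \<otimes>\<^bsub>FA\<^esub> ?x i)"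
      unfolding S_relations_def Let_def by blast
    then show ?thesis
    proof cases
      case ij: yy
      show ?thesis
        unfolding ij(3,4) using ij(1,2) yy[OF ij(1,2)] by (simp add: simps del: atLeastAtMost_iff)
    next
      case i: xy
      show ?thesis
        unfolding i(2,3) using i(1) r_n[OF i(1)] xy[OF r_n[OF i(1)]]
        by (simp add: simps del: atLeastAtMost_iff)
    next
      case ij: xy'
      show ?thesis
        unfolding ij(4,5) using ij(1,2) r_n[OF ij(1)] xy'[OF r_n[OF ij(1)] ij(2,3)]
        by (simp add: simps del: atLeastAtMost_iff)
    next
      case ij: xx
      show ?thesis
        unfolding ij(3,4) using ij(1,2) r_n[OF ij(1)] r_n[OF ij(2)]
          xx[OF r_n[OF ij(1)] r_n[OF ij(2)]]
        by (simp add: simps del: atLeastAtMost_iff)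
    qed
  qed
  from presented_lift[OF B.assoc_alg_axioms g this] that show ?thesis by blast
qed

lemma single_pos: "(0 :: nat \<Rightarrow>\<^sub>0 int) < Poly_Mapping.single k 1"
  by (transfer, rule less_funI) (auto simp: when_def intro!: exI[of _ k])

lemma deg_pos: "0 < ydeg i" "0 < xdeg i"
  by (simp_all add: ydeg_def xdeg_def single_pos)

lemma S_leading:
  obtains P where "total_leading K PA dbeta P"
    and "\<And>i. i \<in> {1..n} \<Longrightarrow> gen (SY i) \<in> P (ydeg i) \<one>"
proof -
  obtain \<rho> where \<rho>: "\<rho> \<in> assoc_algebra_hom K PA (End_algebra K V)"
    and gen: "\<And>x. x \<in> S_gens n r \<Longrightarrow> \<rho> (gen x) = S_op x"
    using S_representation by blast
  let ?P = "D.rep_lead PA \<rho>"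
  interpret L: leading K PA dbeta ?P
    by (rule D.leading_rep_lead[OF PA.assoc_alg_axioms \<rho>])
  have y: "gen (SY i) \<in> ?P (ydeg i) \<one>" if i: "i \<in> {1..n}" for i
  proof (rule D.rep_leadI)
    have ge: "\<rho> (gen (SY i)) = y_op i" using gen[of "SY i"] i by (simp add: S_gens_def)
    fix b and f :: "(nat \<Rightarrow>\<^sub>0 int) \<Rightarrow> 'k" assume f: "f \<in> carrier V" "\<forall>e>b. f e = \<zero>"
    show "\<rho> (gen (SY i)) f e = \<zero>" if "e > ydeg i + b" for e
    proof -
      have "e - ydeg i > b" using that by (simp add: algebra_simps)
      then show ?thesis using f by (simp add: ge y_op_apply)
    qed
    show "\<rho> (gen (SY i)) f (ydeg i + b) = \<one> \<otimes> dbeta (ydeg i) b \<otimes> f b"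
      using f i by (simp add: ge y_op_apply D.beta_add_right dbeta_diag_yy)
  qed (use i gens_closed in auto)
  have x: "gen (SX i) \<in> ?P (xdeg i) \<one>" if i: "i \<in> {1..r}" for i
  proof (rule D.rep_leadI)
    have ge: "\<rho> (gen (SX i)) = x_op i" using gen[of "SX i"] i by (simp add: S_gens_def)
    fix b and f :: "(nat \<Rightarrow>\<^sub>0 int) \<Rightarrow> 'k" assume f: "f \<in> carrier V" "\<forall>e>b. f e = \<zero>"
    have z: "f e \<in> carrier K" for e using f V_closed by simp
    show "\<rho> (gen (SX i)) f e = \<zero>" if e: "e > xdeg i + b" for e
    proof -
      have "e - xdeg i > b" using e by (simp add: algebra_simps)
      \<comment> \<open>The second part of x_i lowers degrees, so it cannot contribute in degrees as
        large as \<open>xdeg i + b\<close>. This rests on the positivity of unit vectors in the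
        order.\<close>
      moreover have "e + ydeg i > b"
        using add_strict_mono[OF e add_strict_mono[OF deg_pos(1)[of i] deg_pos(2)[of i]]]
          \<open>e - xdeg i > b\<close> by (simp add: algebra_simps)
      ultimately show ?thesis using f by (simp add: ge x_op_apply)
    qed
    have "xdeg i + b + ydeg i > b"
      using add_strict_mono[OF deg_pos(1)[of i] deg_pos(2)[of i]] by (simp add: algebra_simps)
    then show "\<rho> (gen (SX i)) f (xdeg i + b) = \<one> \<otimes> dbeta (xdeg i) b \<otimes> f b"
      using f z r_n[OF i] by (simp add: ge x_op_apply D.beta_add_right dbeta_diag)
  qed (use i gens_closed in auto)
  have xy: "\<exists>c. c \<noteq> \<zero> \<and> gen z \<in> ?P (S_deg z) c" if "z \<in> S_gens n r" for z
    using that x y K.one_not_zero by (auto simp: S_gens_def simp del: atLeastAtMost_iff K.one_not_zero)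
  have inj: "inj_on (\<lambda>w. sum_list (map S_deg w)) (range mset_word \<inter> lists (S_gens n r))"
  proof (rule inj_onI)
    fix v w assume "v \<in> range mset_word \<inter> lists (S_gens n r)" "w \<in> range mset_word \<inter> lists (S_gens n r)"
      and "sum_list (map S_deg v) = sum_list (map S_deg w)"
    then show "v = w" using S_deg_mset[of v w] by auto
  qed
  \<comment> \<open>Normal words span and have distinct degrees, and every generator has leading
    coefficient one. Hence a nonzero element, written in normal words, takes its leading degree from
    its largest word.\<close>
  have "\<exists>a c. c \<noteq> \<zero> \<and> z \<in> ?P a c" if zc: "z \<in> carrier PA" and nz: "z \<noteq> \<zero>\<^bsub>PA\<^esub>" for z
  proof -
    obtain f where f: "f \<in> carrier FA" "\<forall>w. f w \<noteq> \<zero> \<longrightarrow> w \<in> range mset_word"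
      "z = PA.free_eval gen f"
      using PA.word_spanE[OF zc[unfolded carrier_span]] by metis
    have "f \<noteq> (\<lambda>w. \<zero>)" using nz f(3) PA.free_eval_zero[OF gen_closed] by blast
    then show ?thesis
      using L.P_word_span[OF gen_closed xy inj f(1) f(2)[rule_format]] f(3) by simp
  qed
  then have "total_leading K PA dbeta ?P"
    by (intro total_leading.intro L.leading_axioms total_leading_axioms.intro)
  with y show ?thesis using that by blast
qed

end

section \<open>Extending leading terms to the skew field of fractions\<close>

text \<open>Totality gives the inverse some degree; comparing the product with one, which has degree
  0, identifies it.\<close>

lemma (in total_leading) P_inverse:
  assumes "skew_field A" "z \<in> P a c" "c \<noteq> \<zero>" "z' \<in> carrier A" "z \<otimes>\<^bsub>A\<^esub> z' = \<one>\<^bsub>A\<^esub>"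
  shows "\<exists>d. d \<noteq> \<zero> \<and> z' \<in> P (- a) d"
proof -
  have "z' \<noteq> \<zero>\<^bsub>A\<^esub>"
    using assms P_carrier by (auto simp: skew_field_def)
  then obtain b d where d: "d \<noteq> \<zero>" "z' \<in> P b d"
    using P_total assms by blast
  have "\<one>\<^bsub>A\<^esub> \<in> P (a + b) (c \<otimes> d \<otimes> \<beta> a b)"
    using P_mult[OF assms(2) d(2)] assms(5) by simp
  from P_unique(1)[OF this P_one P_mult_nonzero[OF assms(2) d(2) assms(3) d(1)]]
  have "b = - a" by (simp add: eq_neg_iff_add_eq_0 add.commute)
  then show ?thesis using d by blast
qed

locale lead_fractions = S: total_leading K S \<beta> P
  for K :: "('k, 'e) ring_scheme" (structure) and S :: "('k, 's, 'm) module_scheme"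
    and \<beta> :: "'g::linordered_ab_group_add \<Rightarrow> 'g \<Rightarrow> 'k" and P :: "'g \<Rightarrow> 'k \<Rightarrow> 's set" +
  fixes F :: "('k, 'f, 'n) module_scheme" and \<iota> :: "'s \<Rightarrow> 'f"
  assumes fractions: "skew_field_of_fractions K S F \<iota>"
begin

sublocale F: assoc_alg K F
  using fractions by (simp add: assoc_alg_def skew_field_of_fractions_def)

lemma skew: "skew_field F"
  and hom: "\<iota> \<in> assoc_algebra_hom K S F"
  and inj: "inj_on \<iota> (carrier S)"
  and fraction: "f \<in> carrier F \<Longrightarrow>
    \<exists>a\<in>carrier S. \<exists>s\<in>carrier S - {\<zero>\<^bsub>S\<^esub>}. f = \<iota> a \<otimes>\<^bsub>F\<^esub> inv\<^bsub>F\<^esub> (\<iota> s)"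
  using fractions by (auto simp: skew_field_of_fractions_def)

lemma Units_F: "Units F = carrier F - {\<zero>\<^bsub>F\<^esub>}" and F_one: "\<one>\<^bsub>F\<^esub> \<noteq> \<zero>\<^bsub>F\<^esub>"
  using skew by (simp_all add: skew_field_def)

lemma iota_zero [simp]: "\<iota> \<zero>\<^bsub>S\<^esub> = \<zero>\<^bsub>F\<^esub>"
  by (rule assoc_algebra_hom_zero[OF hom S.A.ring_axioms F.A.ring_axioms])

lemmas iota = assoc_algebra_homD(2-)[OF hom]

lemma iota_Units:
  assumes "s \<in> carrier S" "s \<noteq> \<zero>\<^bsub>S\<^esub>"
  shows "\<iota> s \<in> Units F"
  using assms inj iota_zero iota(2)[OF assms(1)] unfolding Units_F
  by (metis DiffI S.A.zero_closed inj_onD singletonD)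

lemma mult_zeroD:
  assumes "s \<in> carrier S" "t \<in> carrier S" "s \<noteq> \<zero>\<^bsub>S\<^esub>" "s \<otimes>\<^bsub>S\<^esub> t = \<zero>\<^bsub>S\<^esub>"
  shows "t = \<zero>\<^bsub>S\<^esub>"
proof (rule ccontr)
  assume "t \<noteq> \<zero>\<^bsub>S\<^esub>"
  then have "\<iota> s \<otimes>\<^bsub>F\<^esub> \<iota> t \<in> Units F"
    using iota_Units assms by simp
  moreover have "\<iota> s \<otimes>\<^bsub>F\<^esub> \<iota> t = \<zero>\<^bsub>F\<^esub>"
    using assms iota(3)[OF assms(1,2)] by simp
  ultimately show False by (simp add: Units_F)
qed

text \<open>The right Ore condition, read off from the fraction property of \<open>F\<close>: the
  left fraction of \<open>b\<close> by \<open>s\<close> is also a right fraction of \<open>p\<close>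
  by \<open>q\<close>.\<close>

lemma right_multiple:
  assumes "b \<in> carrier S" "s \<in> carrier S" "s \<noteq> \<zero>\<^bsub>S\<^esub>"
  obtains p q where "p \<in> carrier S" "q \<in> carrier S" "q \<noteq> \<zero>\<^bsub>S\<^esub>" "b \<otimes>\<^bsub>S\<^esub> q = s \<otimes>\<^bsub>S\<^esub> p"
proof -
  have s: "\<iota> s \<in> Units F" by (rule iota_Units[OF assms(2,3)])
  have b: "\<iota> b \<in> carrier F" and sc: "\<iota> s \<in> carrier F" using iota assms by simp_all
  obtain p q where pq: "p \<in> carrier S" "q \<in> carrier S" "q \<noteq> \<zero>\<^bsub>S\<^esub>"
    and eq: "inv\<^bsub>F\<^esub> (\<iota> s) \<otimes>\<^bsub>F\<^esub> \<iota> b = \<iota> p \<otimes>\<^bsub>F\<^esub> inv\<^bsub>F\<^esub> (\<iota> q)"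
    using fraction[of "inv\<^bsub>F\<^esub> (\<iota> s) \<otimes>\<^bsub>F\<^esub> \<iota> b"] s b by auto
  have q: "\<iota> q \<in> Units F" by (rule iota_Units[OF pq(2,3)])
  have cl: "\<iota> p \<in> carrier F" "\<iota> q \<in> carrier F" using iota pq by simp_all
  have "\<iota> b \<otimes>\<^bsub>F\<^esub> \<iota> q = \<iota> s \<otimes>\<^bsub>F\<^esub> (inv\<^bsub>F\<^esub> (\<iota> s) \<otimes>\<^bsub>F\<^esub> \<iota> b) \<otimes>\<^bsub>F\<^esub> \<iota> q"
    using s b sc cl by (simp add: F.A.m_assoc[symmetric])
  also have "\<dots> = \<iota> s \<otimes>\<^bsub>F\<^esub> \<iota> p"
    unfolding eq using s q sc cl by (simp add: F.A.m_assoc)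
  finally have "\<iota> (b \<otimes>\<^bsub>S\<^esub> q) = \<iota> (s \<otimes>\<^bsub>S\<^esub> p)"
    using assms pq iota by simp
  then have "b \<otimes>\<^bsub>S\<^esub> q = s \<otimes>\<^bsub>S\<^esub> p"
    using inj_onD[OF inj] assms pq by simp
  with pq that show ?thesis by blast
qed

text \<open>Dictated by multiplicativity: if \<open>f\<close> has coefficient \<open>c\<close> in
  degree \<open>a\<close> and \<open>s\<close> has \<open>d\<close> in degree \<open>b\<close>, the
  numerator \<open>u\<close> must have \<open>c \<otimes> d \<otimes> \<beta> a b\<close> in degree
  \<open>a + b\<close>. A single denominator is asked for; independence of its choice comes out
  afterwards as uniqueness of leading terms.\<close>

definition frac_lead :: "'g \<Rightarrow> 'k \<Rightarrow> 'f set" where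
  "frac_lead a c = {f \<in> carrier F. c \<in> carrier K \<and> (\<exists>s u b d. d \<noteq> \<zero> \<and> s \<in> P b d \<and>
     u \<in> P (a + b) (c \<otimes> d \<otimes> \<beta> a b) \<and> f \<otimes>\<^bsub>F\<^esub> \<iota> s = \<iota> u)}"

lemma frac_leadI:
  assumes "f \<in> carrier F" "c \<in> carrier K" "d \<noteq> \<zero>" "s \<in> P b d"
    "u \<in> P (a + b) (c \<otimes> d \<otimes> \<beta> a b)" "f \<otimes>\<^bsub>F\<^esub> \<iota> s = \<iota> u"
  shows "f \<in> frac_lead a c"
  using assms unfolding frac_lead_def by blast

lemma frac_leadE:
  assumes "f \<in> frac_lead a c"
  obtains s u b d where "f \<in> carrier F" "c \<in> carrier K" "d \<noteq> \<zero>" "s \<in> P b d"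
    "u \<in> P (a + b) (c \<otimes> d \<otimes> \<beta> a b)" "f \<otimes>\<^bsub>F\<^esub> \<iota> s = \<iota> u"
    "s \<in> carrier S" "u \<in> carrier S" "s \<noteq> \<zero>\<^bsub>S\<^esub>" "d \<in> carrier K" "\<iota> s \<in> carrier F" "\<iota> u \<in> carrier F"
  using assms S.P_carrier S.P_coeff S.P_nonzero iota(2) unfolding frac_lead_def by blast

lemma frac_lead_add:
  assumes f: "f \<in> frac_lead a c" and g: "g \<in> frac_lead a c'"
  shows "f \<oplus>\<^bsub>F\<^esub> g \<in> frac_lead a (c \<oplus> c')"
proof -
  obtain s u b d where s: "f \<in> carrier F" "c \<in> carrier K" "d \<noteq> \<zero>" "s \<in> P b d"
    "u \<in> P (a + b) (c \<otimes> d \<otimes> \<beta> a b)" "f \<otimes>\<^bsub>F\<^esub> \<iota> s = \<iota> u"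
    "s \<in> carrier S" "u \<in> carrier S" "s \<noteq> \<zero>\<^bsub>S\<^esub>" "d \<in> carrier K" "\<iota> s \<in> carrier F" "\<iota> u \<in> carrier F"
    by (rule frac_leadE[OF f])
  obtain t v b' d' where t: "g \<in> carrier F" "c' \<in> carrier K" "d' \<noteq> \<zero>" "t \<in> P b' d'"
    "v \<in> P (a + b') (c' \<otimes> d' \<otimes> \<beta> a b')" "g \<otimes>\<^bsub>F\<^esub> \<iota> t = \<iota> v"
    "t \<in> carrier S" "v \<in> carrier S" "t \<noteq> \<zero>\<^bsub>S\<^esub>" "d' \<in> carrier K" "\<iota> t \<in> carrier F" "\<iota> v \<in> carrier F"
    by (rule frac_leadE[OF g])
  \<comment> \<open>The common denominator \<open>s \<otimes> p = t \<otimes> q\<close> of the two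
    fractions.\<close>
  obtain p q where pq: "p \<in> carrier S" "q \<in> carrier S" "q \<noteq> \<zero>\<^bsub>S\<^esub>" "t \<otimes>\<^bsub>S\<^esub> q = s \<otimes>\<^bsub>S\<^esub> p"
    by (rule right_multiple[OF t(7) s(7) s(9)])
  have "p \<noteq> \<zero>\<^bsub>S\<^esub>"
    using mult_zeroD[OF t(7) pq(2) t(9)] pq s(7) by auto
  then obtain k e where p: "e \<noteq> \<zero>" "p \<in> P k e" using S.P_total pq by blast
  obtain k' e' where q: "e' \<noteq> \<zero>" "q \<in> P k' e'" using S.P_total pq by blast
  have e: "e \<in> carrier K" "e' \<in> carrier K" using S.P_coeff p q by blast+
  let ?D = "d \<otimes> e \<otimes> \<beta> b k"
  have sp: "s \<otimes>\<^bsub>S\<^esub> p \<in> P (b + k) ?D" by (rule S.P_mult[OF s(4) p(2)])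
  have tq: "s \<otimes>\<^bsub>S\<^esub> p \<in> P (b' + k') (d' \<otimes> e' \<otimes> \<beta> b' k')"
    using S.P_mult[OF t(4) q(2)] pq(4) by simp
  \<comment> \<open>The leading term of the common denominator is computed from both factorisations.
    By uniqueness the results agree, so the two numerators are compared in one and the same
    degree.\<close>
  note un = S.P_unique[OF sp tq S.P_mult_nonzero[OF s(4) p(2) s(3) p(1)]
      S.P_mult_nonzero[OF t(4) q(2) t(3) q(1)]]
  have up: "u \<otimes>\<^bsub>S\<^esub> p \<in> P (a + (b + k)) (c \<otimes> ?D \<otimes> \<beta> a (b + k))"
  proof -
    have "c \<otimes> d \<otimes> \<beta> a b \<otimes> e \<otimes> \<beta> (a + b) k = c \<otimes> ?D \<otimes> \<beta> a (b + k)"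
      using s(2,10) e by (simp add: S.beta_add_left S.beta_add_right S.K.m_ac)
    then show ?thesis using S.P_mult[OF s(5) p(2)] by (simp add: add.assoc)
  qed
  have vq: "v \<otimes>\<^bsub>S\<^esub> q \<in> P (a + (b + k)) (c' \<otimes> ?D \<otimes> \<beta> a (b + k))"
  proof -
    have "c' \<otimes> d' \<otimes> \<beta> a b' \<otimes> e' \<otimes> \<beta> (a + b') k' =
        c' \<otimes> (d' \<otimes> e' \<otimes> \<beta> b' k') \<otimes> \<beta> a (b' + k')"
      using t(2,10) e by (simp add: S.beta_add_left S.beta_add_right S.K.m_ac)
    then show ?thesis
      using S.P_mult[OF t(5) q(2)] unfolding un by (simp add: add.assoc)
  qed
  have "c \<otimes> ?D \<otimes> \<beta> a (b + k) \<oplus> c' \<otimes> ?D \<otimes> \<beta> a (b + k) =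
      (c \<oplus> c') \<otimes> ?D \<otimes> \<beta> a (b + k)"
    using s t e by (simp add: S.K.l_distr)
  then have sum: "u \<otimes>\<^bsub>S\<^esub> p \<oplus>\<^bsub>S\<^esub> v \<otimes>\<^bsub>S\<^esub> q \<in> P (a + (b + k)) ((c \<oplus> c') \<otimes> ?D \<otimes> \<beta> a (b + k))"
    using S.P_add[OF up vq] by simp
  have ip: "\<iota> p \<in> carrier F" "\<iota> q \<in> carrier F" using iota pq by simp_all
  have "f \<otimes>\<^bsub>F\<^esub> \<iota> (s \<otimes>\<^bsub>S\<^esub> p) = \<iota> (u \<otimes>\<^bsub>S\<^esub> p)"
    using s pq ip iota by (simp add: F.A.m_assoc[symmetric])
  moreover have "g \<otimes>\<^bsub>F\<^esub> \<iota> (s \<otimes>\<^bsub>S\<^esub> p) = \<iota> (v \<otimes>\<^bsub>S\<^esub> q)"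
    unfolding pq(4)[symmetric] using t pq(1,2) ip iota by (simp add: F.A.m_assoc[symmetric])
  ultimately have "(f \<oplus>\<^bsub>F\<^esub> g) \<otimes>\<^bsub>F\<^esub> \<iota> (s \<otimes>\<^bsub>S\<^esub> p) = \<iota> (u \<otimes>\<^bsub>S\<^esub> p \<oplus>\<^bsub>S\<^esub> v \<otimes>\<^bsub>S\<^esub> q)"
    using s t pq ip iota by (simp add: F.A.l_distr)
  with sp sum show ?thesis
    using S.P_mult_nonzero[OF s(4) p(2) s(3) p(1)] s t by (intro frac_leadI) auto
qed

lemma frac_lead_mult:
  assumes f: "f \<in> frac_lead a c" and g: "g \<in> frac_lead a' c'"
  shows "f \<otimes>\<^bsub>F\<^esub> g \<in> frac_lead (a + a') (c \<otimes> c' \<otimes> \<beta> a a')"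
proof -
  obtain s u b d where s: "f \<in> carrier F" "c \<in> carrier K" "d \<noteq> \<zero>" "s \<in> P b d"
    "u \<in> P (a + b) (c \<otimes> d \<otimes> \<beta> a b)" "f \<otimes>\<^bsub>F\<^esub> \<iota> s = \<iota> u"
    "s \<in> carrier S" "u \<in> carrier S" "s \<noteq> \<zero>\<^bsub>S\<^esub>" "d \<in> carrier K" "\<iota> s \<in> carrier F" "\<iota> u \<in> carrier F"
    by (rule frac_leadE[OF f])
  obtain t v b' d' where t: "g \<in> carrier F" "c' \<in> carrier K" "d' \<noteq> \<zero>" "t \<in> P b' d'"
    "v \<in> P (a' + b') (c' \<otimes> d' \<otimes> \<beta> a' b')" "g \<otimes>\<^bsub>F\<^esub> \<iota> t = \<iota> v"
    "t \<in> carrier S" "v \<in> carrier S" "t \<noteq> \<zero>\<^bsub>S\<^esub>" "d' \<in> carrier K" "\<iota> t \<in> carrier F" "\<iota> v \<in> carrier F"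
    by (rule frac_leadE[OF g])
  \<comment> \<open>Matching the numerator of \<open>g\<close> with the denominator of
    \<open>f\<close> makes \<open>f \<otimes> g\<close> the fraction of \<open>u \<otimes> p\<close>
    by \<open>t \<otimes> q\<close>.\<close>
  obtain p q where pq: "p \<in> carrier S" "q \<in> carrier S" "q \<noteq> \<zero>\<^bsub>S\<^esub>" "v \<otimes>\<^bsub>S\<^esub> q = s \<otimes>\<^bsub>S\<^esub> p"
    by (rule right_multiple[OF t(8) s(7) s(9)])
  obtain k e where q: "e \<noteq> \<zero>" "q \<in> P k e" using S.P_total pq by blast
  have e: "e \<in> carrier K" using S.P_coeff q by blast
  let ?D = "d' \<otimes> e \<otimes> \<beta> b' k"
  have tq: "t \<otimes>\<^bsub>S\<^esub> q \<in> P (b' + k) ?D" by (rule S.P_mult[OF t(4) q(2)])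
  have vq: "v \<otimes>\<^bsub>S\<^esub> q \<in> P (a' + b' + k) (c' \<otimes> d' \<otimes> \<beta> a' b' \<otimes> e \<otimes> \<beta> (a' + b') k)"
    by (rule S.P_mult[OF t(5) q(2)])
  have ip: "\<iota> p \<in> carrier F" "\<iota> q \<in> carrier F" using iota pq by simp_all
  have eq: "(f \<otimes>\<^bsub>F\<^esub> g) \<otimes>\<^bsub>F\<^esub> \<iota> (t \<otimes>\<^bsub>S\<^esub> q) = \<iota> (u \<otimes>\<^bsub>S\<^esub> p)"
  proof -
    have "(f \<otimes>\<^bsub>F\<^esub> g) \<otimes>\<^bsub>F\<^esub> \<iota> (t \<otimes>\<^bsub>S\<^esub> q) = f \<otimes>\<^bsub>F\<^esub> ((g \<otimes>\<^bsub>F\<^esub> \<iota> t) \<otimes>\<^bsub>F\<^esub> \<iota> q)"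
      using F.A.m_assoc[OF t(1,11) ip(2)] s t(1,7,11) pq(2) ip iota by (simp add: F.A.m_assoc)
    also have "\<dots> = f \<otimes>\<^bsub>F\<^esub> \<iota> (v \<otimes>\<^bsub>S\<^esub> q)"
      using t pq(1,2) iota by simp
    also have "\<dots> = (f \<otimes>\<^bsub>F\<^esub> \<iota> s) \<otimes>\<^bsub>F\<^esub> \<iota> p"
      unfolding pq(4) using F.A.m_assoc[OF s(1,11) ip(1)] iota(3)[OF s(7) pq(1)] by simp
    also have "\<dots> = \<iota> (u \<otimes>\<^bsub>S\<^esub> p)"
      using s pq iota by simp
    finally show ?thesis .
  qed
  have "u \<otimes>\<^bsub>S\<^esub> p \<in> P (a + a' + (b' + k)) (c \<otimes> c' \<otimes> \<beta> a a' \<otimes> ?D \<otimes> \<beta> (a + a') (b' + k))"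
  proof (cases "p = \<zero>\<^bsub>S\<^esub>")
    \<comment> \<open>Then the numerator of \<open>g\<close> vanishes, hence \<open>c'\<close> does,
      and zero has coefficient zero in every degree.\<close>
    case True
    then have "v \<otimes>\<^bsub>S\<^esub> q = \<zero>\<^bsub>S\<^esub>" using pq s(7) by simp
    then have "v = \<zero>\<^bsub>S\<^esub>" using mult_zeroD[OF t(8) pq(2)] pq(3) by blast
    then have "c' \<otimes> d' \<otimes> \<beta> a' b' = \<zero>" using t(5) S.P_zeroD by blast
    then have "c' = \<zero>" using t(2,3,10) by (simp add: S.K.integral_iff)
    then show ?thesis
      using True s(2,8) t(10) e S.P_zero by simp
  next
    case False
    then obtain l h where p: "h \<noteq> \<zero>" "p \<in> P l h" using S.P_total pq by blast
    have h: "h \<in> carrier K" using S.P_coeff p by blast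
    have sp: "v \<otimes>\<^bsub>S\<^esub> q \<in> P (b + l) (d \<otimes> h \<otimes> \<beta> b l)"
      using S.P_mult[OF s(4) p(2)] pq(4) by simp
    note nz = S.P_mult_nonzero[OF s(4) p(2) s(3) p(1)]
    have up: "u \<otimes>\<^bsub>S\<^esub> p \<in> P (a + (b + l)) (c \<otimes> (d \<otimes> h \<otimes> \<beta> b l) \<otimes> \<beta> a (b + l))"
    proof -
      have "c \<otimes> d \<otimes> \<beta> a b \<otimes> h \<otimes> \<beta> (a + b) l =
          c \<otimes> (d \<otimes> h \<otimes> \<beta> b l) \<otimes> \<beta> a (b + l)"
        using s(2,10) h by (simp add: S.beta_add_left S.beta_add_right S.K.m_ac)
      then show ?thesis using S.P_mult[OF s(5) p(2)] by (simp add: add.assoc)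
    qed
    show ?thesis
    proof (cases "c' = \<zero>")
      \<comment> \<open>Here \<open>a' + b'\<close> is only a strict upper bound for the degree of
        \<open>v\<close>. Degrees can be compared by an inequality alone, and \<open>P_lower\<close>
        turns it into coefficient zero.\<close>
      case True
      have vq0: "v \<otimes>\<^bsub>S\<^esub> q \<in> P (a' + b' + k) \<zero>"
        using vq True t(10) e by simp
      have "b + l < a' + b' + k"
        using nz S.P_unique_coeff[OF sp] vq0 S.P_lower[OF vq0] by (metis linorder_less_linear)
      then have "a + (b + l) < a + a' + (b' + k)" by (simp add: add.assoc)
      from S.P_lower[OF up this] show ?thesis
        using True s(2) t(10) e by simp
    next
      case False
      have vnz: "c' \<otimes> d' \<otimes> \<beta> a' b' \<otimes> e \<otimes> \<beta> (a' + b') k \<noteq> \<zero>"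
        using False t(2,3,10) q(1) e by (simp add: S.K.integral_iff)
      note un = S.P_unique[OF sp vq nz vnz]
      have "c \<otimes> (c' \<otimes> d' \<otimes> \<beta> a' b' \<otimes> e \<otimes> \<beta> (a' + b') k) \<otimes> \<beta> a (a' + b' + k) =
          c \<otimes> c' \<otimes> \<beta> a a' \<otimes> ?D \<otimes> \<beta> (a + a') (b' + k)"
        using s(2) t(2,10) e by (simp add: S.beta_add_left S.beta_add_right S.K.m_ac)
      then show ?thesis using up unfolding un by (simp add: add.assoc)
    qed
  qed
  with tq eq show ?thesis
    using S.P_mult_nonzero[OF t(4) q(2) t(3) q(1)] s t by (intro frac_leadI) auto
qed

lemma frac_lead_iota: "s \<in> P a c \<Longrightarrow> \<iota> s \<in> frac_lead a c"
  using S.P_carrier[of s a c] S.P_coeff[of s a c] iota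
  by (intro frac_leadI[of _ _ "\<one>" "\<one>\<^bsub>S\<^esub>" 0 s]) (auto simp: S.P_one)

lemma frac_lead_total:
  assumes "f \<in> carrier F" "f \<noteq> \<zero>\<^bsub>F\<^esub>"
  shows "\<exists>a c. c \<noteq> \<zero> \<and> f \<in> frac_lead a c"
proof -
  obtain u s where us: "u \<in> carrier S" "s \<in> carrier S" "s \<noteq> \<zero>\<^bsub>S\<^esub>" "f = \<iota> u \<otimes>\<^bsub>F\<^esub> inv\<^bsub>F\<^esub> (\<iota> s)"
    using fraction[OF assms(1)] by blast
  have U: "\<iota> s \<in> Units F" by (rule iota_Units[OF us(2,3)])
  have "u \<noteq> \<zero>\<^bsub>S\<^esub>" using assms us U by auto
  then obtain b c where u: "c \<noteq> \<zero>" "u \<in> P b c" using S.P_total us by blast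
  obtain b' d where s: "d \<noteq> \<zero>" "s \<in> P b' d" using S.P_total us by blast
  have cl: "c \<in> carrier K" "d \<in> carrier K" using S.P_coeff u s by blast+
  \<comment> \<open>The coefficient of \<open>f\<close> in degree \<open>b - b'\<close> must give
    \<open>c\<close> after multiplication by \<open>d\<close> and
    \<open>\<beta> (b - b') b'\<close>; so it is \<open>c\<close> divided by this
    \<open>e\<close>.\<close>
  define e where "e = d \<otimes> \<beta> (b - b') b'"
  have e: "e \<in> Units K" using cl s S.beta_Units by (simp add: e_def S.K.field_Units S.K.integral_iff)
  then have ei: "inv e \<in> Units K" "e \<in> carrier K" "inv e \<in> carrier K" by auto
  have 1: "(c \<otimes> inv e) \<otimes> d \<otimes> \<beta> (b - b') b' = c"
  proof -
    have "(c \<otimes> inv e) \<otimes> d \<otimes> \<beta> (b - b') b' = c \<otimes> (inv e \<otimes> e)"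
      using cl ei by (simp add: e_def S.K.m_assoc)
    then show ?thesis using cl e by simp
  qed
  have "f \<in> frac_lead (b - b') (c \<otimes> inv e)"
  proof (rule frac_leadI[OF assms(1) _ s])
    show "u \<in> P (b - b' + b') (c \<otimes> inv e \<otimes> d \<otimes> \<beta> (b - b') b')"
      using u 1 by simp
    show "f \<otimes>\<^bsub>F\<^esub> \<iota> s = \<iota> u"
      using us U iota by (simp add: F.A.m_assoc)
  qed (use cl ei in simp)
  moreover have "c \<otimes> inv e \<noteq> \<zero>"
    using cl u ei by (simp add: S.K.integral_iff S.K.field_Units)
  ultimately show ?thesis by blast
qed

lemma total_leading_fractions: "total_leading K F \<beta> frac_lead"
proof (intro total_leading.intro leading.intro leading_axioms.intro total_leading_axioms.intro)
  show "assoc_alg K F" ..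
  show "bicharacter K \<beta>" ..
  fix f a c assume f: "f \<in> frac_lead a c"
  then show "f \<in> carrier F" "c \<in> carrier K" by (auto simp: frac_lead_def)
next
  fix f a c d assume f: "f \<in> frac_lead a c" and d: "d \<in> carrier K"
  obtain s u b e where s: "f \<in> carrier F" "c \<in> carrier K" "e \<noteq> \<zero>" "s \<in> P b e"
    "u \<in> P (a + b) (c \<otimes> e \<otimes> \<beta> a b)" "f \<otimes>\<^bsub>F\<^esub> \<iota> s = \<iota> u"
    "s \<in> carrier S" "u \<in> carrier S" "s \<noteq> \<zero>\<^bsub>S\<^esub>" "e \<in> carrier K" "\<iota> s \<in> carrier F" "\<iota> u \<in> carrier F"
    by (rule frac_leadE[OF f])
  show "d \<odot>\<^bsub>F\<^esub> f \<in> frac_lead a (d \<otimes> c)"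
    by (rule frac_leadI[OF _ _ s(3,4), of _ _ "d \<odot>\<^bsub>S\<^esub> u"])
      (use s d S.P_smult[OF s(5) d] in \<open>auto simp: F.smult_mult iota S.K.m_assoc\<close>)
next
  fix f a a' c assume f: "f \<in> frac_lead a c" and "a < a'"
  obtain s u b e where s: "f \<in> carrier F" "c \<in> carrier K" "e \<noteq> \<zero>" "s \<in> P b e"
    "u \<in> P (a + b) (c \<otimes> e \<otimes> \<beta> a b)" "f \<otimes>\<^bsub>F\<^esub> \<iota> s = \<iota> u"
    "s \<in> carrier S" "u \<in> carrier S" "s \<noteq> \<zero>\<^bsub>S\<^esub>" "e \<in> carrier K" "\<iota> s \<in> carrier F" "\<iota> u \<in> carrier F"
    by (rule frac_leadE[OF f])
  have "a + b < a' + b" using \<open>a < a'\<close> by simp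
  from S.P_lower[OF s(5) this] show "f \<in> frac_lead a' \<zero>"
    using s by (intro frac_leadI[OF _ _ s(3,4)]) auto
next
  have "\<iota> \<one>\<^bsub>S\<^esub> \<in> frac_lead 0 \<one>" by (rule frac_lead_iota[OF S.P_one])
  then show "\<one>\<^bsub>F\<^esub> \<in> frac_lead 0 \<one>" by (simp add: iota)
next
  show "\<zero>\<^bsub>F\<^esub> \<in> frac_lead a \<zero>" for a
    using frac_lead_iota[OF S.P_zero] by simp
next
  fix a c assume f: "\<zero>\<^bsub>F\<^esub> \<in> frac_lead a c"
  obtain s u b e where s: "\<zero>\<^bsub>F\<^esub> \<in> carrier F" "c \<in> carrier K" "e \<noteq> \<zero>" "s \<in> P b e"
    "u \<in> P (a + b) (c \<otimes> e \<otimes> \<beta> a b)" "\<zero>\<^bsub>F\<^esub> \<otimes>\<^bsub>F\<^esub> \<iota> s = \<iota> u"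
    "s \<in> carrier S" "u \<in> carrier S" "s \<noteq> \<zero>\<^bsub>S\<^esub>" "e \<in> carrier K" "\<iota> s \<in> carrier F" "\<iota> u \<in> carrier F"
    by (rule frac_leadE[OF f])
  have "\<iota> u = \<iota> \<zero>\<^bsub>S\<^esub>" using s(6,11) by simp
  then have "u = \<zero>\<^bsub>S\<^esub>" using inj_onD[OF inj] s(8) by blast
  then have "c \<otimes> e \<otimes> \<beta> a b = \<zero>" using s(5) S.P_zeroD by blast
  then show "c = \<zero>" using s(2,3,10) by (simp add: S.K.integral_iff)
qed (use frac_lead_add frac_lead_mult frac_lead_total in blast)+

end

section \<open>Quantum tori\<close>

locale graded_commutation = A: assoc_alg K A + B: bicharacter K \<beta>
  for K :: "('k, 'e) ring_scheme" (structure) and A :: "('k, 'a, 'm) module_scheme"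
    and \<beta> :: "'g::linordered_ab_group_add \<Rightarrow> 'g \<Rightarrow> 'k"
begin

text \<open>The relation \<open>uv / vu = \<beta>(a, b) / \<beta>(b, a)\<close> without division.\<close>

definition q_commute :: "'a \<Rightarrow> 'g \<Rightarrow> 'a \<Rightarrow> 'g \<Rightarrow> bool" where
  "q_commute u a v b \<longleftrightarrow> u \<in> carrier A \<and> v \<in> carrier A \<and>
     \<beta> b a \<odot>\<^bsub>A\<^esub> (u \<otimes>\<^bsub>A\<^esub> v) = \<beta> a b \<odot>\<^bsub>A\<^esub> (v \<otimes>\<^bsub>A\<^esub> u)"

lemma q_commute_sym: "q_commute u a v b \<Longrightarrow> q_commute v b u a"
  by (auto simp: q_commute_def)

lemma q_commute_one: "v \<in> carrier A \<Longrightarrow> q_commute \<one>\<^bsub>A\<^esub> 0 v b"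
  by (simp add: q_commute_def)

lemma q_commute_mult:
  assumes "q_commute u a v b" "q_commute u' a' v b"
  shows "q_commute (u \<otimes>\<^bsub>A\<^esub> u') (a + a') v b"
proof -
  have cl: "u \<in> carrier A" "u' \<in> carrier A" "v \<in> carrier A"
    and 1: "\<beta> b a \<odot>\<^bsub>A\<^esub> (u \<otimes>\<^bsub>A\<^esub> v) = \<beta> a b \<odot>\<^bsub>A\<^esub> (v \<otimes>\<^bsub>A\<^esub> u)"
    and 2: "\<beta> b a' \<odot>\<^bsub>A\<^esub> (u' \<otimes>\<^bsub>A\<^esub> v) = \<beta> a' b \<odot>\<^bsub>A\<^esub> (v \<otimes>\<^bsub>A\<^esub> u')"
    using assms by (auto simp: q_commute_def)
  have "\<beta> b (a + a') \<odot>\<^bsub>A\<^esub> (u \<otimes>\<^bsub>A\<^esub> u' \<otimes>\<^bsub>A\<^esub> v) =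
      \<beta> b a \<odot>\<^bsub>A\<^esub> (u \<otimes>\<^bsub>A\<^esub> (\<beta> b a' \<odot>\<^bsub>A\<^esub> (u' \<otimes>\<^bsub>A\<^esub> v)))"
    using cl by (simp add: B.beta_add_right A.M.smult_assoc1 A.mult_smult A.A.m_assoc)
  also have "\<dots> = \<beta> a' b \<odot>\<^bsub>A\<^esub> ((\<beta> b a \<odot>\<^bsub>A\<^esub> (u \<otimes>\<^bsub>A\<^esub> v)) \<otimes>\<^bsub>A\<^esub> u')"
    unfolding 2 using cl
    by (simp add: A.M.smult_assoc1[symmetric] A.mult_smult A.smult_mult A.A.m_assoc A.K.m_comm)
  also have "\<dots> = \<beta> (a + a') b \<odot>\<^bsub>A\<^esub> (v \<otimes>\<^bsub>A\<^esub> (u \<otimes>\<^bsub>A\<^esub> u'))"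
    unfolding 1 using cl
    by (simp add: B.beta_add_left A.M.smult_assoc1[symmetric] A.smult_mult A.A.m_assoc A.K.m_comm)
  finally show ?thesis
    using cl by (simp add: q_commute_def)
qed

text \<open>The relation for \<open>u\<close> is multiplied by \<open>u'\<close> on both sides,
  which exchanges the two orders; the scalars are then adjusted using that \<open>\<beta>\<close> at
  \<open>- a\<close> is inverse to \<open>\<beta>\<close> at \<open>a\<close>.\<close>

lemma q_commute_inverse:
  assumes "q_commute u a v b" "u' \<in> carrier A" "u \<otimes>\<^bsub>A\<^esub> u' = \<one>\<^bsub>A\<^esub>" "u' \<otimes>\<^bsub>A\<^esub> u = \<one>\<^bsub>A\<^esub>"
  shows "q_commute u' (- a) v b"
proof -
  have cl: "u \<in> carrier A" "v \<in> carrier A"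
    and 1: "\<beta> b a \<odot>\<^bsub>A\<^esub> (u \<otimes>\<^bsub>A\<^esub> v) = \<beta> a b \<odot>\<^bsub>A\<^esub> (v \<otimes>\<^bsub>A\<^esub> u)"
    using assms by (auto simp: q_commute_def)
  have "\<beta> b a \<odot>\<^bsub>A\<^esub> (v \<otimes>\<^bsub>A\<^esub> u') = u' \<otimes>\<^bsub>A\<^esub> (\<beta> b a \<odot>\<^bsub>A\<^esub> (u \<otimes>\<^bsub>A\<^esub> v)) \<otimes>\<^bsub>A\<^esub> u'"
  proof -
    have "u' \<otimes>\<^bsub>A\<^esub> (u \<otimes>\<^bsub>A\<^esub> v) \<otimes>\<^bsub>A\<^esub> u' = v \<otimes>\<^bsub>A\<^esub> u'"
      using cl assms(2,4) by (simp add: A.A.m_assoc[symmetric])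
    then show ?thesis using cl assms(2) by (simp add: A.mult_smult A.smult_mult)
  qed
  also have "\<dots> = \<beta> a b \<odot>\<^bsub>A\<^esub> (u' \<otimes>\<^bsub>A\<^esub> v)"
  proof -
    have "u' \<otimes>\<^bsub>A\<^esub> (v \<otimes>\<^bsub>A\<^esub> u) \<otimes>\<^bsub>A\<^esub> u' = u' \<otimes>\<^bsub>A\<^esub> v"
      using cl assms(2,3) by (simp add: A.A.m_assoc)
    then show ?thesis unfolding 1 using cl assms(2) by (simp add: A.mult_smult A.smult_mult)
  qed
  finally have 2: "\<beta> b a \<odot>\<^bsub>A\<^esub> (v \<otimes>\<^bsub>A\<^esub> u') = \<beta> a b \<odot>\<^bsub>A\<^esub> (u' \<otimes>\<^bsub>A\<^esub> v)" .
  have inv: "\<beta> b (- a) \<otimes> \<beta> b a = \<one>" "\<beta> (- a) b \<otimes> \<beta> a b = \<one>"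
    using B.beta_add_right[of b "- a" a] B.beta_add_left[of "- a" a b] by simp_all
  have "\<beta> b (- a) \<odot>\<^bsub>A\<^esub> (u' \<otimes>\<^bsub>A\<^esub> v) = (\<beta> b (- a) \<otimes> (\<beta> (- a) b \<otimes> \<beta> a b)) \<odot>\<^bsub>A\<^esub> (u' \<otimes>\<^bsub>A\<^esub> v)"
    by (simp add: inv)
  also have "\<dots> = (\<beta> b (- a) \<otimes> \<beta> (- a) b) \<odot>\<^bsub>A\<^esub> (\<beta> a b \<odot>\<^bsub>A\<^esub> (u' \<otimes>\<^bsub>A\<^esub> v))"
    using cl assms(2) by (simp add: A.M.smult_assoc1)
  also have "\<dots> = (\<beta> (- a) b \<otimes> (\<beta> b (- a) \<otimes> \<beta> b a)) \<odot>\<^bsub>A\<^esub> (v \<otimes>\<^bsub>A\<^esub> u')"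
    unfolding 2[symmetric] using cl assms(2)
    by (simp add: A.M.smult_assoc1[symmetric] A.K.m_ac)
  also have "\<dots> = \<beta> (- a) b \<odot>\<^bsub>A\<^esub> (v \<otimes>\<^bsub>A\<^esub> u')"
    by (simp add: inv)
  finally show ?thesis using cl assms(2) by (simp add: q_commute_def)
qed

lemma q_commute_word:
  assumes g: "g \<in> X \<rightarrow> carrier A" and "v \<in> carrier A"
    and "\<And>x. x \<in> X \<Longrightarrow> q_commute (g x) (d x) v b" "w \<in> lists X"
  shows "q_commute (A.word_prod g w) (sum_list (map d w)) v b"
  using assms(4)
  by (induction w) (use assms(2,3) in \<open>auto intro: q_commute_one q_commute_mult\<close>)

text \<open>One argument at a time: first a letter against a word, using symmetry, then a word
  against a word.\<close>

lemma q_commute_words: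
  assumes g: "g \<in> X \<rightarrow> carrier A"
    and "\<And>x y. \<lbrakk>x \<in> X; y \<in> X\<rbrakk> \<Longrightarrow> q_commute (g x) (d x) (g y) (d y)"
    and "v \<in> lists X" "w \<in> lists X"
  shows "q_commute (A.word_prod g v) (sum_list (map d v)) (A.word_prod g w) (sum_list (map d w))"
proof (rule q_commute_word[OF g A.word_prod_closed[OF g assms(4)] _ assms(3)])
  fix x assume x: "x \<in> X"
  then have "g x \<in> carrier A" using g by auto
  then show "q_commute (g x) (d x) (A.word_prod g w) (sum_list (map d w))"
    using q_commute_word[OF g _ _ assms(4), of "g x" d "d x"] assms(2) x
    by (blast intro: q_commute_sym)
qed

end

section \<open>The torus: Laurent monomials, lifting of homomorphisms, units\<close>

definition torus_gens :: "nat \<Rightarrow> torus_gen set" where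
  "torus_gens n = TY ` {1..n} \<union> TYinv ` {1..n}"

definition torus_relations ::
    "('k, 'e) ring_scheme \<Rightarrow> nat \<Rightarrow> (nat \<Rightarrow> nat \<Rightarrow> 'k) \<Rightarrow>
      ((torus_gen list \<Rightarrow> 'k) \<times> (torus_gen list \<Rightarrow> 'k)) set" where
  "torus_relations K n \<Lambda> =
     (let A = free_algebra K (torus_gens n);
          y = (\<lambda>i. free_gen K (TY i));
          y' = (\<lambda>i. free_gen K (TYinv i))
      in {(y i \<otimes>\<^bsub>A\<^esub> y' i, \<one>\<^bsub>A\<^esub>) |i. i \<in> {1..n}} \<union>
         {(y' i \<otimes>\<^bsub>A\<^esub> y i, \<one>\<^bsub>A\<^esub>) |i. i \<in> {1..n}} \<union>
         {(y i \<otimes>\<^bsub>A\<^esub> y j, \<Lambda> i j \<odot>\<^bsub>A\<^esub> (y j \<otimes>\<^bsub>A\<^esub> y i)) |i j. i \<in> {1..n} \<and> j \<in> {1..n}})"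

lemma quantum_torus_eq:
  "quantum_torus K n \<Lambda> = presented_algebra K (torus_gens n) (torus_relations K n \<Lambda>)"
  by (simp add: quantum_torus_def torus_gens_def torus_relations_def Let_def)

fun torus_deg :: "torus_gen \<Rightarrow> nat \<Rightarrow>\<^sub>0 int" where
  "torus_deg (TY i) = ydeg i"
| "torus_deg (TYinv i) = - ydeg i"

lemma torus_deg_count:
  "Poly_Mapping.lookup (sum_list (map torus_deg w)) (2 * i) =
    int (count (mset w) (TY i)) - int (count (mset w) (TYinv i))"
proof (induction w)
  case (Cons x w)
  then show ?case by (cases x)
    (auto simp: Poly_Mapping.lookup_add Poly_Mapping.lookup_minus Poly_Mapping.lookup_single
      when_def ydeg_def)
qed simp

text \<open>Exactly one word for each Laurent monomial.\<close>

definition torus_reduced :: "torus_gen list set" where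
  "torus_reduced = range mset_word \<inter> {w. \<forall>i. \<not> (TY i \<in> set w \<and> TYinv i \<in> set w)}"

text \<open>The degree determines only the difference of the multiplicities of y_i and its inverse;
  in a reduced word one of them is zero, so both are known. The intersection with \<open>L\<close>
  fits the hypothesis of \<open>P_word_span\<close>.\<close>

lemma inj_torus_deg: "inj_on (\<lambda>w. sum_list (map torus_deg w)) (torus_reduced \<inter> L)"
proof (rule inj_onI)
  fix v w assume vw: "v \<in> torus_reduced \<inter> L" "w \<in> torus_reduced \<inter> L"
    and eq: "sum_list (map torus_deg v) = sum_list (map torus_deg w)"
  have diff: "int (count (mset v) (TY i)) - int (count (mset v) (TYinv i)) =
      int (count (mset w) (TY i)) - int (count (mset w) (TYinv i))" for i
    using torus_deg_count[of v i] torus_deg_count[of w i] eq by simp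
  have red: "count (mset u) (TY i) = 0 \<or> count (mset u) (TYinv i) = 0"
    if "u \<in> torus_reduced" for u i
    using that by (auto simp: torus_reduced_def count_eq_zero_iff)
  have "count (mset v) (TY i) = count (mset w) (TY i) \<and> count (mset v) (TYinv i) = count (mset w) (TYinv i)"
    for i
  proof -
    have "v \<in> torus_reduced" "w \<in> torus_reduced" using vw by simp_all
    from red[OF this(1), of i] red[OF this(2), of i] diff[of i] show ?thesis by linarith
  qed
  then have "count (mset v) x = count (mset w) x" for x by (cases x) simp_all
  then have "mset v = mset w" by (rule multiset_eqI)
  then show "v = w" using vw by (auto simp: torus_reduced_def)
qed

locale torus = antisymmetric_matrix K n \<Lambda>
  for K :: "('k, 'e) ring_scheme" (structure) and n :: nat and \<Lambda> :: "nat \<Rightarrow> nat \<Rightarrow> 'k"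

sublocale torus \<subseteq> presentation K "torus_gens n" "torus_relations K n \<Lambda>"
proof (unfold_locales)
  interpret A: assoc_alg K "free_algebra K (torus_gens n)" by (rule K.free_algebra_assoc_alg)
  have y: "free_gen K (TY i) \<in> carrier (free_algebra K (torus_gens n))"
    "free_gen K (TYinv i) \<in> carrier (free_algebra K (torus_gens n))" if "i \<in> {1..n}" for i
    using that unfolding K.free_gen_eq by (auto simp: torus_gens_def intro!: K.free_word_closed)
  show "torus_relations K n \<Lambda> \<subseteq>
      carrier (free_algebra K (torus_gens n)) \<times> carrier (free_algebra K (torus_gens n))"
    unfolding torus_relations_def Let_def
    by (auto simp: y simp del: atLeastAtMost_iff One_nat_def)
qed

context torus
begin

lemma gens_closed:
  "i \<in> {1..n} \<Longrightarrow> gen (TY i) \<in> carrier PA" "i \<in> {1..n} \<Longrightarrow> gen (TYinv i) \<in> carrier PA"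
  using gen_closed by (auto simp: torus_gens_def)

lemma free_gens_closed:
  "i \<in> {1..n} \<Longrightarrow> free_gen K (TY i) \<in> carrier FA" "i \<in> {1..n} \<Longrightarrow> free_gen K (TYinv i) \<in> carrier FA"
  using free_gen_closed by (auto simp: torus_gens_def)

lemma gen_inverse:
  assumes "i \<in> {1..n}"
  shows "gen (TY i) \<otimes>\<^bsub>PA\<^esub> gen (TYinv i) = \<one>\<^bsub>PA\<^esub>" "gen (TYinv i) \<otimes>\<^bsub>PA\<^esub> gen (TY i) = \<one>\<^bsub>PA\<^esub>"
proof -
  have "proj (free_gen K (TY i) \<otimes>\<^bsub>FA\<^esub> free_gen K (TYinv i)) = proj \<one>\<^bsub>FA\<^esub>"
    by (rule proj_relation) (use assms in \<open>unfold torus_relations_def Let_def, blast\<close>)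
  then show "gen (TY i) \<otimes>\<^bsub>PA\<^esub> gen (TYinv i) = \<one>\<^bsub>PA\<^esub>"
    using assms by (simp add: presented_gen_def proj_homD free_gens_closed)
  have "proj (free_gen K (TYinv i) \<otimes>\<^bsub>FA\<^esub> free_gen K (TY i)) = proj \<one>\<^bsub>FA\<^esub>"
    by (rule proj_relation) (use assms in \<open>unfold torus_relations_def Let_def, blast\<close>)
  then show "gen (TYinv i) \<otimes>\<^bsub>PA\<^esub> gen (TY i) = \<one>\<^bsub>PA\<^esub>"
    using assms by (simp add: presented_gen_def proj_homD free_gens_closed)
qed

lemma gen_rel:
  assumes "i \<in> {1..n}" "j \<in> {1..n}"
  shows "gen (TY i) \<otimes>\<^bsub>PA\<^esub> gen (TY j) = \<Lambda> i j \<odot>\<^bsub>PA\<^esub> (gen (TY j) \<otimes>\<^bsub>PA\<^esub> gen (TY i))"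
proof -
  have "proj (free_gen K (TY i) \<otimes>\<^bsub>FA\<^esub> free_gen K (TY j)) =
      proj (\<Lambda> i j \<odot>\<^bsub>FA\<^esub> (free_gen K (TY j) \<otimes>\<^bsub>FA\<^esub> free_gen K (TY i)))"
    by (rule proj_relation) (use assms in \<open>unfold torus_relations_def Let_def, blast\<close>)
  then show ?thesis
    using assms by (simp add: presented_gen_def proj_homD free_gens_closed)
qed

lemma torus_lift:
  assumes B: "assoc_alg K B"
    and h: "\<And>i. i \<in> {1..n} \<Longrightarrow> h i \<in> Units B"
    and comm: "\<And>i j. \<lbrakk>i \<in> {1..n}; j \<in> {1..n}\<rbrakk> \<Longrightarrow> h i \<otimes>\<^bsub>B\<^esub> h j = \<Lambda> i j \<odot>\<^bsub>B\<^esub> (h j \<otimes>\<^bsub>B\<^esub> h i)"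
  obtains \<phi> where "\<phi> \<in> assoc_algebra_hom K PA B" "\<forall>i\<in>{1..n}. \<phi> (gen (TY i)) = h i"
    "\<forall>i\<in>{1..n}. \<phi> (gen (TYinv i)) = inv\<^bsub>B\<^esub> (h i)"
proof -
  interpret B: assoc_alg K B by (rule B)
  define g where "g = (\<lambda>x. case x of TY i \<Rightarrow> h i | TYinv i \<Rightarrow> inv\<^bsub>B\<^esub> (h i))"
  have gs: "g (TY i) = h i" "g (TYinv i) = inv\<^bsub>B\<^esub> (h i)" for i by (simp_all add: g_def)
  have hc: "h i \<in> carrier B" "inv\<^bsub>B\<^esub> (h i) \<in> carrier B" if "i \<in> {1..n}" for i
    using h[OF that] by (auto intro: B.A.Units_closed B.A.Units_inv_closed)
  have g: "g \<in> torus_gens n \<rightarrow> carrier B"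
    using hc by (auto simp: torus_gens_def gs simp del: atLeastAtMost_iff)
  note hom = assoc_algebra_homD[OF B.free_eval_hom[OF g]]
  have ev: "B.free_eval g (free_gen K (TY i)) = h i" "B.free_eval g (free_gen K (TYinv i)) = inv\<^bsub>B\<^esub> (h i)"
    if "i \<in> {1..n}" for i
    using eval_gen[OF B g, of "TY i"] eval_gen[OF B g, of "TYinv i"] that
    by (simp_all add: torus_gens_def gs)
  note simps = hom free_gens_closed ev
  have "B.free_eval g u = B.free_eval g v" if E: "(u, v) \<in> torus_relations K n \<Lambda>" for u v
  proof -
    let ?y = "\<lambda>i. free_gen K (TY i)" and ?y' = "\<lambda>i. free_gen K (TYinv i)"
    from E consider
      (r_inv) i where "i \<in> {1..n}" "u = ?y i \<otimes>\<^bsub>FA\<^esub> ?y' i" "v = \<one>\<^bsub>FA\<^esub>"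
    | (l_inv) i where "i \<in> {1..n}" "u = ?y' i \<otimes>\<^bsub>FA\<^esub> ?y i" "v = \<one>\<^bsub>FA\<^esub>"
    | (yy) i j where "i \<in> {1..n}" "j \<in> {1..n}"
        "u = ?y i \<otimes>\<^bsub>FA\<^esub> ?y j" "v = \<Lambda> i j \<odot>\<^bsub>FA\<^esub> (?y j \<otimes>\<^bsub>FA\<^esub> ?y i)"
      unfolding torus_relations_def Let_def by blast
    then show ?thesis
    proof cases
      case i: r_inv
      show ?thesis
        unfolding i(2,3) using i(1) h[OF i(1)]
        by (simp add: simps B.A.Units_r_inv del: atLeastAtMost_iff)
    next
      case i: l_inv
      show ?thesis
        unfolding i(2,3) using i(1) h[OF i(1)]
        by (simp add: simps B.A.Units_l_inv del: atLeastAtMost_iff)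
    next
      case ij: yy
      show ?thesis
        unfolding ij(3,4) using ij(1,2) comm[OF ij(1,2)]
        by (simp add: simps del: atLeastAtMost_iff)
    qed
  qed
  from presented_lift[OF B g this] obtain \<phi> where \<phi>: "\<phi> \<in> assoc_algebra_hom K PA B"
    "\<And>x. x \<in> torus_gens n \<Longrightarrow> \<phi> (gen x) = g x" by blast
  show ?thesis
  proof (rule that[OF \<phi>(1)])
    have mem: "TY i \<in> torus_gens n" "TYinv i \<in> torus_gens n" if "i \<in> {1..n}" for i
      using that by (auto simp: torus_gens_def)
    show "\<forall>i\<in>{1..n}. \<phi> (gen (TY i)) = h i"
      by (intro ballI) (simp only: \<phi>(2)[OF mem(1)] gs)
    show "\<forall>i\<in>{1..n}. \<phi> (gen (TYinv i)) = inv\<^bsub>B\<^esub> (h i)"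
      by (intro ballI) (simp only: \<phi>(2)[OF mem(2)] gs)
  qed
qed

sublocale Q: graded_commutation K PA dbeta ..

lemma gen_q_commute:
  assumes "x \<in> torus_gens n" "y \<in> torus_gens n"
  shows "Q.q_commute (gen x) (torus_deg x) (gen y) (torus_deg y)"
proof -
  have yy: "Q.q_commute (gen (TY i)) (ydeg i) (gen (TY j)) (ydeg j)"
    if "i \<in> {1..n}" "j \<in> {1..n}" for i j
    unfolding Q.q_commute_def gen_rel[OF that] dbeta_swap_yy[OF that]
    using that gens_closed by (simp add: PA.M.smult_assoc1[symmetric] K.m_comm)
  have xy: "Q.q_commute (gen x) (torus_deg x) (gen (TY j)) (ydeg j)"
    if "x \<in> torus_gens n" "j \<in> {1..n}" for x j
    using that yy Q.q_commute_inverse[OF yy gens_closed(2) gen_inverse]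
    by (auto simp: torus_gens_def simp del: atLeastAtMost_iff)
  from assms(2) consider (y) j where "y = TY j" "j \<in> {1..n}" | (inv) j where "y = TYinv j" "j \<in> {1..n}"
    unfolding torus_gens_def by blast
  then show ?thesis
  proof cases
    case y
    then show ?thesis using xy[OF assms(1)] by simp
  next
    case j: inv
    have "Q.q_commute (gen (TYinv j)) (- ydeg j) (gen x) (torus_deg x)"
      by (rule Q.q_commute_inverse[OF Q.q_commute_sym[OF xy[OF assms(1) j(2)]]
            gens_closed(2)[OF j(2)] gen_inverse[OF j(2)]])
    then show ?thesis using j by (simp add: Q.q_commute_sym)
  qed
qed

lemma gen_commute:
  assumes "x \<in> torus_gens n" "y \<in> torus_gens n"
  shows "\<exists>c\<in>carrier K. \<exists>d\<in>carrier K.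
    gen x \<otimes>\<^bsub>PA\<^esub> gen y = c \<odot>\<^bsub>PA\<^esub> (gen y \<otimes>\<^bsub>PA\<^esub> gen x) \<oplus>\<^bsub>PA\<^esub> d \<odot>\<^bsub>PA\<^esub> \<one>\<^bsub>PA\<^esub>"
proof -
  let ?b = "dbeta (torus_deg y) (torus_deg x)" and ?c = "dbeta (torus_deg x) (torus_deg y)"
  have cl: "gen x \<in> carrier PA" "gen y \<in> carrier PA" using gen_closed assms by auto
  have b: "?b \<in> Units K" "inv ?b \<in> carrier K" using D.beta_Units by simp_all
  have "gen x \<otimes>\<^bsub>PA\<^esub> gen y = (inv ?b \<otimes> ?b) \<odot>\<^bsub>PA\<^esub> (gen x \<otimes>\<^bsub>PA\<^esub> gen y)"
    using cl b by simp
  also have "\<dots> = inv ?b \<odot>\<^bsub>PA\<^esub> (?b \<odot>\<^bsub>PA\<^esub> (gen x \<otimes>\<^bsub>PA\<^esub> gen y))"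
    using cl b by (subst PA.M.smult_assoc1) auto
  also have "?b \<odot>\<^bsub>PA\<^esub> (gen x \<otimes>\<^bsub>PA\<^esub> gen y) = ?c \<odot>\<^bsub>PA\<^esub> (gen y \<otimes>\<^bsub>PA\<^esub> gen x)"
    using gen_q_commute[OF assms] by (simp add: Q.q_commute_def)
  also have "inv ?b \<odot>\<^bsub>PA\<^esub> \<dots> = (inv ?b \<otimes> ?c) \<odot>\<^bsub>PA\<^esub> (gen y \<otimes>\<^bsub>PA\<^esub> gen x)"
    using cl b by (subst PA.M.smult_assoc1) auto
  finally show ?thesis
    using cl b by (intro bexI[of _ "inv ?b \<otimes> ?c"] bexI[of _ "\<zero>"]) auto
qed

lemma carrier_span: "carrier PA = PA.word_span gen (torus_gens n) torus_reduced"
proof (rule carrier_eq_word_span)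
  fix w assume "w \<in> lists (torus_gens n)"
  then show "PA.word_prod gen w \<in> PA.word_span gen (torus_gens n) torus_reduced"
  proof (rule PA.word_span_normal_forms[OF gen_closed gen_commute, rotated 3])
    fix w assume w: "w \<in> lists (torus_gens n)"
    show "\<exists>w'. mset w' = mset w \<and> (w' \<in> torus_reduced \<or>
        PA.word_prod gen w' \<in> PA.word_span gen (torus_gens n) {v. length v < length w})"
    proof (cases "mset_word (mset w) \<in> torus_reduced")
      case True
      then show ?thesis by (intro exI[of _ "mset_word (mset w)"]) simp
    next
      case False
      then obtain i where "TY i \<in> set (mset_word (mset w))" "TYinv i \<in> set (mset_word (mset w))"
        by (auto simp: torus_reduced_def)
      then have i: "TY i \<in># mset w" "TYinv i \<in># mset w"
        by (metis mset_mset_word set_mset_mset)+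
      \<comment> \<open>The letters left after removing one cancelling pair. With the pair placed in
        front of it, \<open>u\<close> becomes a rearrangement of \<open>w\<close> whose value is
        that of the shorter word \<open>u\<close>.\<close>
      define u where "u = mset_word (mset w - {#TY i#} - {#TYinv i#})"
      have "TYinv i \<in># mset w - {#TY i#}" using i by (simp add: in_diff_count)
      from insert_DiffM[OF this] insert_DiffM[OF i(1)]
      have ms: "mset (TY i # TYinv i # u) = mset w"
        unfolding u_def mset.simps mset_mset_word by (simp only:)
      then have "set w = set (TY i # TYinv i # u)" by (metis set_mset_mset)
      then have u: "u \<in> lists (torus_gens n)" "TY i \<in> torus_gens n"
        using w unfolding lists_eq_set by auto
      then have i': "i \<in> {1..n}" by (auto simp: torus_gens_def)
      have len: "length u < length w"
        using ms by (metis length_Cons lessI less_SucI size_mset)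
      have "PA.word_prod gen (TY i # TYinv i # u) = PA.word_prod gen u"
        using gens_closed[OF i'] gen_inverse[OF i'] PA.word_prod_closed[OF gen_closed u(1)]
        by (simp add: PA.A.m_assoc[symmetric])
      then show ?thesis
        using ms PA.word_span_word[OF gen_closed _ u(1), of "{v. length v < length w}"] len
        by (intro exI[of _ "TY i # TYinv i # u"]) simp
    qed
  qed
qed

lemma gen_Units:
  assumes "x \<in> torus_gens n"
  shows "gen x \<in> Units PA"
proof -
  obtain i where i: "i \<in> {1..n}" "x = TY i \<or> x = TYinv i"
    using assms unfolding torus_gens_def by blast
  show ?thesis
    using i(2) gens_closed[OF i(1)] gen_inverse[OF i(1)] unfolding Units_def by blast
qed

lemma word_Units: "w \<in> lists (torus_gens n) \<Longrightarrow> PA.word_prod gen w \<in> Units PA"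
proof (induction w)
  case (Cons x w)
  have "gen x \<in> Units PA"
    using gen_Units Cons by auto
  then show ?case using Cons by auto
qed simp

text \<open>Because all integer exponents occur, a degree of the skew field that has x-coordinates
  can be replaced by the degree of a Laurent monomial with the same weights.\<close>

lemma word_with_exponents:
  obtains w where "w \<in> lists (torus_gens n)"
    "\<And>i. i \<in> {1..n} \<Longrightarrow> expo (sum_list (map torus_deg w)) i = a i"
proof -
  have ex: "expo (sum_list (map torus_deg w)) i =
      int (count (mset w) (TY i)) - int (count (mset w) (TYinv i))" for w i
  proof -
    have "Poly_Mapping.lookup (sum_list (map torus_deg w)) (2 * i + 1) = 0"
    proof (induction w)
      case (Cons x w)
      have *: "(2 * j = Suc (2 * k)) = False" "(Suc (2 * k) = 2 * j) = False" for j k :: nat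
        by presburger+
      from Cons show ?case by (cases x)
        (auto simp: Poly_Mapping.lookup_add Poly_Mapping.lookup_minus Poly_Mapping.lookup_single
          when_def ydeg_def *)
    qed simp
    then show ?thesis by (simp only: expo_def torus_deg_count)
  qed
  have "\<exists>w\<in>lists (torus_gens n). \<forall>i. expo (sum_list (map torus_deg w)) i = (if i \<in> {1..j} then a i else 0)"
    if "j \<le> n" for j
    using that
  proof (induction j)
    case 0
    then show ?case by (intro bexI[of _ "[]"]) (simp_all add: expo_def)
  next
    case (Suc j)
    then obtain w where w: "w \<in> lists (torus_gens n)"
      "\<And>i. expo (sum_list (map torus_deg w)) i = (if i \<in> {1..j} then a i else 0)" by auto
    \<comment> \<open>Truncation by \<open>nat\<close> leaves at least one of the two blocks empty,
      according to the sign of the exponent.\<close>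
    let ?w = "w @ replicate (nat (a (Suc j))) (TY (Suc j)) @ replicate (nat (- a (Suc j))) (TYinv (Suc j))"
    have "set ?w \<subseteq> torus_gens n"
      using w(1) Suc.prems by (auto simp: torus_gens_def lists_eq_set)
    then have "?w \<in> lists (torus_gens n)" by (auto simp: lists_eq_set)
    moreover have "expo (sum_list (map torus_deg ?w)) i = (if i \<in> {1..Suc j} then a i else 0)" for i
      using w(2)[of i] unfolding ex by (auto simp: le_Suc_eq)
    ultimately show ?case by blast
  qed
  from this[of n] that show ?thesis by force
qed

end

section \<open>Maximality\<close>

text \<open>Distinct reduced words go to elements of distinct leading degrees, so the homomorphism
  given by the universal property is injective, and its image is the subalgebra.\<close>

lemma torus_subalgebra:
  fixes F :: "('k, 'f, 'm) module_scheme"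
  assumes "torus K n \<Lambda>" "skew_field F" "assoc_alg K F"
    and "total_leading K F (antisymmetric_matrix.dbeta K n \<Lambda>) P"
    and y: "\<And>i. i \<in> {1..n} \<Longrightarrow> y i \<in> P (ydeg i) \<one>\<^bsub>K\<^esub>"
    and comm: "\<And>i j. \<lbrakk>i \<in> {1..n}; j \<in> {1..n}\<rbrakk> \<Longrightarrow> y i \<otimes>\<^bsub>F\<^esub> y j = \<Lambda> i j \<odot>\<^bsub>F\<^esub> (y j \<otimes>\<^bsub>F\<^esub> y i)"
  shows "\<exists>B. assoc_subalgebra K B F \<and> assoc_algebra_iso K (quantum_torus K n \<Lambda>) (F\<lparr>carrier := B\<rparr>) \<noteq> {}"
proof -
  interpret T: torus K n \<Lambda> by fact
  interpret F: total_leading K F T.dbeta P by fact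
  have U: "y i \<in> Units F" if "i \<in> {1..n}" for i
    using assms(2) F.P_carrier[OF y[OF that]] F.P_nonzero[OF y[OF that]]
    by (auto simp: skew_field_def)
  obtain \<phi> where \<phi>: "\<phi> \<in> assoc_algebra_hom K T.PA F" "\<forall>i\<in>{1..n}. \<phi> (T.gen (TY i)) = y i"
    "\<forall>i\<in>{1..n}. \<phi> (T.gen (TYinv i)) = inv\<^bsub>F\<^esub> (y i)"
    using T.torus_lift[OF assms(3) U comm] by metis
  note hom = assoc_algebra_homD[OF \<phi>(1)]
  interpret \<phi>: ring_hom_ring T.PA F \<phi>
    by (rule ring_hom_ringI2[OF T.PA.A.ring_axioms F.A.ring_axioms hom(1)])
  have cg: "\<phi> \<circ> T.gen \<in> torus_gens n \<rightarrow> carrier F"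
    using T.gen_closed hom(3) by (simp add: Pi_iff)
  have lead: "\<exists>c. c \<noteq> \<zero>\<^bsub>K\<^esub> \<and> (\<phi> \<circ> T.gen) x \<in> P (torus_deg x) c" if "x \<in> torus_gens n" for x
  proof -
    from that consider (y) i where "x = TY i" "i \<in> {1..n}"
      | (inv) i where "x = TYinv i" "i \<in> {1..n}"
      unfolding torus_gens_def by blast
    then show ?thesis
    proof cases
      case i: y
      then show ?thesis using y[OF i(2)] bspec[OF \<phi>(2) i(2)]
        by (intro exI[of _ "\<one>\<^bsub>K\<^esub>"]) simp
    next
      case i: inv
      then show ?thesis
        using F.P_inverse[OF assms(2) y[OF i(2)], of "inv\<^bsub>F\<^esub> (y i)"] U[OF i(2)]
          bspec[OF \<phi>(3) i(2)] by simp
    qed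
  qed
  have ker: "z = \<zero>\<^bsub>T.PA\<^esub>" if z: "z \<in> carrier T.PA" "\<phi> z = \<zero>\<^bsub>F\<^esub>" for z
  proof -
    obtain f where f: "f \<in> carrier T.FA" "\<forall>w. f w \<noteq> \<zero>\<^bsub>K\<^esub> \<longrightarrow> w \<in> torus_reduced"
      "z = T.PA.free_eval T.gen f"
      using T.PA.word_spanE[OF z(1)[unfolded T.carrier_span]] by metis
    have "\<phi> z = F.free_eval (\<phi> \<circ> T.gen) f"
      unfolding f(3)
      by (rule assoc_algebra_hom_free_eval[OF T.PA.assoc_alg_axioms assms(3) \<phi>(1) T.gen_closed f(1)])
    then have "f = (\<lambda>w. \<zero>\<^bsub>K\<^esub>)"
      using F.P_word_span[OF cg lead inj_torus_deg f(1) f(2)[rule_format]] z(2) F.P_nonzero by metis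
    then show ?thesis using f(3) T.PA.free_eval_zero[OF T.gen_closed] by simp
  qed
  let ?B = "\<phi> ` carrier T.PA"
  have "subring ?B F"
    by (rule \<phi>.img_is_subring[OF T.PA.A.carrier_is_subring])
  moreover have "c \<odot>\<^bsub>F\<^esub> x \<in> ?B" if c: "c \<in> carrier K" and x: "x \<in> ?B" for c x
  proof -
    obtain z where z: "z \<in> carrier T.PA" "x = \<phi> z" using x by blast
    show ?thesis
      unfolding z(2) hom(2)[OF c z(1), symmetric]
      by (rule imageI) (rule T.PA.M.smult_closed[OF c z(1)])
  qed
  ultimately have "assoc_subalgebra K ?B F" by (simp add: assoc_subalgebra_def)
  moreover have "\<phi> \<in> assoc_algebra_iso K T.PA (F\<lparr>carrier := ?B\<rparr>)"
    unfolding assoc_algebra_iso_def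
  proof (intro CollectI conjI)
    show "\<phi> \<in> assoc_algebra_hom K T.PA (F\<lparr>carrier := ?B\<rparr>)"
      by (rule assoc_algebra_homI) (simp_all add: hom)
    have "inj_on \<phi> (carrier T.PA)"
    proof (rule inj_onI)
      fix v w assume vw: "v \<in> carrier T.PA" "w \<in> carrier T.PA" "\<phi> v = \<phi> w"
      have "\<phi> (v \<ominus>\<^bsub>T.PA\<^esub> w) = \<zero>\<^bsub>F\<^esub>"
        unfolding a_minus_def using vw hom(3)[OF vw(2)] by (simp add: F.A.r_neg)
      then have "v \<ominus>\<^bsub>T.PA\<^esub> w = \<zero>\<^bsub>T.PA\<^esub>" using ker vw by simp
      then show "v = w" using vw by simp
    qed
    then show "bij_betw \<phi> (carrier T.PA) (carrier (F\<lparr>carrier := ?B\<rparr>))"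
      by (simp add: bij_betw_def)
  qed
  ultimately show ?thesis
    unfolding quantum_torus_eq by blast
qed

text \<open>The given homomorphism is used only through the leading terms of the images of the
  generators. Their degrees satisfy the relations of \<open>M\<close> under the bicharacter, and
  Laurent monomials of the same weights then satisfy them exactly, since monomials commute up to a
  bicharacter scalar without lower terms.\<close>

lemma torus_hom_from_leading_terms:
  fixes F :: "('k, 'f, 'm) module_scheme"
  assumes "torus K n \<Lambda>" "torus K m M"
    and "total_leading K F (antisymmetric_matrix.dbeta K n \<Lambda>) P" "\<one>\<^bsub>F\<^esub> \<noteq> \<zero>\<^bsub>F\<^esub>"
    and \<psi>: "\<psi> \<in> assoc_algebra_hom K (quantum_torus K m M) F"
  shows "assoc_algebra_hom K (quantum_torus K m M) (quantum_torus K n \<Lambda>) \<noteq> {}"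
proof -
  interpret T: torus K n \<Lambda> by fact
  interpret M: torus K m M by fact
  interpret F: total_leading K F T.dbeta P by fact
  note hom = assoc_algebra_homD[OF \<psi>[unfolded quantum_torus_eq]]
  define f where "f i = \<psi> (M.gen (TY i))" for i
  have f: "f i \<in> carrier F" if "i \<in> {1..m}" for i
    using that hom(3) M.gens_closed by (simp add: f_def)
  have nz: "f i \<noteq> \<zero>\<^bsub>F\<^esub>" if i: "i \<in> {1..m}" for i
  proof
    assume "f i = \<zero>\<^bsub>F\<^esub>"
    moreover have "f i \<otimes>\<^bsub>F\<^esub> \<psi> (M.gen (TYinv i)) = \<one>\<^bsub>F\<^esub>"
      using M.gen_inverse(1)[OF i] hom(4)[OF M.gens_closed[OF i]] hom(6) by (simp add: f_def)
    ultimately show False using hom(3)[OF M.gens_closed(2)[OF i]] assms(4) by simp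
  qed
  have "\<forall>i\<in>{1..m}. \<exists>a c. c \<noteq> \<zero>\<^bsub>K\<^esub> \<and> f i \<in> P a c"
    using F.P_total f nz by blast
  then obtain a c where ac: "\<And>i. i \<in> {1..m} \<Longrightarrow> c i \<noteq> \<zero>\<^bsub>K\<^esub>" "\<And>i. i \<in> {1..m} \<Longrightarrow> f i \<in> P (a i) (c i)"
    by metis
  \<comment> \<open>Leading coefficients are compared in the relation between \<open>f i\<close> and
    \<open>f j\<close>. Both sides lie in degree \<open>a i + a j\<close>, and the nonzero factor
    \<open>c i \<otimes> c j\<close> cancels because \<open>K\<close> is commutative.\<close>
  have beta: "T.dbeta (a i) (a j) = M i j \<otimes>\<^bsub>K\<^esub> T.dbeta (a j) (a i)"
    if ij: "i \<in> {1..m}" "j \<in> {1..m}" for i j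
  proof -
    have cc: "c i \<in> carrier K" "c j \<in> carrier K" using F.P_coeff ac ij by blast+
    have "f i \<otimes>\<^bsub>F\<^esub> f j = M i j \<odot>\<^bsub>F\<^esub> (f j \<otimes>\<^bsub>F\<^esub> f i)"
      using arg_cong[OF M.gen_rel[OF ij], of \<psi>] ij M.gens_closed hom by (simp add: f_def)
    moreover have "M i j \<odot>\<^bsub>F\<^esub> (f j \<otimes>\<^bsub>F\<^esub> f i) \<in>
        P (a j + a i) (M i j \<otimes>\<^bsub>K\<^esub> (c j \<otimes>\<^bsub>K\<^esub> c i \<otimes>\<^bsub>K\<^esub> T.dbeta (a j) (a i)))"
      using ac ij by (intro F.P_smult F.P_mult M.Lambda_closed) auto
    moreover have "f i \<otimes>\<^bsub>F\<^esub> f j \<in> P (a j + a i) (c i \<otimes>\<^bsub>K\<^esub> c j \<otimes>\<^bsub>K\<^esub> T.dbeta (a i) (a j))"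
      using F.P_mult[OF ac(2)[OF ij(1)] ac(2)[OF ij(2)]] by (simp add: add.commute)
    ultimately have "c i \<otimes>\<^bsub>K\<^esub> c j \<otimes>\<^bsub>K\<^esub> T.dbeta (a i) (a j) =
        M i j \<otimes>\<^bsub>K\<^esub> (c j \<otimes>\<^bsub>K\<^esub> c i \<otimes>\<^bsub>K\<^esub> T.dbeta (a j) (a i))"
      using F.P_unique_coeff by metis
    then have "(c i \<otimes>\<^bsub>K\<^esub> c j) \<otimes>\<^bsub>K\<^esub> T.dbeta (a i) (a j) =
        (c i \<otimes>\<^bsub>K\<^esub> c j) \<otimes>\<^bsub>K\<^esub> (M i j \<otimes>\<^bsub>K\<^esub> T.dbeta (a j) (a i))"
      using cc ij by (simp add: T.K.m_ac)
    moreover have "c i \<otimes>\<^bsub>K\<^esub> c j \<noteq> \<zero>\<^bsub>K\<^esub>" using cc ac(1) ij by (simp add: T.K.integral_iff)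
    ultimately show ?thesis
      using cc ij T.K.m_lcancel[of "c i \<otimes>\<^bsub>K\<^esub> c j"] by simp
  qed
  \<comment> \<open>\<open>a i\<close> may have x-coordinates, which no word of the torus has. But
    \<open>dbeta\<close> depends on degrees only through \<open>expo\<close> at the indices up to
    \<open>n\<close>, and these values are realised by a word.\<close>
  have "\<forall>i. \<exists>w\<in>lists (torus_gens n). \<forall>k\<in>{1..n}. expo (sum_list (map torus_deg w)) k = expo (a i) k"
    using T.word_with_exponents by metis
  then obtain w where w: "\<And>i. w i \<in> lists (torus_gens n)"
    "\<And>i k. k \<in> {1..n} \<Longrightarrow> expo (sum_list (map torus_deg (w i))) k = expo (a i) k"
    by metis
  define h where "h i = T.PA.word_prod T.gen (w i)" for i
  define d where "d i = sum_list (map torus_deg (w i))" for i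
  have hU: "h i \<in> Units T.PA" "h i \<in> carrier T.PA" for i
    using T.word_Units[OF w(1)] by (auto simp: h_def)
  have d: "T.dbeta (d i) (d j) = T.dbeta (a i) (a j)" for i j
    unfolding T.dbeta_def by (rule T.qbeta_cong) (simp_all add: d_def w(2))
  have "h i \<otimes>\<^bsub>T.PA\<^esub> h j = M i j \<odot>\<^bsub>T.PA\<^esub> (h j \<otimes>\<^bsub>T.PA\<^esub> h i)"
    if ij: "i \<in> {1..m}" "j \<in> {1..m}" for i j
  proof -
    have "T.Q.q_commute (h i) (d i) (h j) (d j)"
      unfolding h_def d_def
      by (rule T.Q.q_commute_words[OF T.gen_closed T.gen_q_commute w(1) w(1)])
    then have "T.dbeta (a j) (a i) \<odot>\<^bsub>T.PA\<^esub> (h i \<otimes>\<^bsub>T.PA\<^esub> h j) =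
        (M i j \<otimes>\<^bsub>K\<^esub> T.dbeta (a j) (a i)) \<odot>\<^bsub>T.PA\<^esub> (h j \<otimes>\<^bsub>T.PA\<^esub> h i)"
      unfolding T.Q.q_commute_def d beta[OF ij] by simp
    also have "\<dots> = T.dbeta (a j) (a i) \<odot>\<^bsub>T.PA\<^esub> (M i j \<odot>\<^bsub>T.PA\<^esub> (h j \<otimes>\<^bsub>T.PA\<^esub> h i))"
      using ij hU by (simp add: T.PA.M.smult_assoc1[symmetric] T.K.m_comm)
    finally show ?thesis
      by (rule T.PA.smult_cancel[OF T.D.beta_Units, rotated 2]) (use ij hU in auto)
  qed
  from M.torus_lift[OF T.PA.assoc_alg_axioms hU(1) this]
  obtain \<phi> where "\<phi> \<in> assoc_algebra_hom K M.PA T.PA" by metis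
  then show ?thesis by (auto simp only: quantum_torus_eq)
qed

theorem proposition4p3p1:
  fixes K :: "('k, 'e) ring_scheme"
    and n r :: nat
    and \<Lambda> :: "nat \<Rightarrow> nat \<Rightarrow> 'k"
    and F :: "('k, 'f, 'm) module_scheme"
    and \<iota> :: "(S_gen list \<Rightarrow> 'k) set \<Rightarrow> 'f"
  assumes "field K"
    and "\<And>p::nat. p > 0 \<Longrightarrow> [p] \<cdot>\<^bsub>K\<^esub> \<one>\<^bsub>K\<^esub> \<noteq> \<zero>\<^bsub>K\<^esub>"
    and "n \<ge> 1" and "r \<le> n"
    and "mult_antisymmetric K n \<Lambda>"
    and "skew_field_of_fractions K (S_algebra K n r \<Lambda>) F \<iota>"
  shows "maximal_quantum_subtorus K n \<Lambda> F"
proof -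
  interpret S: S_alg K n \<Lambda> r
    using assms by (intro S_alg.intro antisymmetric_matrix.intro antisymmetric_matrix_axioms.intro
        S_alg_axioms.intro)
  obtain P where P: "total_leading K S.PA S.dbeta P"
    and y: "\<And>i. i \<in> {1..n} \<Longrightarrow> S.gen (SY i) \<in> P (ydeg i) \<one>\<^bsub>K\<^esub>"
    using S.S_leading by blast
  interpret P: total_leading K S.PA S.dbeta P by (rule P)
  interpret F: lead_fractions K S.PA S.dbeta P F \<iota>
    using assms(6) unfolding S_algebra_eq
    by (intro lead_fractions.intro lead_fractions_axioms.intro P)
  have T: "torus K n \<Lambda>"
    by (intro torus.intro S.antisymmetric_matrix_axioms)
  show ?thesis
    unfolding maximal_quantum_subtorus_def
  proof (intro conjI allI impI)
    show "\<exists>B. assoc_subalgebra K B F \<and> assoc_algebra_iso K (quantum_torus K n \<Lambda>) (F\<lparr>carrier := B\<rparr>) \<noteq> {}"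
    \<comment> \<open>The torus is generated by the images of the y_i of \<open>S\<close> and their
      inverses.\<close>
    proof (rule torus_subalgebra[OF T F.skew F.F.assoc_alg_axioms F.total_leading_fractions])
      show "\<iota> (S.gen (SY i)) \<in> F.frac_lead (ydeg i) \<one>\<^bsub>K\<^esub>" if "i \<in> {1..n}" for i
        by (rule F.frac_lead_iota[OF y[OF that]])
      show "\<iota> (S.gen (SY i)) \<otimes>\<^bsub>F\<^esub> \<iota> (S.gen (SY j)) =
          \<Lambda> i j \<odot>\<^bsub>F\<^esub> (\<iota> (S.gen (SY j)) \<otimes>\<^bsub>F\<^esub> \<iota> (S.gen (SY i)))"
        if ij: "i \<in> {1..n}" "j \<in> {1..n}" for i j
        using arg_cong[OF S.gen_rel_yy[OF ij], of \<iota>] ij S.gens_closed F.iota by simp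
    qed
    fix m M
    assume M: "mult_antisymmetric K m M"
      and "assoc_algebra_hom K (quantum_torus K m M) F \<noteq> {}"
    then obtain \<psi> where \<psi>: "\<psi> \<in> assoc_algebra_hom K (quantum_torus K m M) F" by blast
    have "torus K m M"
      using assms(1) M by (intro torus.intro antisymmetric_matrix.intro antisymmetric_matrix_axioms.intro)
    then show "assoc_algebra_hom K (quantum_torus K m M) (quantum_torus K n \<Lambda>) \<noteq> {}"
      by (rule torus_hom_from_leading_terms[OF T _ F.total_leading_fractions F.F_one \<psi>])
  qed
qed

end
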